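(* Let $G$ be a countable discrete group acting on a second countable, locally compact, Hausdorff topological space $X$, let $Y\subset X$ be a clopen subset with $GY=X$, and let $N\colon G\to(0,+\infty)$ be a homomorphism, with associated dynamics $\sigma$ on $C^*_r(G\boxtimes Y)$. Define $Y_0=Y\setminus\bigcup_{\{g\in G\colon N(g)>1\}}gY$. Assume $Y_0$ has the property that if $gY_0\cap Y_0\ne\emptyset$ for some $g\in G$ then $g=e$. Then the map $\mu\mapsto\mu_*\circ E$ is an affine isomorphism between the Borel probability measures on $Y$ supported on $Y_0$ and the ground states on $C^*_r(G\boxtimes Y)$.
   Context: $G\boxtimes Y=\{(g,x)\mid x\in Y,\ gx\in Y\}$ is a subgroupoid of the transformation groupoid $G\times X$, and $C^*_r(G\boxtimes Y)=\mathbf 1_Y(C_0(X)\rtimes_rG)\mathbf 1_Y$ is its reduced C$^*$-algebra, where $\mathbf 1_Y$ is the characteristic function of $Y$. The dynamics is $\sigma_t(f)(g,x)=N(g)^{it}f(g,x)$ for $t\in\mathbb R$ and $f\in C_c(G\boxtimes Y)$. A $\sigma$-invariant state $\varphi$ is called a ground state if the holomorphic function $z\mapsto\varphi(a\sigma_z(b))$ is bounded on the upper half-plane for $a$ and $b$ in a set of $\sigma$-analytic elements spanning a dense subspace. $E\colon C_0(X)\rtimes_rG\to C_0(X)$ is the canonical conditional expectation: with $u_g$ the unitary in the multiplier algebra corresponding to $g\in G$, $E(fu_g)=f$ if $g=e$ and $0$ otherwise; it maps $C^*_r(G\boxtimes Y)$ onto $C_0(Y)$. For a measure $\mu$, $\mu_*$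 denotes the functional $f\mapsto\int f\,d\mu$, and $\mu_*\circ E$ is regarded as a functional on $C^*_r(G\boxtimes Y)$. *)

theory Defs
  imports "HOL-Probability.Probability"
begin

section \<open>The complex Hilbert space of square-summable families\<close>

typedef 'i ell2 = "{\<xi> :: 'i \<Rightarrow> complex. (\<lambda>i. (cmod (\<xi> i))\<^sup>2) summable_on UNIV}"
  morphisms coord Abs_ell2
  by (rule exI[of _ "\<lambda>_. 0"]) simp

setup_lifting type_definition_ell2

lemma ell2_prod_summable:
  fixes \<xi> \<eta> :: "'i \<Rightarrow> complex"
  assumes "(\<lambda>i. (cmod (\<xi> i))\<^sup>2) summable_on UNIV" "(\<lambda>i. (cmod (\<eta> i))\<^sup>2) summable_on UNIV"
  shows "(\<lambda>i. \<xi> i * cnj (\<eta> i)) summable_on UNIV"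
proof -
  have s: "(\<lambda>i. (cmod (\<xi> i))\<^sup>2 + (cmod (\<eta> i))\<^sup>2) summable_on UNIV"
    using assms by (rule summable_on_add)
  have b: "cmod (\<xi> i * cnj (\<eta> i)) \<le> (cmod (\<xi> i))\<^sup>2 + (cmod (\<eta> i))\<^sup>2" for i
  proof -
    have "2 * (cmod (\<xi> i) * cmod (\<eta> i)) \<le> (cmod (\<xi> i))\<^sup>2 + (cmod (\<eta> i))\<^sup>2"
      using sum_squares_bound[of "cmod (\<xi> i)" "cmod (\<eta> i)"] by (simp add: mult.assoc)
    moreover have "0 \<le> cmod (\<xi> i) * cmod (\<eta> i)" by simp
    ultimately show ?thesis unfolding norm_mult complex_mod_cnj by linarith
  qed
  have "(\<lambda>i. norm (\<xi> i * cnj (\<eta> i))) summable_on UNIV"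
    by (rule Infinite_Sum.abs_summable_on_comparison_test'[OF s]) (use b in auto)
  then show ?thesis by (rule abs_summable_summable)
qed

lemma ell2_cmult_summable:
  fixes \<xi> d :: "'i \<Rightarrow> complex"
  assumes "(\<lambda>i. (cmod (\<xi> i))\<^sup>2) summable_on UNIV" "\<And>i. cmod (d i) \<le> K"
  shows "(\<lambda>i. (cmod (d i * \<xi> i))\<^sup>2) summable_on UNIV"
proof (rule summable_on_comparison_test)
  show "(\<lambda>i. K\<^sup>2 * (cmod (\<xi> i))\<^sup>2) summable_on UNIV"
    using assms(1) by (rule summable_on_cmult_right)
  show "(cmod (d i * \<xi> i))\<^sup>2 \<le> K\<^sup>2 * (cmod (\<xi> i))\<^sup>2" for i
    by (simp add: norm_mult power_mult_distrib assms(2) mult_right_mono power_mono)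
qed auto

lemma ell2_add_summable:
  fixes \<xi> \<eta> :: "'i \<Rightarrow> complex"
  assumes "(\<lambda>i. (cmod (\<xi> i))\<^sup>2) summable_on UNIV" "(\<lambda>i. (cmod (\<eta> i))\<^sup>2) summable_on UNIV"
  shows "(\<lambda>i. (cmod (\<xi> i + \<eta> i))\<^sup>2) summable_on UNIV"
proof (rule summable_on_comparison_test)
  show "(\<lambda>i. 2 * ((cmod (\<xi> i))\<^sup>2 + (cmod (\<eta> i))\<^sup>2)) summable_on UNIV"
    using assms by (intro summable_on_cmult_right summable_on_add)
  show "(cmod (\<xi> i + \<eta> i))\<^sup>2 \<le> 2 * ((cmod (\<xi> i))\<^sup>2 + (cmod (\<eta> i))\<^sup>2)" for i
  proof -
    have "(cmod (\<xi> i + \<eta> i))\<^sup>2 \<le> (cmod (\<xi> i) + cmod (\<eta> i))\<^sup>2"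
      by (intro power_mono norm_triangle_ineq norm_ge_zero)
    also have "\<dots> \<le> 2 * ((cmod (\<xi> i))\<^sup>2 + (cmod (\<eta> i))\<^sup>2)"
      using sum_squares_bound[of "cmod (\<xi> i)" "cmod (\<eta> i)"]
      by (simp add: power2_sum)
    finally show ?thesis .
  qed
qed auto

lemma coord_summable: "(\<lambda>i. (cmod (coord \<xi> i))\<^sup>2) summable_on UNIV"
  using coord[of \<xi>] by simp

instantiation ell2 :: (type) real_vector
begin

lift_definition zero_ell2 :: "'a ell2" is "\<lambda>_. 0" by simp
lift_definition plus_ell2 :: "'a ell2 \<Rightarrow> 'a ell2 \<Rightarrow> 'a ell2" is "\<lambda>\<xi> \<eta> i. \<xi> i + \<eta> i"
  by (simp add: ell2_add_summable)
lift_definition uminus_ell2 :: "'a ell2 \<Rightarrow> 'a ell2" is "\<lambda>\<xi> i. - \<xi> i" by simp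
definition minus_ell2 :: "'a ell2 \<Rightarrow> 'a ell2 \<Rightarrow> 'a ell2" where "minus_ell2 \<xi> \<eta> = \<xi> + - \<eta>"
lift_definition scaleR_ell2 :: "real \<Rightarrow> 'a ell2 \<Rightarrow> 'a ell2" is "\<lambda>r \<xi> i. complex_of_real r * \<xi> i"
  by (rule ell2_cmult_summable) auto

instance
  by standard (unfold minus_ell2_def, (transfer; simp add: algebra_simps fun_eq_iff)+)

end

lemma coord_simps [simp]:
  "coord 0 i = 0" "coord (\<xi> + \<eta>) i = coord \<xi> i + coord \<eta> i" "coord (- \<xi>) i = - coord \<xi> i"
  "coord (\<xi> - \<eta>) i = coord \<xi> i - coord \<eta> i" "coord (r *\<^sub>R \<xi>) i = of_real r * coord \<xi> i"
  unfolding minus_ell2_def by (transfer; simp)+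

lemma ell2_eqI: "(\<And>i. coord \<xi> i = coord \<eta> i) \<Longrightarrow> \<xi> = \<eta>"
  by transfer auto

text \<open>The inner product is linear in the first variable; its real part makes \<open>ell2\<close> a real
  inner product space with the usual norm.\<close>

definition cinner :: "'i ell2 \<Rightarrow> 'i ell2 \<Rightarrow> complex" where
  "cinner \<xi> \<eta> = (\<Sum>\<^sub>\<infinity>i. coord \<xi> i * cnj (coord \<eta> i))"

lemma cinner_summable: "(\<lambda>i. coord \<xi> i * cnj (coord \<eta> i)) summable_on UNIV"
  by (intro ell2_prod_summable coord_summable)

lemma cinner_self: "cinner \<xi> \<xi> = of_real (\<Sum>\<^sub>\<infinity>i. (cmod (coord \<xi> i))\<^sup>2)"
  unfolding cinner_def complex_norm_square[symmetric]
  by (rule infsumI[OF has_sum_of_real[OF has_sum_infsum[OF coord_summable]]])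

instantiation ell2 :: (type) real_inner
begin

definition "inner \<xi> \<eta> = Re (cinner \<xi> \<eta>)" for \<xi> \<eta> :: "'a ell2"
definition "norm \<xi> = sqrt (inner \<xi> \<xi>)" for \<xi> :: "'a ell2"
definition "dist \<xi> \<eta> = norm (\<xi> - \<eta>)" for \<xi> \<eta> :: "'a ell2"
definition "sgn \<xi> = \<xi> /\<^sub>R norm \<xi>" for \<xi> :: "'a ell2"
definition [code del]:
  "(uniformity :: ('a ell2 \<times> 'a ell2) filter) = (INF e\<in>{0<..}. principal {(x, y). dist x y < e})"
definition [code del]:
  "open U \<longleftrightarrow> (\<forall>x\<in>U. eventually (\<lambda>(x', y). x' = x \<longrightarrow> y \<in> U) uniformity)" for U :: "'a ell2 set"

instance
proof
  fix \<xi> \<eta> \<zeta> :: "'a ell2" and r :: real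
  have "cinner \<eta> \<xi> = cnj (cinner \<xi> \<eta>)"
    unfolding cinner_def infsum_cnj[symmetric] by (simp add: mult.commute)
  then show "inner \<xi> \<eta> = inner \<eta> \<xi>" by (simp add: inner_ell2_def)
  have "cinner (\<xi> + \<eta>) \<zeta> = cinner \<xi> \<zeta> + cinner \<eta> \<zeta>"
    unfolding cinner_def by (simp add: distrib_right infsum_add cinner_summable)
  then show "inner (\<xi> + \<eta>) \<zeta> = inner \<xi> \<zeta> + inner \<eta> \<zeta>" by (simp add: inner_ell2_def)
  have "cinner (r *\<^sub>R \<xi>) \<eta> = of_real r * cinner \<xi> \<eta>"
    unfolding cinner_def by (simp add: mult.assoc infsum_cmult_right')
  then show "inner (r *\<^sub>R \<xi>) \<eta> = r * inner \<xi> \<eta>" by (simp add: inner_ell2_def)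
  show "0 \<le> inner \<xi> \<xi>" by (simp add: inner_ell2_def cinner_self infsum_nonneg)
  show "inner \<xi> \<xi> = 0 \<longleftrightarrow> \<xi> = 0"
  proof
    assume "inner \<xi> \<xi> = 0"
    then have "(\<Sum>\<^sub>\<infinity>i. (cmod (coord \<xi> i))\<^sup>2) \<le> 0" by (simp add: inner_ell2_def cinner_self)
    then have "(cmod (coord \<xi> i))\<^sup>2 = 0" for i
      by (rule nonneg_infsum_le_0D) (use coord_summable in auto)
    then show "\<xi> = 0" by (intro ell2_eqI) simp
  qed (simp add: inner_ell2_def cinner_def)
qed (simp_all add: norm_ell2_def dist_ell2_def sgn_ell2_def uniformity_ell2_def open_ell2_def)

end

lemma norm_ell2_eq: "norm \<xi> = sqrt (\<Sum>\<^sub>\<infinity>i. (cmod (coord \<xi> i))\<^sup>2)"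
  by (simp add: norm_ell2_def inner_ell2_def cinner_self)

lift_definition delta :: "'i \<Rightarrow> 'i ell2" is "\<lambda>i j. if j = i then 1 else 0"
  by (rule summable_on_cong_neutral[THEN iffD1, OF _ _ _ summable_on_finite]) auto


section \<open>Operators\<close>

text \<open>Only complex-linear operators will occur below, although \<open>blinfun\<close> is the type of
  bounded real-linear maps.\<close>

type_synonym 'i op = "'i ell2 \<Rightarrow>\<^sub>L 'i ell2"

text \<open>\<open>diag_op d\<close> is only meaningful for bounded \<open>d\<close>, and \<open>subst_op p\<close> for bijective \<open>p\<close>.\<close>

definition diag_op :: "('i \<Rightarrow> complex) \<Rightarrow> 'i op" where
  "diag_op d = Blinfun (\<lambda>\<xi>. Abs_ell2 (\<lambda>i. d i * coord \<xi> i))"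

definition subst_op :: "('i \<Rightarrow> 'i) \<Rightarrow> 'i op" where
  "subst_op p = Blinfun (\<lambda>\<xi>. Abs_ell2 (\<lambda>i. coord \<xi> (p i)))"

lemma coord_diag_op:
  assumes "\<And>i. cmod (d i) \<le> K"
  shows "coord (diag_op d \<xi>) i = d i * coord \<xi> i"
proof -
  define f where "f \<xi> = Abs_ell2 (\<lambda>i. d i * coord \<xi> i)" for \<xi>
  have c: "coord (f \<xi>) i = d i * coord \<xi> i" for \<xi> i
    unfolding f_def by (subst Abs_ell2_inverse) (auto intro!: ell2_cmult_summable[OF coord_summable assms])
  have "bounded_linear f"
  proof (rule bounded_linear_intro[where K = K])
    show "f (\<xi> + \<eta>) = f \<xi> + f \<eta>" for \<xi> \<eta>
      by (rule ell2_eqI) (simp add: c distrib_left)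
    show "f (r *\<^sub>R \<xi>) = r *\<^sub>R f \<xi>" for r \<xi>
      by (rule ell2_eqI) (simp add: c)
    have K: "0 \<le> K" using assms norm_ge_zero order_trans by blast
    show "norm (f \<xi>) \<le> norm \<xi> * K" for \<xi>
    proof -
      have "(\<Sum>\<^sub>\<infinity>i. (cmod (coord (f \<xi>) i))\<^sup>2) \<le> (\<Sum>\<^sub>\<infinity>i. K\<^sup>2 * (cmod (coord \<xi> i))\<^sup>2)"
      proof (rule infsum_mono)
        show "(cmod (coord (f \<xi>) i))\<^sup>2 \<le> K\<^sup>2 * (cmod (coord \<xi> i))\<^sup>2" for i
          by (simp add: c norm_mult power_mult_distrib assms mult_right_mono power_mono)
      qed (intro coord_summable summable_on_cmult_right)+
      also have "\<dots> = K\<^sup>2 * (\<Sum>\<^sub>\<infinity>i. (cmod (coord \<xi> i))\<^sup>2)" by (rule infsum_cmult_right')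
      finally show ?thesis
        unfolding norm_ell2_eq using K real_sqrt_le_mono by (fastforce simp: real_sqrt_mult mult.commute)
    qed
  qed
  then show ?thesis by (simp add: diag_op_def f_def[symmetric] bounded_linear_Blinfun_apply c)
qed

lemma coord_subst_op:
  assumes "bij p"
  shows "coord (subst_op p \<xi>) i = coord \<xi> (p i)"
proof -
  define f where "f \<xi> = Abs_ell2 (\<lambda>i. coord \<xi> (p i))" for \<xi>
  have s: "(\<lambda>i. (cmod (coord \<xi> (p i)))\<^sup>2) summable_on UNIV" for \<xi>
    using summable_on_reindex_bij_betw[OF assms, of "\<lambda>i. (cmod (coord \<xi> i))\<^sup>2"] coord_summable by blast
  have c: "coord (f \<xi>) i = coord \<xi> (p i)" for \<xi> i
    unfolding f_def by (subst Abs_ell2_inverse) (auto simp: s)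
  have "bounded_linear f"
  proof (rule bounded_linear_intro[where K = 1])
    show "f (\<xi> + \<eta>) = f \<xi> + f \<eta>" for \<xi> \<eta>
      by (rule ell2_eqI) (simp add: c)
    show "f (r *\<^sub>R \<xi>) = r *\<^sub>R f \<xi>" for r \<xi>
      by (rule ell2_eqI) (simp add: c)
    show "norm (f \<xi>) \<le> norm \<xi> * 1" for \<xi>
      using infsum_reindex_bij_betw[OF assms, of "\<lambda>i. (cmod (coord \<xi> i))\<^sup>2"]
      by (simp add: norm_ell2_eq c)
  qed
  then show ?thesis by (simp add: subst_op_def f_def[symmetric] bounded_linear_Blinfun_apply c)
qed

lemma op_eqI: "(\<And>\<xi> i. coord (a \<xi>) i = coord (b \<xi>) i) \<Longrightarrow> a = b" for a b :: "'i op"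
  by (intro blinfun_eqI ell2_eqI)

definition scaleC :: "complex \<Rightarrow> 'i op \<Rightarrow> 'i op" (infixr "*\<^sub>C" 75) where
  "c *\<^sub>C a = diag_op (\<lambda>_. c) o\<^sub>L a"

lemma coord_scaleC: "coord ((c *\<^sub>C a) \<xi>) i = c * coord (a \<xi>) i"
  by (simp add: scaleC_def coord_diag_op[of _ "cmod c"])

definition cspan :: "'i op set \<Rightarrow> 'i op set" where
  "cspan S = span {c *\<^sub>C s | c s. s \<in> S}"

definition is_adjoint :: "'i op \<Rightarrow> 'i op \<Rightarrow> bool" where
  "is_adjoint a b \<longleftrightarrow> (\<forall>\<xi> \<eta>. cinner (a \<xi>) \<eta> = cinner \<xi> (b \<eta>))"


section \<open>The reduced crossed product and its corner\<close>

text \<open>The group is written additively (\<open>group_add\<close> is not assumed commutative).\<close>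

definition continuous_action :: "('g::group_add \<Rightarrow> 'x::topological_space \<Rightarrow> 'x) \<Rightarrow> bool" where
  "continuous_action act \<longleftrightarrow>
     (\<forall>x. act 0 x = x) \<and> (\<forall>g h x. act (g + h) x = act g (act h x)) \<and>
     (\<forall>g. continuous_on UNIV (act g))"

definition C0 :: "('x::topological_space \<Rightarrow> complex) set" where
  "C0 = {f. continuous_on UNIV f \<and> (\<forall>\<epsilon>>0. compact {x. \<epsilon> \<le> cmod (f x)})}"

text \<open>The regular representation on \<open>\<ell>\<^sup>2(G \<times> X)\<close> induced from the faithful representation of
  \<open>C\<^sub>0(X)\<close> on \<open>\<ell>\<^sup>2(X)\<close> by multiplication:
  \<open>(f \<xi>)(h, x) = f(hx) \<xi>(h, x)\<close> and \<open>(u\<^sub>g \<xi>)(h, x) = \<xi>(g\<^sup>-\<^sup>1h, x)\<close>,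
  so that \<open>u\<^sub>g f u\<^sub>g\<^sup>* = f(g\<^sup>-\<^sup>1 \<cdot>)\<close>. The element \<open>f u\<^sub>g\<close> is the function on the
  transformation groupoid that takes the value \<open>f(gx)\<close> at \<open>(g, x)\<close> and vanishes at \<open>(h, x)\<close>
  for \<open>h \<noteq> g\<close>.\<close>

definition mult_op :: "('g \<Rightarrow> 'x \<Rightarrow> 'x) \<Rightarrow> ('x \<Rightarrow> complex) \<Rightarrow> ('g \<times> 'x) op" where
  "mult_op act f = diag_op (\<lambda>(h, x). f (act h x))"

definition trans_op :: "'g::group_add \<Rightarrow> ('g \<times> 'x) op" where
  "trans_op g = subst_op (\<lambda>(h, x). (- g + h, x))"

definition crossed_product ::
    "('g::group_add \<Rightarrow> 'x::topological_space \<Rightarrow> 'x) \<Rightarrow> ('g \<times> 'x) op set" where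
  "crossed_product act = closure (cspan {mult_op act f o\<^sub>L trans_op g | f g. f \<in> C0})"

definition reduced_algebra ::
    "('g::group_add \<Rightarrow> 'x::topological_space \<Rightarrow> 'x) \<Rightarrow> 'x set \<Rightarrow> ('g \<times> 'x) op set" where
  "reduced_algebra act Y =
     {mult_op act (indicator Y) o\<^sub>L a o\<^sub>L mult_op act (indicator Y) | a. a \<in> crossed_product act}"

lemma bij_trans: "bij (\<lambda>(h, x). (- g + h, x))" for g :: "'g::group_add"
  by (rule bij_betw_byWitness[where f' = "\<lambda>(h, x). (g + h, x)"]) (auto simp: add.assoc[symmetric])

lemma coord_trans_op: "coord (trans_op g \<xi>) (h, x) = coord \<xi> (- g + h, x)"
  by (simp add: trans_op_def coord_subst_op bij_trans)

lemma coord_mult_op: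
  assumes "\<And>x. cmod (f x) \<le> K"
  shows "coord (mult_op act f \<xi>) (h, x) = f (act h x) * coord \<xi> (h, x)"
  unfolding mult_op_def by (subst coord_diag_op[where K = K]) (use assms in auto)

lemma coord_mult_op_indicator:
  "coord (mult_op act (indicator Y) \<xi>) (h, x) = indicator Y (act h x) * coord \<xi> (h, x)"
  by (rule coord_mult_op[where K = 1]) (simp add: indicator_def)

lemma C0_bounded:
  assumes "f \<in> C0"
  obtains K where "\<And>x. cmod (f x) \<le> K"
proof -
  have "compact {x. 1 \<le> cmod (f x)}" "continuous_on UNIV f" using assms by (auto simp: C0_def)
  then have "bounded (f ` {x. 1 \<le> cmod (f x)})"
    by (intro compact_imp_bounded compact_continuous_image) (auto intro: continuous_on_subset)
  then obtain B where B: "\<And>x. 1 \<le> cmod (f x) \<Longrightarrow> cmod (f x) \<le> B" by (auto simp: bounded_iff)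
  have "cmod (f x) \<le> max 1 B" for x using B[of x] by (cases "1 \<le> cmod (f x)") auto
  then show ?thesis by (rule that)
qed

lemma covariance:
  assumes "continuous_action act" "f \<in> C0"
  shows "trans_op g o\<^sub>L mult_op act f o\<^sub>L trans_op (- g) = mult_op act (\<lambda>x. f (act (- g) x))"
proof -
  obtain K where K: "\<And>x. cmod (f x) \<le> K" using C0_bounded[OF assms(2)] by blast
  show ?thesis
  proof (rule op_eqI)
    fix \<xi> and i :: "'a \<times> 'b"
    obtain h x where i: "i = (h, x)" by (cases i)
    show "coord ((trans_op g o\<^sub>L mult_op act f o\<^sub>L trans_op (- g)) \<xi>) i =
        coord (mult_op act (\<lambda>x. f (act (- g) x)) \<xi>) i"
      using assms(1)
      by (simp add: i coord_trans_op coord_mult_op[OF K] coord_mult_op[where K = K] K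
          continuous_action_def add.assoc[symmetric])
  qed
qed


section \<open>Dynamics, conditional expectation, ground states\<close>

text \<open>The dynamics is implemented by the unitaries of multiplication by \<open>N(h)\<^sup>i\<^sup>t\<close>; the lemma
  \<open>dynamics_generator\<close> below confirms that it multiplies functions supported on
  \<open>{g} \<times> X\<close> by \<open>N(g)\<^sup>i\<^sup>t\<close>.\<close>

definition phase_op :: "('g \<Rightarrow> real) \<Rightarrow> real \<Rightarrow> ('g \<times> 'x) op" where
  "phase_op N t = diag_op (\<lambda>(h, x). complex_of_real (N h) powr (\<i> * complex_of_real t))"

definition dynamics :: "('g \<Rightarrow> real) \<Rightarrow> real \<Rightarrow> ('g \<times> 'x) op \<Rightarrow> ('g \<times> 'x) op" where
  "dynamics N t a = phase_op N t o\<^sub>L a o\<^sub>L phase_op N (- t)"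

lemma dynamics_generator:
  fixes N :: "'g::group_add \<Rightarrow> real" and act :: "'g \<Rightarrow> 'x::topological_space \<Rightarrow> 'x"
  assumes N: "\<And>g. N g > 0" "\<And>g h. N (g + h) = N g * N h" and f: "f \<in> C0"
  shows "dynamics N t (mult_op act (indicator Y) o\<^sub>L (mult_op act f o\<^sub>L trans_op g)
             o\<^sub>L mult_op act (indicator Y)) =
         complex_of_real (N g) powr (\<i> * complex_of_real t) *\<^sub>C
           (mult_op act (indicator Y) o\<^sub>L (mult_op act f o\<^sub>L trans_op g)
             o\<^sub>L mult_op act (indicator Y))"
proof -
  obtain K where K: "\<And>x. cmod (f x) \<le> K" using C0_bounded[OF f] by blast
  have ph: "coord (phase_op N t \<xi>) (h, x) =
      complex_of_real (N h) powr (\<i> * complex_of_real t) * coord \<xi> (h, x)"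
    for t \<xi> h and x :: 'x
  proof -
    have "cmod (complex_of_real (N h) powr (\<i> * complex_of_real t)) \<le> 1" for h
      using N(1)[of h] by (simp add: powr_def Ln_of_real)
    then show ?thesis
      unfolding phase_op_def by (subst coord_diag_op[where K = 1]) auto
  qed
  have mult: "complex_of_real (N g * N h) powr s =
      complex_of_real (N g) powr s * complex_of_real (N h) powr s" for g h s
    using N(1)[of g] N(1)[of h] powr_times_real[of "of_real (N g)" "of_real (N h)" s] by simp
  have cancel: "complex_of_real (N h) powr (\<i> * complex_of_real t) *
      complex_of_real (N (- g + h)) powr (\<i> * complex_of_real (- t)) =
      complex_of_real (N g) powr (\<i> * complex_of_real t)" for h
  proof -
    have "N h = N g * N (- g + h)" using N(2)[of g "- g + h"] by (simp add: add.assoc[symmetric])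
    then have "complex_of_real (N h) powr (\<i> * complex_of_real t) =
        complex_of_real (N g) powr (\<i> * complex_of_real t) *
        complex_of_real (N (- g + h)) powr (\<i> * complex_of_real t)"
      by (simp only: mult)
    moreover have "N (- g + h) \<noteq> 0" using N(1)[of "- g + h"] by simp
    ultimately show ?thesis by (simp add: powr_minus)
  qed
  show ?thesis
  proof (rule op_eqI)
    fix \<xi> and i :: "'g \<times> 'x"
    obtain h x where i: "i = (h, x)" by (cases i)
    show "coord (dynamics N t (mult_op act (indicator Y) o\<^sub>L (mult_op act f o\<^sub>L trans_op g)
             o\<^sub>L mult_op act (indicator Y)) \<xi>) i =
      coord ((complex_of_real (N g) powr (\<i> * complex_of_real t) *\<^sub>C
           (mult_op act (indicator Y) o\<^sub>L (mult_op act f o\<^sub>L trans_op g)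
             o\<^sub>L mult_op act (indicator Y))) \<xi>) i"
      by (simp add: i dynamics_def ph coord_scaleC coord_trans_op coord_mult_op[OF K]
          coord_mult_op_indicator cancel[of h, symmetric] del: of_real_minus)
  qed
qed

text \<open>The canonical conditional expectation as a diagonal matrix coefficient; it is characterised
  on the generators by \<open>cond_exp_generator\<close>.\<close>

definition cond_exp :: "('g::group_add \<times> 'x) op \<Rightarrow> 'x \<Rightarrow> complex" where
  "cond_exp a x = coord (a (delta (0, x))) (0, x)"

lemma cond_exp_generator:
  assumes "continuous_action act" "f \<in> C0"
  shows "cond_exp (mult_op act f o\<^sub>L trans_op g) = (if g = 0 then f else (\<lambda>_. 0))"
proof -
  obtain K where K: "\<And>x. cmod (f x) \<le> K" using C0_bounded[OF assms(2)] by blast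
  show ?thesis using assms(1)
    by (auto simp: cond_exp_def coord_mult_op[OF K] coord_trans_op delta.rep_eq
        continuous_action_def fun_eq_iff)
qed

text \<open>A functional on a set \<open>A\<close> of operators is a total function that is \<open>0\<close> off \<open>A\<close>, so that
  equality of functionals is equality of functions.\<close>

definition state_on :: "'i op set \<Rightarrow> ('i op \<Rightarrow> complex) \<Rightarrow> bool" where
  "state_on A \<phi> \<longleftrightarrow>
     (\<forall>a. a \<notin> A \<longrightarrow> \<phi> a = 0) \<and>
     (\<forall>a\<in>A. \<forall>b\<in>A. \<phi> (a + b) = \<phi> a + \<phi> b) \<and>
     (\<forall>c. \<forall>a\<in>A. \<phi> (c *\<^sub>C a) = c * \<phi> a) \<and>
     (\<forall>a\<in>A. \<forall>b. is_adjoint a b \<longrightarrow> \<phi> (b o\<^sub>L a) \<in> \<real>\<^sub>\<ge>\<^sub>0) \<and>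
     bdd_above ((\<lambda>a. cmod (\<phi> a)) ` {a \<in> A. norm a \<le> 1}) \<and>
     (SUP a\<in>{a \<in> A. norm a \<le> 1}. cmod (\<phi> a)) = 1"

text \<open>\<open>F\<close> is the entire \<open>A\<close>-valued function \<open>z \<mapsto> \<sigma>\<^sub>z(b)\<close>; its existence means that \<open>b\<close> is
  \<open>\<sigma>\<close>-analytic.\<close>

definition analytic_orbit ::
    "'i op set \<Rightarrow> (real \<Rightarrow> 'i op \<Rightarrow> 'i op) \<Rightarrow> 'i op \<Rightarrow> (complex \<Rightarrow> 'i op) \<Rightarrow> bool" where
  "analytic_orbit A \<sigma> b F \<longleftrightarrow>
     (\<forall>z. F z \<in> A) \<and> (\<forall>t. F (complex_of_real t) = \<sigma> t b) \<and>
     (\<forall>z. \<exists>D. (F has_derivative (\<lambda>w. w *\<^sub>C D)) (at z))"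

definition ground_states ::
    "'i op set \<Rightarrow> (real \<Rightarrow> 'i op \<Rightarrow> 'i op) \<Rightarrow> ('i op \<Rightarrow> complex) set" where
  "ground_states A \<sigma> =
     {\<phi>. state_on A \<phi> \<and> (\<forall>t. \<forall>a\<in>A. \<phi> (\<sigma> t a) = \<phi> a) \<and>
         (\<exists>S\<subseteq>A. A \<subseteq> closure (cspan S) \<and>
            (\<forall>b\<in>S. \<exists>F. analytic_orbit A \<sigma> b F \<and>
               (\<forall>a\<in>S. bounded ((\<lambda>z. \<phi> (a o\<^sub>L F z)) ` {z. 0 < Im z}))))}"


section \<open>Measures\<close>

definition Y0 :: "('g \<Rightarrow> 'x \<Rightarrow> 'x) \<Rightarrow> 'x set \<Rightarrow> ('g \<Rightarrow> real) \<Rightarrow> 'x set" where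
  "Y0 act Y N = Y - (\<Union>g\<in>{g. N g > 1}. act g ` Y)"

definition prob_measures_on :: "'x::topological_space set \<Rightarrow> 'x set \<Rightarrow> 'x measure set" where
  "prob_measures_on Y Z =
     {\<mu>. prob_space \<mu> \<and> space \<mu> = Y \<and> sets \<mu> = sets (restrict_space borel Y) \<and>
         emeasure \<mu> (Y - Z) = 0}"

definition mixture :: "real \<Rightarrow> 'x measure \<Rightarrow> 'x measure \<Rightarrow> 'x measure" where
  "mixture t \<mu> \<nu> = measure_of (space \<mu>) (sets \<mu>)
     (\<lambda>B. ennreal t * emeasure \<mu> B + ennreal (1 - t) * emeasure \<nu> B)"

lemma sets_mixture [simp]: "sets (mixture t \<mu> \<nu>) = sets \<mu>"
  and space_mixture [simp]: "space (mixture t \<mu> \<nu>) = space \<mu>"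
  by (simp_all add: mixture_def sets.space_closed)

lemma emeasure_mixture:
  assumes "sets \<nu> = sets \<mu>" "B \<in> sets \<mu>"
  shows "emeasure (mixture t \<mu> \<nu>) B = ennreal t * emeasure \<mu> B + ennreal (1 - t) * emeasure \<nu> B"
proof (rule emeasure_measure_of[OF mixture_def sets.space_closed])
  show "B \<in> sets (mixture t \<mu> \<nu>)" using assms(2) by simp
  show "countably_additive (sets (mixture t \<mu> \<nu>))
      (\<lambda>B. ennreal t * emeasure \<mu> B + ennreal (1 - t) * emeasure \<nu> B)"
  proof (rule countably_additiveI)
    fix C :: "nat \<Rightarrow> 'a set"
    assume C: "range C \<subseteq> sets (mixture t \<mu> \<nu>)" "disjoint_family C"
    then have "(\<Sum>i. emeasure \<mu> (C i)) = emeasure \<mu> (\<Union>i. C i)"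
      "(\<Sum>i. emeasure \<nu> (C i)) = emeasure \<nu> (\<Union>i. C i)"
      using assms(1) by (auto intro!: suminf_emeasure)
    then show "(\<Sum>i. ennreal t * emeasure \<mu> (C i) + ennreal (1 - t) * emeasure \<nu> (C i)) =
        ennreal t * emeasure \<mu> (\<Union>i. C i) + ennreal (1 - t) * emeasure \<nu> (\<Union>i. C i)"
      by (simp add: suminf_add[symmetric])
  qed
qed (simp add: positive_def)

lemma mixture_prob_measures_on:
  assumes "\<mu> \<in> prob_measures_on Y Z" "\<nu> \<in> prob_measures_on Y Z" "t \<in> {0..1}"
    and "Z \<in> sets (restrict_space borel Y)"
  shows "mixture t \<mu> \<nu> \<in> prob_measures_on Y Z"
proof -
  have s: "sets \<nu> = sets \<mu>" "space \<mu> = Y" "space \<nu> = Y" "sets \<mu> = sets (restrict_space borel Y)"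
    "prob_space \<mu>" "prob_space \<nu>" "emeasure \<mu> (Y - Z) = 0" "emeasure \<nu> (Y - Z) = 0"
    using assms(1,2) by (auto simp: prob_measures_on_def)
  have "Y \<in> sets \<mu>" using sets.top[of \<mu>] s(2) by simp
  moreover have "Y - Z \<in> sets \<mu>" using calculation assms(4) s(4) by auto
  moreover have "emeasure \<mu> Y = 1" "emeasure \<nu> Y = 1"
    using prob_space.emeasure_space_1[OF s(5)] prob_space.emeasure_space_1[OF s(6)] s(2,3) by auto
  moreover have "ennreal t + ennreal (1 - t) = 1"
    using assms(3) by (simp add: ennreal_plus[symmetric] del: ennreal_plus)
  ultimately show ?thesis
    using s by (auto simp: prob_measures_on_def emeasure_mixture intro!: prob_spaceI)
qed

definition induced_functional ::
    "('g::group_add \<times> 'x) op set \<Rightarrow> 'x measure \<Rightarrow> ('g \<times> 'x) op \<Rightarrow> complex" where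
  "induced_functional A \<mu> a = (if a \<in> A then integral\<^sup>L \<mu> (cond_exp a) else 0)"

end

theory Submission
  imports Defs "HOL-Complex_Analysis.Complex_Analysis"
begin

text \<open>For \<open>N(g) < 1\<close> the orbit \<open>\<sigma>\<^sub>z(f u\<^sub>g) = N(g)\<^bsup>iz\<^esup> f u\<^sub>g\<close> grows exponentially in the
  upper half-plane. A Phragmen-Lindelof estimate, applied to approximations of \<open>a\<close> and \<open>f u\<^sub>g\<close> by
  elements of the dense subspace in the definition of a ground state \<open>\<phi>\<close>, therefore forces
  \<open>\<phi>(a f u\<^sub>g) = 0\<close>. Taking \<open>a = (f u\<^sub>g)\<^sup>*\<close> shows that the measure \<open>\<mu>\<close> representing \<open>\<phi>\<close> on
  \<open>C\<^sub>0(Y)\<close> is concentrated on \<open>Y\<^sub>0\<close>. For \<open>g \<noteq> e\<close> the closed sets \<open>Y\<^sub>0\<close> and \<open>gY\<^sub>0\<close> are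
  disjoint, so \<open>f\<close> is a sum of a function vanishing on \<open>Y\<^sub>0\<close> and one vanishing on \<open>gY\<^sub>0\<close>, and the
  Cauchy-Schwarz inequality gives \<open>\<phi>(f u\<^sub>g) = 0\<close>; hence \<open>\<phi> = \<mu>\<^sub>* \<circ> E\<close>. Conversely, a measure on
  \<open>Y\<^sub>0\<close> gives \<open>\<phi>(k u\<^sub>h f u\<^sub>g) = 0\<close> whenever \<open>N(g) < 1\<close>, because \<open>f(gx) \<noteq> 0\<close> forces
  \<open>x \<in> g\<^sup>-\<^sup>1Y\<close>.\<close>

section \<open>Functions vanishing at infinity\<close>

text \<open>The algebra need not have a unit, since \<open>Y\<close> need not be compact, and the
  definition of a ground state controls only some unspecified set with dense span. Both facts shape
  the details. Boundedness on the half-plane does not pass to norm limits, so the growth argument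
  compares f u_g with bounded holomorphic functions that approximate its orbit uniformly on the real
  axis; the approximation is uniform because the dynamics does not increase norms, and vanishing is
  read off far up the imaginary axis. The Riesz measure of a state restricted to C_0(Y) is at first
  only known to have mass at most 1; mass 1 comes at the end from the norm of the state, once the
  formula with E holds on the whole algebra. Second countability writes each open set as a countable
  union of sets {f > 0} with f in C_0 supported there, and countability of G then turns vanishing
  integrals into a statement about almost every point. The Cauchy-Schwarz step rests on a
  factorization f = k1 k2 with |k1| = |k2| = sqrt|f|, which makes the zeros of f visible in both
  factors.\<close>

lemma C0_dominated:
  assumes "g1 \<in> C0" "g2 \<in> C0" "continuous_on UNIV f"
    and le: "\<And>x. cmod (f x) \<le> K * (cmod (g1 x) + cmod (g2 x))"
  shows "f \<in> C0"
  unfolding C0_def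
proof (intro CollectI conjI allI impI assms)
  fix \<epsilon> :: real assume e: "\<epsilon> > 0"
  define K' where "K' = max 1 K"
  have K': "K' > 0" by (simp add: K'_def)
  \<comment> \<open>Where both \<open>g1\<close> and \<open>g2\<close> are below
    \<open>\<delta>\<close>, \<open>f\<close> is below \<open>K' * (2 * \<delta>)\<close>, which is
    \<open>\<epsilon>\<close>. Replacing \<open>K\<close> by \<open>max 1 K\<close> makes the
    division legitimate.\<close>
  define \<delta> where "\<delta> = \<epsilon> / (2 * K')"
  have d: "\<delta> > 0" using e K' by (simp add: \<delta>_def)
  have "{x. \<epsilon> \<le> cmod (f x)} \<subseteq> {x. \<delta> \<le> cmod (g1 x)} \<union> {x. \<delta> \<le> cmod (g2 x)}"
  proof (rule subsetI, rule ccontr)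
    fix x assume "x \<in> {x. \<epsilon> \<le> cmod (f x)}" "x \<notin> {x. \<delta> \<le> cmod (g1 x)} \<union> {x. \<delta> \<le> cmod (g2 x)}"
    then have *: "\<epsilon> \<le> cmod (f x)" "cmod (g1 x) + cmod (g2 x) < 2 * \<delta>" by auto
    have "cmod (f x) \<le> K' * (cmod (g1 x) + cmod (g2 x))"
      by (rule order_trans[OF le]) (auto intro!: mult_right_mono simp: K'_def)
    also have "\<dots> < K' * (2 * \<delta>)" using * K' by simp
    also have "\<dots> = \<epsilon>" using K' by (simp add: \<delta>_def)
    finally show False using * by simp
  qed
  moreover have "compact ({x. \<delta> \<le> cmod (g1 x)} \<union> {x. \<delta> \<le> cmod (g2 x)})"
    using assms(1,2) d by (auto simp: C0_def)
  moreover have "closed {x. \<epsilon> \<le> cmod (f x)}"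
    using assms(3) by (intro closed_Collect_le continuous_on_norm) auto
  ultimately show "compact {x. \<epsilon> \<le> cmod (f x)}"
    by (metis compact_Int_closed inf.absorb_iff2)
qed

lemma C0_continuous: "f \<in> C0 \<Longrightarrow> continuous_on UNIV f"
  by (simp add: C0_def)

lemma C0_bounded_mult:
  assumes "g \<in> C0" "continuous_on UNIV h" "\<And>x. cmod (h x) \<le> K"
  shows "(\<lambda>x. h x * g x) \<in> C0"
proof (rule C0_dominated[OF assms(1,1)])
  show "cmod (h x * g x) \<le> K * (cmod (g x) + cmod (g x))" for x
  proof -
    have "cmod (h x * g x) \<le> K * cmod (g x)"
      by (simp add: norm_mult assms(3) mult_right_mono)
    moreover have "0 \<le> K" using assms(3)[of x] norm_ge_zero[of "h x"] by linarith
    then have "0 \<le> K * cmod (g x)" by simp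
    ultimately show ?thesis by (simp add: distrib_left)
  qed
qed (intro continuous_intros assms C0_continuous)

lemma C0_mult:
  assumes "f \<in> C0" "g \<in> C0"
  shows "(\<lambda>x. f x * g x) \<in> C0"
proof -
  obtain K where "\<And>x. cmod (f x) \<le> K" using C0_bounded[OF assms(1)] by blast
  then show ?thesis by (rule C0_bounded_mult[OF assms(2) C0_continuous[OF assms(1)]])
qed

lemma C0_cnj: "f \<in> C0 \<Longrightarrow> (\<lambda>x. cnj (f x)) \<in> C0"
  by (rule C0_dominated[of f f _ 1], assumption, assumption, rule continuous_on_cnj, erule C0_continuous) simp

lemma C0_homeo:
  assumes "f \<in> C0" "continuous_on UNIV p" "continuous_on UNIV q" "\<And>x. p (q x) = x" "\<And>x. q (p x) = x"
  shows "(\<lambda>x. f (p x)) \<in> C0"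
proof -
  have "{x. \<epsilon> \<le> cmod (f (p x))} = q ` {x. \<epsilon> \<le> cmod (f x)}" for \<epsilon>
    using assms(4,5) by (force simp: image_iff)
  moreover have "continuous_on UNIV (\<lambda>x. f (p x))"
    by (rule continuous_on_compose2[OF C0_continuous[OF assms(1)] assms(2)]) simp
  moreover have "compact (q ` {x. \<epsilon> \<le> cmod (f x)})" if "\<epsilon> > 0" for \<epsilon>
    using assms(1) that
    by (intro compact_continuous_image continuous_on_subset[OF assms(3)]) (auto simp: C0_def)
  ultimately show ?thesis by (simp add: C0_def)
qed

text \<open>For open \<open>U\<close> this is the real part of C_0(U), extended by zero: the level
  sets \<open>{x. \<epsilon> \<le> \<bar>f x\<bar>}\<close> are compact and contained in
  \<open>U\<close>. Subsets are thus handled with total functions on one type.\<close>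

definition C0r :: "'x::topological_space set \<Rightarrow> ('x \<Rightarrow> real) set" where
  "C0r U = {f. (\<lambda>x. complex_of_real (f x)) \<in> C0 \<and> (\<forall>x. x \<notin> U \<longrightarrow> f x = 0)}"

lemma C0r_continuous:
  assumes "f \<in> C0r U"
  shows "continuous_on A f"
proof -
  have "continuous_on UNIV (\<lambda>x. Re (complex_of_real (f x)))"
    using assms by (intro continuous_on_Re C0_continuous) (simp add: C0r_def)
  then show ?thesis by (auto intro: continuous_on_subset)
qed

lemma C0r_dominated:
  assumes "g1 \<in> C0r U" "g2 \<in> C0r U" "continuous_on UNIV f"
    and "\<And>x. \<bar>f x\<bar> \<le> K * (\<bar>g1 x\<bar> + \<bar>g2 x\<bar>)"
  shows "f \<in> C0r U"
proof -
  have "(\<lambda>x. complex_of_real (f x)) \<in> C0"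
  proof (rule C0_dominated)
    show "(\<lambda>x. complex_of_real (g1 x)) \<in> C0" "(\<lambda>x. complex_of_real (g2 x)) \<in> C0"
      using assms by (simp_all add: C0r_def)
    show "continuous_on UNIV (\<lambda>x. complex_of_real (f x))" by (rule continuous_on_of_real[OF assms(3)])
    show "cmod (complex_of_real (f x)) \<le> K * (cmod (complex_of_real (g1 x)) + cmod (complex_of_real (g2 x)))" for x
      using assms(4)[of x] by simp
  qed
  moreover have "f x = 0" if "x \<notin> U" for x
    using assms(4)[of x] that assms(1,2) by (simp add: C0r_def)
  ultimately show ?thesis by (simp add: C0r_def)
qed

lemma C0r_add:
  assumes "f \<in> C0r U" "g \<in> C0r U"
  shows "(\<lambda>x. f x + g x) \<in> C0r U"
  by (rule C0r_dominated[OF assms, of _ 1])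
    (auto intro: continuous_on_add C0r_continuous[OF assms(1)] C0r_continuous[OF assms(2)])

lemma C0r_diff:
  assumes "f \<in> C0r U" "g \<in> C0r U"
  shows "(\<lambda>x. f x - g x) \<in> C0r U"
  by (rule C0r_dominated[OF assms, of _ 1])
    (auto intro: continuous_on_diff C0r_continuous[OF assms(1)] C0r_continuous[OF assms(2)])

lemma C0r_cmult:
  assumes "f \<in> C0r U"
  shows "(\<lambda>x. c * f x) \<in> C0r U"
  by (rule C0r_dominated[OF assms assms, of _ "\<bar>c\<bar>"])
    (auto simp: abs_mult distrib_left intro: continuous_on_mult_left C0r_continuous[OF assms])

lemma C0r_max:
  assumes "f \<in> C0r U" "g \<in> C0r U"
  shows "(\<lambda>x. max (f x) (g x)) \<in> C0r U"
  by (rule C0r_dominated[OF assms, of _ 1])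
    (auto intro: continuous_on_max C0r_continuous[OF assms(1)] C0r_continuous[OF assms(2)])

lemma C0r_min1:
  assumes "f \<in> C0r U"
  shows "(\<lambda>x. min 1 (f x)) \<in> C0r U"
  by (rule C0r_dominated[OF assms assms, of _ 1])
    (auto intro: continuous_on_min continuous_on_const C0r_continuous[OF assms])

lemma C0r_zero: "(\<lambda>x. 0) \<in> C0r U"
  by (auto simp: C0r_def C0_def)

lemma C0r_sum: "(\<And>i. i \<in> I \<Longrightarrow> f i \<in> C0r U) \<Longrightarrow> (\<lambda>x. \<Sum>i\<in>I. f i x) \<in> C0r U"
  by (induction I rule: infinite_finite_induct) (auto intro: C0r_zero C0r_add)

lemma C0r_bounded:
  assumes "f \<in> C0r U"
  obtains K where "K > 0" "\<And>x. \<bar>f x\<bar> \<le> K"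
proof -
  have "(\<lambda>x. complex_of_real (f x)) \<in> C0" using assms by (simp add: C0r_def)
  from C0_bounded[OF this] obtain K where "\<And>x. \<bar>f x\<bar> \<le> K" by auto
  then have "\<bar>f x\<bar> \<le> max 1 K" for x by (simp add: max.coboundedI2)
  then show thesis using that[of "max 1 K"] by simp
qed

lemma C0r_mult:
  assumes "f \<in> C0r U" "g \<in> C0r U"
  shows "(\<lambda>x. f x * g x) \<in> C0r U"
proof -
  obtain K where K: "K > 0" "\<And>x. \<bar>f x\<bar> \<le> K" using C0r_bounded[OF assms(1)] by metis
  show ?thesis
  proof (rule C0r_dominated[OF assms(2,2), of _ K])
    show "\<bar>f x * g x\<bar> \<le> K * (\<bar>g x\<bar> + \<bar>g x\<bar>)" for x
      using mult_right_mono[OF K(2)[of x], of "\<bar>g x\<bar>"] K(1)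
        mult_left_mono[of "\<bar>g x\<bar>" "\<bar>g x\<bar> + \<bar>g x\<bar>" K]
      unfolding abs_mult by linarith
  qed (intro continuous_on_mult C0r_continuous[OF assms(1)] C0r_continuous[OF assms(2)])
qed

lemma C0r_mono: "U \<subseteq> V \<Longrightarrow> f \<in> C0r U \<Longrightarrow> f \<in> C0r V"
  by (auto simp: C0r_def)

section \<open>Cut-off functions, exhaustions and Urysohn functions\<close>

lemma compact_C0r: "f \<in> C0r U \<Longrightarrow> \<epsilon> > 0 \<Longrightarrow> compact {x. \<epsilon> \<le> \<bar>f x\<bar>}"
  by (simp add: C0r_def C0_def)

lemma open_C0r_pos: "f \<in> C0r U \<Longrightarrow> open {x. c < f x}"
  by (intro open_Collect_less continuous_on_const C0r_continuous)

text \<open>Local compactness provides an open \<open>V\<close> around \<open>x\<close> with a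
  compact \<open>C\<close> between \<open>V\<close> and \<open>U\<close>. Complete regularity gives
  \<open>k\<close> that is 0 at \<open>x\<close> and 1 off \<open>V\<close>; then
  \<open>max 0 (1 - \<bar>k y\<bar>)\<close> is supported in \<open>V\<close>, and its level sets
  are closed subsets of \<open>C\<close>.\<close>

lemma C0r_bump:
  fixes U :: "'x::t2_space set"
  assumes lc: "locally_compact_space (euclidean :: 'x topology)" and "open U" "x \<in> U"
  obtains f where "f \<in> C0r U" "f x = 1" "\<And>y. 0 \<le> f y" "\<And>y. f y \<le> 1"
proof -
  have h: "Hausdorff_space (euclidean :: 'x topology)"
    unfolding Hausdorff_space_def disjnt_def open_openin[symmetric] using hausdorff by blast
  have "neighbourhood_base_of (compactin (euclidean :: 'x topology)) euclidean"
    using lc locally_compact_Hausdorff_imp_regular_space[OF lc h]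
    by (rule locally_compact_imp_neighbourhood_base)
  then obtain V C where V: "open V" "compact C" "x \<in> V" "V \<subseteq> C" "C \<subseteq> U"
    using assms(2,3) unfolding neighbourhood_base_of by (meson compactin_euclidean_iff open_openin)
  have "completely_regular_space (euclidean :: 'x topology)"
    using locally_compact_regular_imp_completely_regular_space[OF lc] h by blast
  moreover have "closedin euclidean (- V)" using V(1) by (simp add: closed_def)
  moreover have "x \<in> topspace euclidean - (- V)" using V(3) by simp
  ultimately obtain k where k: "continuous_map euclidean euclideanreal k" "k x = 0" "k ` (- V) \<subseteq> {1}"
    unfolding completely_regular_space_alt by meson
  have ck: "continuous_on UNIV k" using k(1) by simp
  define f where "f y = max 0 (1 - \<bar>k y\<bar>)" for y
  have cf: "continuous_on UNIV f" unfolding f_def by (intro continuous_intros ck)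
  have fV: "f y = 0" if "y \<notin> V" for y using k(3) that by (auto simp: f_def)
  have "compact {y. \<epsilon> \<le> cmod (complex_of_real (f y))}" if "\<epsilon> > 0" for \<epsilon>
  proof -
    have "{y. \<epsilon> \<le> cmod (complex_of_real (f y))} = C \<inter> {y. \<epsilon> \<le> \<bar>f y\<bar>}"
      using fV V(4) that by force
    moreover have "closed {y. \<epsilon> \<le> \<bar>f y\<bar>}" by (intro closed_Collect_le continuous_intros cf)
    ultimately show ?thesis using compact_Int_closed[OF V(2)] by metis
  qed
  then have "f \<in> C0r U" using cf fV V by (auto simp: C0r_def C0_def)
  then show thesis by (rule that) (auto simp: f_def k)
qed

text \<open>By the Lindelof property, countably many positivity sets of bump functions already cover
  \<open>U\<close>. Measurability of open sets and null-set arguments are thereby reduced to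
  sequences of functions.\<close>

lemma open_countable_C0r:
  fixes U :: "'x::{t2_space, second_countable_topology} set"
  assumes lc: "locally_compact_space (euclidean :: 'x topology)" and "open U"
  obtains f :: "nat \<Rightarrow> 'x \<Rightarrow> real"
  where "\<And>n. f n \<in> C0r U" "\<And>n x. 0 \<le> f n x" "\<And>n x. f n x \<le> 1" "U = (\<Union>n. {x. 0 < f n x})"
proof -
  define B where "B = {f \<in> C0r U. \<forall>x. 0 \<le> f x \<and> f x \<le> 1}"
  define F where "F = (\<lambda>f. {x. 0 < f x}) ` B"
  obtain F' where F': "F' \<subseteq> F" "countable F'" "\<Union>F' = \<Union>F"
    by (rule Lindelof[of F]) (auto simp: F_def B_def open_C0r_pos)
  \<comment> \<open>The zero function contributes the empty set, which is inserted so that the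
    countable family is nonempty and can be enumerated by \<open>from_nat_into\<close>.\<close>
  have 0: "(\<lambda>x. 0) \<in> B" by (simp add: B_def C0r_zero)
  then have "{} \<in> F" unfolding F_def by (intro image_eqI[where x = "\<lambda>x. 0"]) auto
  then have sub: "insert {} F' \<subseteq> F" using F' by auto
  have "\<exists>f\<in>B. from_nat_into (insert {} F') n = {x. 0 < f x}" for n
  proof -
    have "from_nat_into (insert {} F') n \<in> F" using from_nat_into[of "insert {} F'" n] sub by blast
    then show ?thesis unfolding F_def by blast
  qed
  then obtain f where f: "\<And>n. f n \<in> B" "\<And>n. from_nat_into (insert {} F') n = {x. 0 < f n x}"
    by metis
  have "(\<lambda>n. {x. 0 < f n x}) = from_nat_into (insert {} F')" using f(2) by auto
  then have "(\<Union>n. {x. 0 < f n x}) = \<Union>(insert {} F')"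
    using F'(2) range_from_nat_into[of "insert {} F'"] by (metis countable_insert insert_not_empty)
  also have "\<dots> = \<Union>F" using F' by simp
  also have "\<dots> = U"
  proof (intro antisym subsetI)
    fix x assume "x \<in> U"
    then obtain f where "f \<in> C0r U" "f x = 1" "\<And>y. 0 \<le> f y" "\<And>y. f y \<le> 1"
      using C0r_bump[OF lc assms(2)] by blast
    then show "x \<in> \<Union>F" by (auto simp: F_def B_def intro!: bexI[of _ f])
  next
    fix x assume "x \<in> \<Union>F"
    then show "x \<in> U" by (force simp: F_def B_def C0r_def)
  qed
  finally have U: "U = (\<Union>n. {x. 0 < f n x})" ..
  show thesis
  proof (rule that[OF _ _ _ U])
    show "f n \<in> C0r U" "0 \<le> f n x" "f n x \<le> 1" for n x using f(1)[of n] by (auto simp: B_def)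
  qed
qed

lemma C0r_exhaustion:
  fixes U :: "'x::{t2_space, second_countable_topology} set"
  assumes lc: "locally_compact_space (euclidean :: 'x topology)" and "open U"
  obtains g :: "nat \<Rightarrow> 'x \<Rightarrow> real"
  where "\<And>n. g n \<in> C0r U" "\<And>n x. 0 \<le> g n x" "\<And>n x. g n x \<le> 1"
    "\<And>x. (\<lambda>n. g n x) \<longlonglongrightarrow> indicator U x"
proof -
  obtain f :: "nat \<Rightarrow> 'x \<Rightarrow> real" where f: "\<And>n. f n \<in> C0r U" "\<And>n x. 0 \<le> f n x" "\<And>n x. f n x \<le> 1"
    "U = (\<Union>n. {x. 0 < f n x})"
    using open_countable_C0r[OF assms] by metis
  \<comment> \<open>At a point of \<open>U\<close> the partial sum eventually contains a positive
    term, and the factor \<open>real n\<close> lifts it above 1, so the sequence is eventually equal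
    to 1. Off \<open>U\<close> every term is zero.\<close>
  define g where "g n x = min 1 (real n * (\<Sum>i<n. f i x))" for n x
  have "g n \<in> C0r U" for n
    unfolding g_def by (intro C0r_min1 C0r_cmult C0r_sum f)
  moreover have "0 \<le> g n x" "g n x \<le> 1" for n x
    using f(2) by (auto simp: g_def sum_nonneg)
  moreover have "(\<lambda>n. g n x) \<longlonglongrightarrow> indicator U x" for x
  proof (cases "x \<in> U")
    case False
    then have "f i x = 0" for i using f(1)[of i] by (simp add: C0r_def)
    then show ?thesis using False by (simp add: g_def)
  next
    case True
    then obtain i where i: "0 < f i x" using f(4) by auto
    obtain m where m: "1 / f i x \<le> real m" using real_arch_simple by blast
    have "g n x = 1" if "n \<ge> max m (Suc i)" for n
    proof -
      have "1 / f i x \<le> real n" using m that by simp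
      then have "1 \<le> real n * f i x" using i by (simp add: divide_simps)
      also have "f i x \<le> (\<Sum>i<n. f i x)"
        using that f(2) by (intro member_le_sum) auto
      finally show ?thesis using mult_left_mono by (fastforce simp: g_def)
    qed
    then have "eventually (\<lambda>n. g n x = 1) sequentially"
      using eventually_sequentially by blast
    then have "(\<lambda>n. g n x) \<longlonglongrightarrow> 1" by (rule tendsto_eventually)
    then show ?thesis using True by simp
  qed
  ultimately show thesis by (rule that)
qed

text \<open>A regular Lindelof space is normal; regularity comes from local compactness, the
  Lindelof property from second countability. Neither closed set is assumed compact, as
  \<open>Y0\<close> and its translates may fail to be. The result serves as a bounded multiplier of
  C_0 functions.\<close>

lemma Urysohn_locally_compact:
  fixes S T :: "'x::{t2_space, second_countable_topology} set"
  assumes lc: "locally_compact_space (euclidean :: 'x topology)"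
    and "closed S" "closed T" "S \<inter> T = {}"
  obtains k :: "'x \<Rightarrow> real" where "continuous_on UNIV k" "\<And>x. 0 \<le> k x" "\<And>x. k x \<le> 1"
    "\<And>x. x \<in> S \<Longrightarrow> k x = 0" "\<And>x. x \<in> T \<Longrightarrow> k x = 1"
proof -
  have h: "Hausdorff_space (euclidean :: 'x topology)"
    unfolding Hausdorff_space_def disjnt_def open_openin[symmetric] using hausdorff by blast
  have "Lindelof_space (euclidean :: 'x topology)"
    unfolding Lindelof_space_def
  proof (intro allI impI, elim conjE)
    fix \<U> :: "'x set set" assume "\<forall>U\<in>\<U>. openin euclidean U" "\<Union>\<U> = topspace euclidean"
    then show "\<exists>\<V>. countable \<V> \<and> \<V> \<subseteq> \<U> \<and> \<Union>\<V> = topspace euclidean"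
      using Lindelof[of \<U>] by (metis open_openin)
  qed
  then have "normal_space (euclidean :: 'x topology)"
    using locally_compact_Hausdorff_imp_regular_space[OF lc h] regular_Lindelof_imp_normal_space by blast
  moreover have "closedin euclidean S" "closedin euclidean T" "disjnt S T"
    using assms(2-4) by (auto simp: disjnt_def)
  ultimately obtain k where k: "continuous_map euclidean (top_of_set {0..1::real}) k" "k ` S \<subseteq> {0}" "k ` T \<subseteq> {1}"
    using Urysohn_lemma[of "euclidean :: 'x topology" S T 0 1] zero_le_one by blast
  then have c: "continuous_on UNIV k" "\<And>x. k x \<in> {0..1}"
    by (auto simp: continuous_map_in_subtopology)
  show thesis
  proof (rule that[OF c(1)])
    show "0 \<le> k x" "k x \<le> 1" for x using c(2)[of x] by auto
    show "k x = 0" if "x \<in> S" for x using k(2) that by auto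
    show "k x = 1" if "x \<in> T" for x using k(3) that by auto
  qed
qed

section \<open>The Riesz representation theorem\<close>

text \<open>The constant function 1 may lie outside the domain, so contractivity is phrased by
  comparison with constants in \<open>L_bound\<close>. It is the source of the bound 1 for the total
  mass.\<close>

locale C0_functional =
  fixes U :: "'x::{t2_space, second_countable_topology} set" and L :: "('x \<Rightarrow> real) \<Rightarrow> real"
  assumes lc: "locally_compact_space (euclidean :: 'x topology)"
    and open_U: "open U"
    and L_add: "\<And>f g. f \<in> C0r U \<Longrightarrow> g \<in> C0r U \<Longrightarrow> L (\<lambda>x. f x + g x) = L f + L g"
    and L_cmult: "\<And>f c. f \<in> C0r U \<Longrightarrow> L (\<lambda>x. c * f x) = c * L f"
    and L_nonneg: "\<And>f. f \<in> C0r U \<Longrightarrow> (\<And>x. 0 \<le> f x) \<Longrightarrow> 0 \<le> L f"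
    and L_bound: "\<And>f. f \<in> C0r U \<Longrightarrow> (\<And>x. 0 \<le> f x) \<Longrightarrow> (\<And>x. f x \<le> c) \<Longrightarrow> L f \<le> c"
begin

definition Pos :: "('x \<Rightarrow> real) set" where
  "Pos = {f \<in> C0r U. \<forall>x. 0 \<le> f x}"

lemma Pos_C0r: "f \<in> Pos \<Longrightarrow> f \<in> C0r U" and Pos_nonneg: "f \<in> Pos \<Longrightarrow> 0 \<le> f x"
  by (auto simp: Pos_def)

lemma PosI: "f \<in> C0r U \<Longrightarrow> (\<And>x. 0 \<le> f x) \<Longrightarrow> f \<in> Pos"
  by (auto simp: Pos_def)

lemma L_Pos: "f \<in> Pos \<Longrightarrow> 0 \<le> L f"
  by (simp add: Pos_def L_nonneg)

lemma zero_Pos: "(\<lambda>x. 0) \<in> Pos"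
  by (simp add: Pos_def C0r_zero)

lemma L_zero: "L (\<lambda>x. 0) = 0"
  using L_cmult[OF C0r_zero, of 0] by simp

lemma L_diff:
  assumes "f \<in> C0r U" "g \<in> C0r U"
  shows "L (\<lambda>x. f x - g x) = L f - L g"
  using L_add[OF C0r_diff[OF assms] assms(2)] by simp

lemma L_mono:
  assumes "f \<in> C0r U" "g \<in> C0r U" "\<And>x. f x \<le> g x"
  shows "L f \<le> L g"
  using L_nonneg[OF C0r_diff[OF assms(2,1)]] L_diff[OF assms(2,1)] assms(3) by simp

lemma L_sum: "finite I \<Longrightarrow> (\<And>i. i \<in> I \<Longrightarrow> f i \<in> C0r U) \<Longrightarrow> L (\<lambda>x. \<Sum>i\<in>I. f i x) = (\<Sum>i\<in>I. L (f i))"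
  by (induction I rule: finite_induct) (simp_all add: L_zero L_add C0r_sum)

lemma L_le:
  assumes "f \<in> C0r U" "\<And>x. f x \<le> c" "0 \<le> c"
  shows "L f \<le> c"
proof -
  have m: "(\<lambda>x. max (f x) 0) \<in> C0r U" by (rule C0r_max[OF assms(1) C0r_zero])
  have "L f \<le> L (\<lambda>x. max (f x) 0)" by (rule L_mono[OF assms(1) m]) simp
  also have "\<dots> \<le> c" by (rule L_bound[OF m]) (use assms in auto)
  finally show ?thesis .
qed

text \<open>Dini's theorem turns pointwise domination by a series into domination of the functional.\<close>

lemma L_le_suminf:
  assumes f: "f \<in> Pos" and F: "\<And>n. F n \<in> Pos"
    and le: "\<And>x. ennreal (f x) \<le> (\<Sum>n. ennreal (F n x))"
  shows "ennreal (L f) \<le> (\<Sum>n. ennreal (L (F n)))"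
proof (rule ennreal_le_epsilon)
  fix e :: real assume e: "0 < e"
  define S where "S n x = (\<Sum>i<n. F i x)" for n x
  have S: "S n \<in> C0r U" for n unfolding S_def by (intro C0r_sum Pos_C0r F)
  have S0: "0 \<le> S n x" for n x unfolding S_def by (intro sum_nonneg Pos_nonneg F)
  have Smono: "S n x \<le> S m x" if "n \<le> m" for n m x
    unfolding S_def using that by (intro sum_mono2) (auto intro: Pos_nonneg F)
  have cf: "continuous_on UNIV f" and cS: "continuous_on UNIV (S n)" for n
    using C0r_continuous[OF Pos_C0r[OF f]] C0r_continuous[OF S] by blast+
  \<comment> \<open>Only \<open>C\<close> needs covering: off \<open>C\<close> the function is below
    \<open>e\<close>, so every partial sum, being nonnegative, is already within \<open>e\<close>
    from below.\<close>
  define C where "C = {x. e \<le> \<bar>f x\<bar>}"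
  define V where "V n = {x. f x - e < S n x}" for n
  have "compact C" unfolding C_def by (rule compact_C0r[OF Pos_C0r[OF f] e])
  moreover have "open (V n)" for n
    unfolding V_def by (intro open_Collect_less continuous_on_diff continuous_on_const cf cS)
  moreover have "C \<subseteq> (\<Union>n\<in>UNIV. V n)"
  proof
    fix x assume "x \<in> C"
    then have fx: "e \<le> f x" using Pos_nonneg[OF f, of x] by (simp add: C_def)
    have "ennreal (f x - e) < ennreal (f x)" using e fx by (intro ennreal_lessI) auto
    also have "\<dots> \<le> (SUP n. \<Sum>i<n. ennreal (F i x))" using le[of x] by (simp add: suminf_eq_SUP)
    finally obtain n where "ennreal (f x - e) < (\<Sum>i<n. ennreal (F i x))" by (auto simp: less_SUP_iff)
    also have "\<dots> = ennreal (S n x)" unfolding S_def by (intro sum_ennreal Pos_nonneg F)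
    finally have "f x - e < S n x" using fx by (simp add: ennreal_less_iff)
    then show "x \<in> (\<Union>n\<in>UNIV. V n)" by (auto simp: V_def)
  qed
  ultimately obtain D where D: "finite D" "C \<subseteq> (\<Union>n\<in>D. V n)"
    by (metis compactE_image)
  define m where "m = Max (insert 0 D)"
  have "f x - S m x \<le> e" for x
  proof (cases "x \<in> C")
    case True
    then obtain n where n: "n \<in> D" "f x - e < S n x" using D(2) by (auto simp: V_def)
    have "n \<le> m" unfolding m_def using D(1) n(1) by (intro Max_ge) auto
    then show ?thesis using Smono[of n m x] n(2) by linarith
  next
    case False
    then show ?thesis using S0[of m x] by (simp add: C_def)
  qed
  then have "L (\<lambda>x. f x - S m x) \<le> e"
    using e by (intro L_le C0r_diff Pos_C0r[OF f] S) auto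
  then have "L f \<le> (\<Sum>i<m. L (F i)) + e"
    using L_diff[OF Pos_C0r[OF f] S, of m] L_sum[of "{..<m}" F] Pos_C0r[OF F]
    by (simp add: S_def[abs_def])
  then have "ennreal (L f) \<le> ennreal ((\<Sum>i<m. L (F i)) + e)" by (rule ennreal_leI)
  also have "\<dots> = (\<Sum>i<m. ennreal (L (F i))) + ennreal e"
    using e by (simp add: L_Pos F sum_nonneg)
  also have "\<dots> \<le> (\<Sum>n. ennreal (L (F n))) + ennreal e"
    by (intro add_right_mono sum_le_suminf summableI) auto
  finally show "ennreal (L f) \<le> (\<Sum>n. ennreal (L (F n))) + ennreal e" .
qed

text \<open>The Daniell upper integral: the cheapest countable cover of \<open>h\<close> by positive
  functions. It is defined for arbitrary functions, not only for indicators, because the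
  Caratheodory argument applies it to an indicator times a cut-off.\<close>

definition upper :: "('x \<Rightarrow> ennreal) \<Rightarrow> ennreal" where
  "upper h = (INF F\<in>{F. (\<forall>n. F n \<in> Pos) \<and> (\<forall>x. h x \<le> (\<Sum>n. ennreal (F n x)))}. \<Sum>n. ennreal (L (F n)))"

lemma upper_lower:
  assumes "\<And>n. F n \<in> Pos" "\<And>x. h x \<le> (\<Sum>n. ennreal (F n x))"
  shows "upper h \<le> (\<Sum>n. ennreal (L (F n)))"
  unfolding upper_def by (rule INF_lower) (use assms in auto)

lemma upper_greatest:
  assumes "\<And>F. (\<And>n. F n \<in> Pos) \<Longrightarrow> (\<And>x. h x \<le> (\<Sum>n. ennreal (F n x))) \<Longrightarrow> c \<le> (\<Sum>n. ennreal (L (F n)))"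
  shows "c \<le> upper h"
  unfolding upper_def by (rule INF_greatest) (use assms in auto)

lemma upper_mono:
  assumes "\<And>x. h x \<le> k x"
  shows "upper h \<le> upper k"
  by (rule upper_greatest, rule upper_lower) (use assms order_trans in blast)+

lemma upper_le_L:
  assumes "f \<in> Pos" "\<And>x. h x \<le> ennreal (f x)"
  shows "upper h \<le> ennreal (L f)"
proof -
  define F where "F n = (if n = (0::nat) then f else (\<lambda>x. 0))" for n
  have "(\<Sum>n. ennreal (F n x)) = ennreal (f x)" for x
    by (subst suminf_finite[of "{0}"]) (auto simp: F_def)
  moreover have "(\<Sum>n. ennreal (L (F n))) = ennreal (L f)"
    by (subst suminf_finite[of "{0}"]) (auto simp: F_def L_zero)
  moreover have "F n \<in> Pos" for n using assms(1) zero_Pos by (simp add: F_def)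
  ultimately show ?thesis using upper_lower[of F h] assms(2) by simp
qed

text \<open>Compactness enters here through \<open>L_le_suminf\<close>: no countable cover of
  \<open>f\<close> can cost less than \<open>L f\<close>. Together with \<open>upper_le_L\<close>
  this makes \<open>upper\<close> an extension of \<open>L\<close> on \<open>Pos\<close>.\<close>

lemma L_le_upper:
  assumes "f \<in> Pos" "\<And>x. ennreal (f x) \<le> h x"
  shows "ennreal (L f) \<le> upper h"
  by (rule upper_greatest, rule L_le_suminf[OF assms(1)]) (use assms(2) order_trans in blast)+

lemma upper_zero: "upper (\<lambda>x. 0) = 0"
  using upper_le_L[OF zero_Pos, of "\<lambda>x. 0"] L_zero by simp

lemma upper_suminf: "upper (\<lambda>x. \<Sum>n. h n x) \<le> (\<Sum>n. upper (h n))"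
proof (rule ennreal_le_epsilon)
  \<comment> \<open>When the right-hand side is infinite there is nothing to show. Otherwise each
    \<open>upper (h n)\<close> is finite, so adding \<open>e * (1/2)^Suc n\<close> makes it strictly
    larger and a cover of at most that cost exists.\<close>
  fix e :: real assume e: "0 < e" and "(\<Sum>n. upper (h n)) < top"
  then have *: "upper (h n) < upper (h n) + e * (1/2)^Suc n" for n
    by (auto simp add: less_top dest!: ennreal_suminf_lessD)
  have "\<exists>F. (\<forall>i. F i \<in> Pos) \<and> (\<forall>x. h n x \<le> (\<Sum>i. ennreal (F i x))) \<and>
      (\<Sum>i. ennreal (L (F i))) < upper (h n) + e * (1/2)^Suc n" for n
    using *[of n] unfolding upper_def[of "h n"] INF_less_iff by blast
  then obtain F where F: "\<And>n i. F n i \<in> Pos" "\<And>n x. h n x \<le> (\<Sum>i. ennreal (F n i x))"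
    and Fle: "\<And>n. (\<Sum>i. ennreal (L (F n i))) < upper (h n) + e * (1/2)^Suc n" by metis
  \<comment> \<open>\<open>prod_decode\<close> lists the double family of covers as one
    sequence.\<close>
  define G where "G = case_prod F \<circ> prod_decode"
  have "upper (\<lambda>x. \<Sum>n. h n x) \<le> (\<Sum>i. ennreal (L (G i)))"
  proof (rule upper_lower)
    show "G i \<in> Pos" for i using F(1) by (simp add: G_def split_def)
    fix x
    have "(\<Sum>n. h n x) \<le> (\<Sum>n. \<Sum>i. ennreal (F n i x))" by (intro suminf_le F summableI)
    also have "\<dots> = (\<Sum>i. ennreal (G i x))"
      unfolding G_def comp_def
      by (rule suminf_ennreal_2dimen[symmetric, where f = "\<lambda>p. ennreal (case_prod F p x)", simplified])
        (simp add: split_def)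
    finally show "(\<Sum>n. h n x) \<le> (\<Sum>i. ennreal (G i x))" .
  qed
  also have "\<dots> = (\<Sum>n. \<Sum>i. ennreal (L (F n i)))"
    unfolding G_def comp_def
    by (rule suminf_ennreal_2dimen[where f = "\<lambda>p. ennreal (L (case_prod F p))"]) simp
  also have "\<dots> \<le> (\<Sum>n. upper (h n) + e * (1/2)^Suc n)"
    by (intro suminf_le summableI less_imp_le[OF Fle])
  also have "\<dots> = (\<Sum>n. upper (h n)) + (\<Sum>n. ennreal e * ennreal ((1/2) ^ Suc n))"
    using \<open>0 < e\<close> by (subst suminf_add[symmetric])
      (auto simp del: ennreal_suminf_cmult simp add: ennreal_mult[symmetric])
  also have "\<dots> = (\<Sum>n. upper (h n)) + e"
    unfolding ennreal_suminf_cmult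
    by (subst suminf_ennreal_eq[OF zero_le_power power_half_series]) auto
  finally show "upper (\<lambda>x. \<Sum>n. h n x) \<le> (\<Sum>n. upper (h n)) + e" .
qed

lemma upper_add: "upper (\<lambda>x. h x + k x) \<le> upper h + upper k"
proof -
  define H where "H n = (if n = (0::nat) then h else if n = 1 then k else (\<lambda>x. 0))" for n
  have "(\<Sum>n. H n x) = h x + k x" for x
    by (subst suminf_finite[of "{0, 1}"]) (auto simp: H_def)
  moreover have "(\<Sum>n. upper (H n)) = upper h + upper k"
    by (subst suminf_finite[of "{0, 1}"]) (auto simp: H_def upper_zero)
  ultimately show ?thesis using upper_suminf[of H] by (simp only:)
qed

text \<open>The increments of \<open>h\<close> from index \<open>k\<close> on are positive functions
  that sum to \<open>s - h k\<close>, and their values under \<open>L\<close> telescope. This bounds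
  what an increasing approximation still misses.\<close>

lemma upper_telescope:
  assumes h: "\<And>k. h k \<in> Pos" "\<And>k x. h k x \<le> h (Suc k) x"
    and lim: "\<And>x. (\<lambda>k. h k x) \<longlonglongrightarrow> s x" "(\<lambda>k. L (h k)) \<longlonglongrightarrow> l"
  shows "upper (\<lambda>x. ennreal (s x - h k x)) \<le> ennreal (l - L (h k))"
proof -
  define F where "F j x = h (Suc j + k) x - h (j + k) x" for j x
  have F: "F j \<in> Pos" for j
    unfolding F_def by (rule PosI[OF C0r_diff[OF Pos_C0r[OF h(1)] Pos_C0r[OF h(1)]]]) (simp add: h(2))
  have "(\<Sum>j. ennreal (F j x)) = ennreal (s x - h k x)" for x
    using Pos_nonneg[OF F] telescope_sums[OF LIMSEQ_ignore_initial_segment[OF lim(1), of k x]]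
    by (intro suminf_ennreal_eq) (auto simp: F_def)
  moreover have "(\<Sum>j. ennreal (L (F j))) = ennreal (l - L (h k))"
  proof (rule suminf_ennreal_eq)
    show "0 \<le> L (F j)" for j by (rule L_Pos[OF F])
    have "L (F j) = L (h (Suc j + k)) - L (h (j + k))" for j
      unfolding F_def by (intro L_diff Pos_C0r h)
    then show "(\<lambda>j. L (F j)) sums (l - L (h k))"
      using telescope_sums[OF LIMSEQ_ignore_initial_segment[OF lim(2), of k]] by simp
  qed
  ultimately show ?thesis using upper_lower[of F "\<lambda>x. ennreal (s x - h k x)"] F by simp
qed

text \<open>The usual approximation from below of the indicator of \<open>{x. 0 < f x}\<close>; it
  uses only scalars and the minimum with 1, hence stays in \<open>C0r U\<close>.\<close>

definition cut :: "('x \<Rightarrow> real) \<Rightarrow> nat \<Rightarrow> 'x \<Rightarrow> real" where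
  "cut f k x = min 1 (real k * f x)"

lemma cut_sequence:
  assumes f: "f \<in> Pos"
  shows "cut f k \<in> Pos" "cut f k x \<le> 1" "cut f k x \<le> cut f (Suc k) x"
    "(\<lambda>k. cut f k x) \<longlonglongrightarrow> indicator {x. 0 < f x} x"
    "\<exists>l\<le>1. (\<lambda>k. L (cut f k)) \<longlonglongrightarrow> l"
proof -
  have f0: "0 \<le> f x" for x by (rule Pos_nonneg[OF f])
  have h: "cut f k \<in> Pos" for k
  proof (rule PosI)
    show "cut f k \<in> C0r U" unfolding cut_def by (intro C0r_min1 C0r_cmult Pos_C0r f)
    show "0 \<le> cut f k x" for x using f0[of x] by (simp add: cut_def)
  qed
  have h1: "cut f k x \<le> 1" for k x by (simp add: cut_def)
  have hS: "cut f k x \<le> cut f (Suc k) x" for k x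
    unfolding cut_def using f0[of x] by (intro min.mono mult_right_mono) auto
  have lim: "(\<lambda>k. cut f k x) \<longlonglongrightarrow> indicator {x. 0 < f x} x" for x
  proof (cases "0 < f x")
    case True
    obtain m where m: "1 / f x \<le> real m" using real_arch_simple by blast
    have "cut f k x = 1" if "m \<le> k" for k
    proof -
      have "1 / f x \<le> real k" using m that by linarith
      then have "1 \<le> real k * f x" using True by (simp add: divide_simps)
      then show ?thesis by (simp add: cut_def)
    qed
    then have "eventually (\<lambda>k. cut f k x = 1) sequentially" using eventually_sequentially by blast
    then show ?thesis using True by (simp add: tendsto_eventually)
  next
    case False
    then have "f x = 0" using f0[of x] by simp
    then show ?thesis by (simp add: cut_def)
  qed
  have L1: "L (cut f k) \<le> 1" for k by (rule L_le[OF Pos_C0r[OF h] h1]) simp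
  have "incseq (\<lambda>k. L (cut f k))"
    by (rule incseq_SucI) (rule L_mono[OF Pos_C0r[OF h] Pos_C0r[OF h] hS])
  then obtain l where l: "(\<lambda>k. L (cut f k)) \<longlonglongrightarrow> l"
    using incseq_convergent[of "\<lambda>k. L (cut f k)" 1] L1 by blast
  have "l \<le> 1" by (rule LIMSEQ_le_const2[OF l]) (use L1 in auto)
  then show "cut f k \<in> Pos" "cut f k x \<le> 1" "cut f k x \<le> cut f (Suc k) x"
    "(\<lambda>k. cut f k x) \<longlonglongrightarrow> indicator {x. 0 < f x} x"
    "\<exists>l\<le>1. (\<lambda>k. L (cut f k)) \<longlonglongrightarrow> l"
    using h h1 hS lim l by blast+
qed

lemma upper_indicator_pos_le:
  assumes f: "f \<in> Pos"
  shows "upper (indicator {x. 0 < f x}) \<le> 1"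
proof -
  obtain l where l: "l \<le> 1" "(\<lambda>k. L (cut f k)) \<longlonglongrightarrow> l" using cut_sequence(5)[OF f] by blast
  \<comment> \<open>Index 0 gives the zero function, so the telescoping bound covers the whole
    indicator.\<close>
  have "cut f 0 = (\<lambda>x. 0)" by (auto simp: cut_def)
  then have "upper (\<lambda>x. ennreal (indicator {x. 0 < f x} x)) \<le> ennreal l"
    using upper_telescope[OF cut_sequence(1,3,4)[OF f] l(2), of 0] by (simp add: L_zero)
  also have "\<dots> \<le> 1" using l(1) by simp
  finally show ?thesis by (simp add: ennreal_indicator)
qed

text \<open>A cover \<open>F\<close> of \<open>E\<close> is split into \<open>F n * h k\<close> and
  \<open>F n - F n * h k\<close>, where \<open>h k\<close> increases to the indicator of
  \<open>V\<close>. The first family covers \<open>E \<inter> V\<close> up to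
  \<open>indicator V - h k\<close>, which costs at most \<open>l - L (h k)\<close>. The second
  covers \<open>E - V\<close>, because \<open>h k\<close> vanishes off \<open>V\<close>. The two
  costs add up to that of \<open>F\<close>.\<close>

lemma caratheodory_pos:
  assumes f: "f \<in> Pos"
  defines "V \<equiv> {x. 0 < f x}"
  shows "upper (indicator (E \<inter> V)) + upper (indicator (E - V)) \<le> upper (indicator E)"
proof (rule upper_greatest)
  fix F :: "nat \<Rightarrow> 'x \<Rightarrow> real"
  assume F: "\<And>n. F n \<in> Pos" "\<And>x. indicator E x \<le> (\<Sum>n. ennreal (F n x))"
  define h where "h = cut f"
  obtain l where "(\<lambda>k. L (h k)) \<longlonglongrightarrow> l" using cut_sequence(5)[OF f] unfolding h_def by blast
  note h = cut_sequence(1-4)[OF f, folded h_def V_def] this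
  have h0: "h k x = 0" if "x \<notin> V" for k x
  proof -
    have "incseq (\<lambda>k. h k x)" using h(3) by (intro incseq_SucI)
    then have "h k x \<le> indicator V x" using h(4) by (rule incseq_le)
    then show ?thesis using that Pos_nonneg[OF h(1), of k x] by simp
  qed
  show "upper (indicator (E \<inter> V)) + upper (indicator (E - V)) \<le> (\<Sum>n. ennreal (L (F n)))"
  proof (rule ennreal_le_epsilon)
    fix e :: real assume "0 < e"
    then obtain k where "norm (L (h k) - l) < e"
      using LIMSEQ_D[OF h(5), of e] by blast
    then have k: "l - L (h k) \<le> e" by (simp add: abs_less_iff)
    have c1: "(\<lambda>x. F n x * h k x) \<in> Pos" for n
    proof (rule PosI)
      show "(\<lambda>x. F n x * h k x) \<in> C0r U" by (rule C0r_mult[OF Pos_C0r[OF F(1)] Pos_C0r[OF h(1)]])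
      show "0 \<le> F n x * h k x" for x
        by (rule mult_nonneg_nonneg[OF Pos_nonneg[OF F(1)] Pos_nonneg[OF h(1)]])
    qed
    have c2: "(\<lambda>x. F n x - F n x * h k x) \<in> Pos" for n
    proof (rule PosI)
      show "(\<lambda>x. F n x - F n x * h k x) \<in> C0r U"
        by (rule C0r_diff[OF Pos_C0r[OF F(1)] Pos_C0r[OF c1]])
      show "0 \<le> F n x - F n x * h k x" for x
        using mult_left_mono[OF h(2)[of k x] Pos_nonneg[OF F(1)[of n], of x]] by simp
    qed
    have "upper (indicator (E \<inter> V)) \<le>
        upper (\<lambda>x. indicator E x * ennreal (h k x) + ennreal (indicator V x - h k x))"
    proof (rule upper_mono)
      fix x show "indicator (E \<inter> V) x \<le> indicator E x * ennreal (h k x) + ennreal (indicator V x - h k x)"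
        using Pos_nonneg[OF h(1), of k x] h(2)[of k x]
        by (auto simp: indicator_def ennreal_plus[symmetric] simp del: ennreal_plus)
    qed
    also have "\<dots> \<le> upper (\<lambda>x. indicator E x * ennreal (h k x)) + upper (\<lambda>x. ennreal (indicator V x - h k x))"
      by (rule upper_add)
    also have "\<dots> \<le> (\<Sum>n. ennreal (L (\<lambda>x. F n x * h k x))) + ennreal e"
    proof (rule add_mono)
      show "upper (\<lambda>x. indicator E x * ennreal (h k x)) \<le> (\<Sum>n. ennreal (L (\<lambda>x. F n x * h k x)))"
      proof (rule upper_lower[OF c1])
        fix x
        have "indicator E x * ennreal (h k x) \<le> (\<Sum>n. ennreal (F n x)) * ennreal (h k x)"
          by (rule mult_right_mono[OF F(2)]) simp
        also have "\<dots> = (\<Sum>n. ennreal (F n x * h k x))"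
          by (simp add: ennreal_mult Pos_nonneg F(1) h(1))
        finally show "indicator E x * ennreal (h k x) \<le> (\<Sum>n. ennreal (F n x * h k x))" .
      qed
      have "upper (\<lambda>x. ennreal (indicator V x - h k x)) \<le> ennreal (l - L (h k))"
        by (rule upper_telescope[OF h(1,3,4,5)])
      also have "\<dots> \<le> ennreal e" using k by (rule ennreal_leI)
      finally show "upper (\<lambda>x. ennreal (indicator V x - h k x)) \<le> ennreal e" .
    qed
    finally have 1: "upper (indicator (E \<inter> V)) \<le> (\<Sum>n. ennreal (L (\<lambda>x. F n x * h k x))) + ennreal e" .
    have 2: "upper (indicator (E - V)) \<le> (\<Sum>n. ennreal (L (\<lambda>x. F n x - F n x * h k x)))"
    proof (rule upper_lower[OF c2])
      fix x show "indicator (E - V) x \<le> (\<Sum>n. ennreal (F n x - F n x * h k x))"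
      proof (cases "x \<in> E - V")
        case True then show ?thesis using F(2)[of x] h0[of x k] by simp
      qed simp
    qed
    have 3: "(\<Sum>n. ennreal (L (\<lambda>x. F n x * h k x))) + (\<Sum>n. ennreal (L (\<lambda>x. F n x - F n x * h k x))) =
        (\<Sum>n. ennreal (L (F n)))"
    proof (subst suminf_add)
      have "ennreal (L (\<lambda>x. F n x * h k x)) + ennreal (L (\<lambda>x. F n x - F n x * h k x)) = ennreal (L (F n))" for n
        using L_Pos[OF c1[of n]] L_Pos[OF c2[of n]] L_diff[OF Pos_C0r[OF F(1)[of n]] Pos_C0r[OF c1[of n]]]
        by (simp add: ennreal_plus[symmetric] del: ennreal_plus)
      then show "(\<Sum>n. ennreal (L (\<lambda>x. F n x * h k x)) + ennreal (L (\<lambda>x. F n x - F n x * h k x))) =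
        (\<Sum>n. ennreal (L (F n)))" by simp
    qed (rule summableI)+
    show "upper (indicator (E \<inter> V)) + upper (indicator (E - V)) \<le> (\<Sum>n. ennreal (L (F n))) + ennreal e"
      unfolding 3[symmetric] by (rule order_trans[OF add_mono[OF 1 2]]) (simp only: ac_simps order_refl)
  qed
qed

section \<open>The outer measure and its restriction to Borel sets\<close>

lemma outer_measure_upper: "outer_measure_space (Pow U) (\<lambda>E. upper (indicator E))"
  unfolding outer_measure_space_def
proof (intro conjI)
  show "positive (Pow U) (\<lambda>E. upper (indicator E))"
    using upper_zero by (simp add: positive_def indicator_def[abs_def])
  show "increasing (Pow U) (\<lambda>E. upper (indicator E))"
    unfolding increasing_def by (intro ballI impI upper_mono) (auto simp: indicator_def)
  show "countably_subadditive (Pow U) (\<lambda>E. upper (indicator E))"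
    unfolding countably_subadditive_def
  proof (intro allI impI)
    fix A :: "nat \<Rightarrow> 'x set"
    have "upper (indicator (\<Union>i. A i)) \<le> upper (\<lambda>x. \<Sum>i. indicator (A i) x)"
    proof (rule upper_mono)
      fix x show "indicator (\<Union>i. A i) x \<le> (\<Sum>i. indicator (A i) x :: ennreal)"
      proof (cases "x \<in> (\<Union>i. A i)")
        case True
        then obtain i where "x \<in> A i" by blast
        then have "1 = (\<Sum>i\<in>{i}. indicator (A i) x :: ennreal)" by simp
        also have "\<dots> \<le> (\<Sum>i. indicator (A i) x)" by (intro sum_le_suminf summableI) auto
        finally show ?thesis using True by simp
      qed simp
    qed
    also have "\<dots> \<le> (\<Sum>i. upper (indicator (A i)))" by (rule upper_suminf)
    finally show "upper (indicator (\<Union>i. A i)) \<le> (\<Sum>i. upper (indicator (A i)))" .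
  qed
qed

text \<open>Positivity sets of functions in \<open>Pos\<close> satisfy the Caratheodory condition by
  \<open>caratheodory_pos\<close> and subadditivity. Open subsets of \<open>U\<close> are countable
  unions of such sets, and the Caratheodory sets form a sigma-algebra.\<close>

lemma borel_lambda_system:
  "sets (restrict_space borel U) \<subseteq> lambda_system U (Pow U) (\<lambda>E. upper (indicator E))"
proof -
  let ?\<mu> = "\<lambda>E. upper (indicator E)"
  let ?A = "lambda_system U (Pow U) ?\<mu>"
  interpret P: sigma_algebra U "Pow U" by (rule sigma_algebra_Pow)
  have sa: "sigma_algebra U ?A"
    using P.caratheodory_lemma[OF outer_measure_upper] by (simp add: measure_space_def)
  interpret A: sigma_algebra U ?A by (rule sa)
  have pos: "{x. 0 < f x} \<in> ?A" if f: "f \<in> Pos" for f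
  proof -
    let ?V = "{x. 0 < f x}"
    have VU: "?V \<subseteq> U" using Pos_C0r[OF f] by (force simp: C0r_def)
    have "?\<mu> (?V \<inter> E) + ?\<mu> ((U - ?V) \<inter> E) = ?\<mu> E" if E: "E \<subseteq> U" for E
    proof -
      have eq: "?V \<inter> E = E \<inter> ?V" "(U - ?V) \<inter> E = E - ?V" using E by auto
      have "?\<mu> E \<le> upper (\<lambda>x. indicator (E \<inter> ?V) x + indicator (E - ?V) x)"
        by (rule upper_mono) (auto simp: indicator_def)
      also have "\<dots> \<le> ?\<mu> (E \<inter> ?V) + ?\<mu> (E - ?V)" by (rule upper_add)
      finally show ?thesis unfolding eq using caratheodory_pos[OF f, of E] by (rule antisym[rotated])
    qed
    then show ?thesis using VU by (simp add: lambda_system_def)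
  qed
  have op: "V \<in> ?A" if "open V" "V \<subseteq> U" for V
  proof -
    obtain f :: "nat \<Rightarrow> 'x \<Rightarrow> real" where f: "\<And>n. f n \<in> C0r V" "\<And>n x. 0 \<le> f n x"
      "V = (\<Union>n. {x. 0 < f n x})"
      using open_countable_C0r[OF lc \<open>open V\<close>] by metis
    have "f n \<in> Pos" for n using C0r_mono[OF that(2) f(1)] f(2) by (rule PosI)
    then show ?thesis unfolding f(3) using pos by blast
  qed
  have S: "sets (sigma U ?A) = ?A" "space (sigma U ?A) = U"
    using A.sigma_sets_eq A.space_closed by (auto simp: sets_measure_of)
  \<comment> \<open>Measurability of the identity map carries the result from open sets to all Borel
    sets.\<close>
  have "(\<lambda>x. x) \<in> borel_measurable (sigma U ?A)"
  proof (rule borel_measurableI)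
    fix S :: "'x set" assume "open S"
    then have "S \<inter> U \<in> ?A" using open_U by (intro op) auto
    then show "(\<lambda>x. x) -` S \<inter> space (sigma U ?A) \<in> sets (sigma U ?A)" by (simp only: S) (simp add: vimage_def)
  qed
  then have "B \<inter> U \<in> ?A" if "B \<in> sets borel" for B
    using measurable_sets[OF _ that] by (force simp only: S vimage_ident)
  then show ?thesis by (auto simp: sets_restrict_space Int_commute)
qed

lemma representing_measure:
  obtains \<mu> where "space \<mu> = U" "sets \<mu> = sets (restrict_space borel U)"
    "\<And>A. A \<in> sets \<mu> \<Longrightarrow> emeasure \<mu> A = upper (indicator A)" "emeasure \<mu> U \<le> 1"
proof -
  let ?m = "\<lambda>E. upper (indicator E)" and ?S = "sets (restrict_space borel U)"
  define \<mu> where "\<mu> = measure_of U ?S ?m"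
  interpret P: sigma_algebra U "Pow U" by (rule sigma_algebra_Pow)
  have spU: "space (restrict_space borel U) = U" by (simp add: space_restrict_space)
  have sa: "sigma_algebra U ?S" using sets.sigma_algebra_axioms[of "restrict_space borel U"] by (simp add: spU)
  have ms: "measure_space U ?S ?m"
    by (rule measure_down[OF P.caratheodory_lemma[OF outer_measure_upper] sa borel_lambda_system])
  have sub: "?S \<subseteq> Pow U" using sets.space_closed[of "restrict_space borel U"] by (simp add: spU)
  have s: "space \<mu> = U" "sets \<mu> = ?S"
    unfolding \<mu>_def using sub sigma_algebra.sigma_sets_eq[OF sa] by (simp_all add: space_measure_of sets_measure_of)
  have em: "emeasure \<mu> A = ?m A" if "A \<in> sets \<mu>" for A
    using that ms unfolding \<mu>_def by (intro emeasure_measure_of_sigma) (auto simp: measure_space_def s(2)[unfolded \<mu>_def])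
  have "emeasure \<mu> U \<le> 1"
  proof -
    obtain f :: "nat \<Rightarrow> 'x \<Rightarrow> real" where f: "\<And>n. f n \<in> C0r U" "\<And>n x. 0 \<le> f n x"
      "U = (\<Union>n. {x. 0 < f n x})"
      using open_countable_C0r[OF lc open_U] by metis
    \<comment> \<open>Adding the functions yields the union of their positivity sets as the
      positivity set of a single function, to which \<open>upper_indicator_pos_le\<close> applies.
      These sets increase to \<open>U\<close>, so the bound passes to \<open>U\<close> by continuity
      from below.\<close>
    define T where "T n = {x. 0 < (\<Sum>i<n. f i x)}" for n
    have T: "(\<lambda>x. \<Sum>i<n. f i x) \<in> Pos" for n
      by (intro PosI C0r_sum f sum_nonneg)
    have TU: "T n \<subseteq> U" for n using Pos_C0r[OF T[of n]] by (force simp: T_def C0r_def)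
    have "open (T n)" for n unfolding T_def by (rule open_C0r_pos[OF Pos_C0r[OF T]])
    then have Tm: "T n \<in> sets \<mu>" for n
      unfolding s(2) sets_restrict_space using TU[of n] by (intro image_eqI[of _ _ "T n"]) auto
    have "incseq T"
    proof (rule incseq_SucI, rule subsetI)
      fix n x assume "x \<in> T n" then show "x \<in> T (Suc n)" using f(2)[of n x] by (simp add: T_def)
    qed
    then have "(SUP n. emeasure \<mu> (T n)) = emeasure \<mu> (\<Union>n. T n)"
      using Tm by (intro SUP_emeasure_incseq) auto
    moreover have "(\<Union>n. T n) = U"
    proof (intro antisym subsetI)
      fix x assume "x \<in> U"
      then obtain n where n: "0 < f n x" using f(3) by blast
      have "f n x \<le> (\<Sum>i<Suc n. f i x)" using f(2) by (intro member_le_sum) auto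
      then have "x \<in> T (Suc n)" using n by (simp add: T_def)
      then show "x \<in> (\<Union>n. T n)" by blast
    qed (use TU in blast)
    moreover have "emeasure \<mu> (T n) \<le> 1" for n
      unfolding em[OF Tm] unfolding T_def by (rule upper_indicator_pos_le[OF T])
    ultimately show ?thesis by (metis SUP_least)
  qed
  then show thesis using that[of \<mu>] s em by blast
qed

text \<open>The slices of height one of a nonnegative number add up to the number, capped at the
  total height \<open>n\<close>; this is the layer-cake decomposition used for the Riesz
  theorem.\<close>

lemma sum_clip: "0 \<le> y \<Longrightarrow> (\<Sum>i<n. min 1 (max 0 (y - real i))) = min (real n) y"
  by (induction n) (auto simp: min_def max_def)

theorem riesz_representation:
  obtains \<mu> where "space \<mu> = U" "sets \<mu> = sets (restrict_space borel U)" "emeasure \<mu> U \<le> 1"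
    "\<And>f. f \<in> C0r U \<Longrightarrow> integrable \<mu> f" "\<And>f. f \<in> C0r U \<Longrightarrow> integral\<^sup>L \<mu> f = L f"
proof -
  obtain \<mu> where \<mu>: "space \<mu> = U" "sets \<mu> = sets (restrict_space borel U)"
    "\<And>A. A \<in> sets \<mu> \<Longrightarrow> emeasure \<mu> A = upper (indicator A)" "emeasure \<mu> U \<le> 1"
    using representing_measure by metis
  interpret finite_measure \<mu>
    by (rule finite_measureI) (use \<mu>(1,4) in \<open>auto simp: top_unique\<close>)
  have mU: "measure \<mu> A \<le> 1" for A
  proof -
    have "emeasure \<mu> A \<le> 1" using \<mu>(1,4) emeasure_space[of \<mu> A] order_trans by metis
    then show ?thesis by (simp add: measure_def enn2real_leI)
  qed
  have meas: "f \<in> borel_measurable \<mu>" if "f \<in> C0r U" for f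
  proof -
    have "f \<in> borel_measurable borel"
      using C0r_continuous[OF that] by (rule borel_measurable_continuous_onI)
    then have "f \<in> borel_measurable (restrict_space borel U)" by (rule measurable_restrict_space1)
    then show ?thesis using measurable_cong_sets[OF \<mu>(2) refl] by blast
  qed
  have int: "integrable \<mu> f" if f: "f \<in> C0r U" for f
  proof -
    obtain K where "\<And>x. \<bar>f x\<bar> \<le> K" using C0r_bounded[OF f] by metis
    then show ?thesis using meas[OF f] by (intro integrable_const_bound[of _ K]) auto
  qed
  \<comment> \<open>Layer cake: \<open>n * f\<close> is the sum of slices \<open>p i\<close> lying
    between the indicators of \<open>V (Suc i)\<close> and \<open>V i\<close>. Both the integral and
    \<open>L\<close> of \<open>p i\<close> therefore lie between \<open>a (Suc i)\<close> and
    \<open>a i\<close>. These gaps telescope to at most 1, so \<open>n\<close> times the discrepancy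
    is at most 1 for every \<open>n\<close>.\<close>
  have unit: "integral\<^sup>L \<mu> f = L f" if f: "f \<in> Pos" and f1: "\<And>x. f x \<le> 1" for f
  proof (rule ccontr)
    assume "integral\<^sup>L \<mu> f \<noteq> L f"
    then have "0 < \<bar>integral\<^sup>L \<mu> f - L f\<bar>" by simp
    then obtain n where n: "1 < real n * \<bar>integral\<^sup>L \<mu> f - L f\<bar>"
      using reals_Archimedean3 by blast
    have fC: "f \<in> C0r U" and f0: "0 \<le> f x" for x using f by (auto simp: Pos_def)
    define p where "p i x = min 1 (max 0 (real n * f x - real i))" for i x
    have p: "p i \<in> C0r U" for i
    proof (rule C0r_dominated[OF fC fC, of _ "real n"])
      show "continuous_on UNIV (p i)" unfolding p_def
        by (intro continuous_on_min continuous_on_max continuous_on_const continuous_on_diff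
            continuous_on_mult C0r_continuous[OF fC])
      fix x
      have "0 \<le> real n * f x" using f0[of x] by simp
      moreover from this have "\<bar>p i x\<bar> \<le> real n * f x" unfolding p_def by linarith
      ultimately show "\<bar>p i x\<bar> \<le> real n * (\<bar>f x\<bar> + \<bar>f x\<bar>)"
        using f0[of x] unfolding distrib_left by simp
    qed
    have pP: "p i \<in> Pos" for i by (rule PosI[OF p]) (simp add: p_def)
    define V where "V i = {x. real i < real n * f x}" for i
    define a where "a i = measure \<mu> (V i)" for i
    have V: "V i \<in> sets \<mu>" for i
    proof -
      have "open (V i)" unfolding V_def
        by (intro open_Collect_less continuous_on_mult continuous_on_const C0r_continuous[OF fC])
      moreover have "V i \<subseteq> U" using fC by (force simp: V_def C0r_def)
      ultimately show ?thesis
        unfolding \<mu>(2) sets_restrict_space by (intro image_eqI[of _ _ "V i"]) auto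
    qed
    have lo: "indicator (V (Suc i)) x \<le> p i x" and hi: "p i x \<le> indicator (V i) x" for i x
      by (auto simp: V_def p_def indicator_def)
    have Lb: "a (Suc i) \<le> L (p i)" "L (p i) \<le> a i" for i
    proof -
      have "ennreal (a (Suc i)) \<le> ennreal (L (p i))"
        unfolding a_def emeasure_eq_measure[symmetric] \<mu>(3)[OF V]
        by (rule upper_le_L[OF pP]) (use lo[of i] in \<open>simp add: ennreal_indicator[symmetric] ennreal_leI\<close>)
      then show "a (Suc i) \<le> L (p i)" using L_Pos[OF pP] by simp
      have "ennreal (L (p i)) \<le> ennreal (a i)"
        unfolding a_def emeasure_eq_measure[symmetric] \<mu>(3)[OF V]
        by (rule L_le_upper[OF pP]) (use hi[of i] in \<open>simp add: ennreal_indicator[symmetric] ennreal_leI\<close>)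
      then show "L (p i) \<le> a i" by (simp add: a_def)
    qed
    have Jb: "a (Suc i) \<le> integral\<^sup>L \<mu> (p i)" "integral\<^sup>L \<mu> (p i) \<le> a i" for i
    proof -
      have i: "integrable \<mu> (indicator (V j) :: 'x \<Rightarrow> real)" for j
        using V by (intro integrable_real_indicator) (auto simp: less_top[symmetric])
      have a: "a j = integral\<^sup>L \<mu> (indicator (V j))" for j
        using V[of j] sets.sets_into_space[OF V[of j]] by (simp add: a_def Int_absorb2)
      show "a (Suc i) \<le> integral\<^sup>L \<mu> (p i)" unfolding a by (rule integral_mono[OF i int[OF p] lo])
      show "integral\<^sup>L \<mu> (p i) \<le> a i" unfolding a by (rule integral_mono[OF int[OF p] i hi])
    qed
    \<comment> \<open>Since \<open>f \<le> 1\<close>, the cap at \<open>n\<close> in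
      \<open>sum_clip\<close> cuts nothing off.\<close>
    have ps: "(\<Sum>i<n. p i x) = real n * f x" for x
    proof -
      have "real n * f x \<le> real n" using f1[of x] mult_left_mono[of "f x" 1 "real n"] by simp
      then show ?thesis unfolding p_def using f0[of x] by (subst sum_clip) auto
    qed
    have "real n * L f = (\<Sum>i<n. L (p i))"
      using L_sum[of "{..<n}" p] p L_cmult[OF fC, of "real n"] by (simp add: ps)
    moreover have "real n * integral\<^sup>L \<mu> f = (\<Sum>i<n. integral\<^sup>L \<mu> (p i))"
      using Bochner_Integration.integral_sum[of "{..<n}" \<mu> p] int[OF p] by (simp add: ps)
    ultimately have "real n * (integral\<^sup>L \<mu> f - L f) = (\<Sum>i<n. integral\<^sup>L \<mu> (p i) - L (p i))"
      by (simp add: right_diff_distrib sum_subtractf)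
    also have "\<bar>\<dots>\<bar> \<le> (\<Sum>i<n. \<bar>integral\<^sup>L \<mu> (p i) - L (p i)\<bar>)" by (rule sum_abs)
    also have "\<dots> \<le> (\<Sum>i<n. a i - a (Suc i))"
    proof (rule sum_mono)
      fix i show "\<bar>integral\<^sup>L \<mu> (p i) - L (p i)\<bar> \<le> a i - a (Suc i)"
        using Lb[of i] Jb[of i] by linarith
    qed
    also have "\<dots> = a 0 - a n" by (rule sum_lessThan_telescope')
    also have "\<dots> \<le> 1" using mU[of "V 0"] measure_nonneg[of \<mu> "V n"] unfolding a_def by linarith
    finally show False using n by (simp add: abs_mult)
  qed
  have pos: "integral\<^sup>L \<mu> f = L f" if f: "f \<in> Pos" for f
  proof -
    obtain K where K: "K > 0" "\<And>x. \<bar>f x\<bar> \<le> K" using C0r_bounded[OF Pos_C0r[OF f]] by metis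
    have "(\<lambda>x. inverse K * f x) \<in> Pos"
      using K(1) Pos_nonneg[OF f] by (intro PosI[OF C0r_cmult[OF Pos_C0r[OF f]]]) auto
    moreover have "inverse K * f x \<le> 1" for x
      using K(1) K(2)[of x] by (simp add: field_simps)
    ultimately have "inverse K * integral\<^sup>L \<mu> f = inverse K * L f"
      using unit[of "\<lambda>x. inverse K * f x"] L_cmult[OF Pos_C0r[OF f], of "inverse K"] by simp
    then show ?thesis using K(1) by simp
  qed
  have "integral\<^sup>L \<mu> f = L f" if f: "f \<in> C0r U" for f
  proof -
    have m: "(\<lambda>x. - f x) \<in> C0r U" using C0r_cmult[OF f, of "-1"] by simp
    let ?p = "\<lambda>x. max (f x) 0" and ?q = "\<lambda>x. max (- f x) 0"
    have P: "?p \<in> Pos" "?q \<in> Pos" by (intro PosI C0r_max f m C0r_zero; simp)+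
    have eq: "f = (\<lambda>x. ?p x - ?q x)" by auto
    have "integral\<^sup>L \<mu> (\<lambda>x. ?p x - ?q x) = integral\<^sup>L \<mu> ?p - integral\<^sup>L \<mu> ?q"
      by (rule Bochner_Integration.integral_diff[OF int[OF Pos_C0r[OF P(1)]] int[OF Pos_C0r[OF P(2)]]])
    also have "\<dots> = L ?p - L ?q" unfolding pos[OF P(1)] pos[OF P(2)] ..
    also have "\<dots> = L (\<lambda>x. ?p x - ?q x)"
      by (rule L_diff[OF Pos_C0r[OF P(1)] Pos_C0r[OF P(2)], symmetric])
    finally show ?thesis unfolding eq[symmetric] .
  qed
  then show thesis using that[of \<mu>] \<mu> int by blast
qed

end

section \<open>The corner of the crossed product\<close>

lemma cinner_commute: "cinner \<eta> \<xi> = cnj (cinner \<xi> \<eta>)"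
  unfolding cinner_def infsum_cnj[symmetric] by (simp add: mult.commute)

lemma cinner_add_left: "cinner (\<xi> + \<eta>) \<zeta> = cinner \<xi> \<zeta> + cinner \<eta> \<zeta>"
  unfolding cinner_def by (simp add: distrib_right infsum_add cinner_summable)

lemma cinner_add_right: "cinner \<zeta> (\<xi> + \<eta>) = cinner \<zeta> \<xi> + cinner \<zeta> \<eta>"
  using cinner_add_left[of \<xi> \<eta> \<zeta>] by (metis cinner_commute complex_cnj_add)

lemma cinner_scaleC_left: "cinner ((c *\<^sub>C a) \<xi>) \<eta> = c * cinner (a \<xi>) \<eta>"
  unfolding cinner_def by (simp add: coord_scaleC mult.assoc infsum_cmult_right')

lemma cinner_scaleC_right: "cinner \<xi> ((c *\<^sub>C a) \<eta>) = cnj c * cinner \<xi> (a \<eta>)"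
  using cinner_scaleC_left[of c a \<eta> \<xi>] by (metis cinner_commute complex_cnj_mult)

lemma cinner_delta: "cinner \<xi> (delta i) = coord \<xi> i"
proof -
  have "cinner \<xi> (delta i) = (\<Sum>\<^sub>\<infinity>j\<in>{i}. coord \<xi> j * cnj (coord (delta i) j))"
    unfolding cinner_def by (rule infsum_cong_neutral) (auto simp: delta.rep_eq)
  then show ?thesis by (simp add: delta.rep_eq)
qed

lemma cinner_self_norm: "cinner \<xi> \<xi> = complex_of_real ((norm \<xi>)\<^sup>2)"
  by (simp add: cinner_self norm_ell2_eq infsum_nonneg)

lemma norm_delta: "norm (delta i) = 1"
proof -
  have "complex_of_real ((norm (delta i))\<^sup>2) = 1"
    unfolding cinner_self_norm[symmetric] cinner_delta by (simp add: delta.rep_eq)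
  then have "(norm (delta i))\<^sup>2 = 1" by (simp only: of_real_eq_1_iff)
  then show ?thesis by (simp add: power2_eq_1_iff) (metis norm_ge_zero not_one_le_zero neg_0_le_iff_le order_trans)
qed

lemma norm_le_coord:
  assumes "0 \<le> K" "\<And>i. cmod (coord \<eta> i) \<le> K * cmod (coord \<xi> i)"
  shows "norm \<eta> \<le> K * norm \<xi>"
proof -
  have "(\<Sum>\<^sub>\<infinity>i. (cmod (coord \<eta> i))\<^sup>2) \<le> (\<Sum>\<^sub>\<infinity>i. K\<^sup>2 * (cmod (coord \<xi> i))\<^sup>2)"
  proof (rule infsum_mono)
    show "(cmod (coord \<eta> i))\<^sup>2 \<le> K\<^sup>2 * (cmod (coord \<xi> i))\<^sup>2" for i
      using power_mono[OF assms(2)[of i], of 2] by (simp add: power_mult_distrib)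
  qed (intro coord_summable summable_on_cmult_right)+
  also have "\<dots> = K\<^sup>2 * (\<Sum>\<^sub>\<infinity>i. (cmod (coord \<xi> i))\<^sup>2)" by (rule infsum_cmult_right')
  finally have "norm \<eta> \<le> sqrt (K\<^sup>2 * (\<Sum>\<^sub>\<infinity>i. (cmod (coord \<xi> i))\<^sup>2))"
    unfolding norm_ell2_eq by (rule real_sqrt_le_mono)
  also have "\<dots> = K * norm \<xi>" using assms(1) by (simp add: norm_ell2_eq real_sqrt_mult)
  finally show ?thesis .
qed

lemma cmod_coord_le: "cmod (coord \<xi> i) \<le> norm \<xi>"
proof -
  have "(\<Sum>j\<in>{i}. (cmod (coord \<xi> j))\<^sup>2) \<le> (\<Sum>\<^sub>\<infinity>j. (cmod (coord \<xi> j))\<^sup>2)"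
    by (rule finite_sum_le_infsum[OF coord_summable]) auto
  then have "sqrt ((cmod (coord \<xi> i))\<^sup>2) \<le> norm \<xi>"
    unfolding norm_ell2_eq by (intro real_sqrt_le_mono) simp
  then show ?thesis by simp
qed

lemma norm_diag_op:
  assumes "0 \<le> K" "\<And>i. cmod (d i) \<le> K"
  shows "norm (diag_op d) \<le> K"
proof (rule norm_blinfun_bound[OF assms(1)])
  show "norm (diag_op d \<xi>) \<le> K * norm \<xi>" for \<xi>
    by (rule norm_le_coord[OF assms(1)])
      (simp add: coord_diag_op[OF assms(2)] norm_mult mult_right_mono assms(2))
qed

lemma norm_compose_le: "norm a \<le> r \<Longrightarrow> norm b \<le> s \<Longrightarrow> norm (a o\<^sub>L b) \<le> r * s"
  by (rule order_trans[OF norm_blinfun_compose mult_mono]) (auto intro: order_trans[OF norm_ge_zero])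

lemma norm_scaleC_le: "norm (c *\<^sub>C a) \<le> cmod c * norm a"
  unfolding scaleC_def by (intro norm_compose_le norm_diag_op) auto

lemmas op_coord_simps = coord_scaleC blinfun.add_left blinfun.add_right blinfun.diff_left
  blinfun.minus_left blinfun.scaleR_left blinfun.zero_left

lemma scaleC_add_right: "c *\<^sub>C (a + b) = c *\<^sub>C a + c *\<^sub>C b"
  and scaleC_add_left: "(c + d) *\<^sub>C a = c *\<^sub>C a + d *\<^sub>C a"
  and scaleC_scaleC: "c *\<^sub>C d *\<^sub>C a = (c * d) *\<^sub>C a"
  and scaleC_of_real: "complex_of_real r *\<^sub>C a = r *\<^sub>R a"
  and scaleC_one: "1 *\<^sub>C a = a"
  and scaleC_zero_right: "c *\<^sub>C 0 = 0"
  and scaleC_compose_left: "(c *\<^sub>C a) o\<^sub>L b = c *\<^sub>C (a o\<^sub>L b)"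
  by (rule op_eqI, simp add: op_coord_simps algebra_simps)+

lemma bounded_linear_compose_right: "bounded_linear (\<lambda>b. a o\<^sub>L b)"
  and bounded_linear_compose_left: "bounded_linear (\<lambda>a. a o\<^sub>L b)"
  using bounded_bilinear_blinfun_compose
  by (rule bounded_bilinear.bounded_linear_right, rule bounded_bilinear.bounded_linear_left)

lemma bounded_linear_scaleC: "bounded_linear (\<lambda>a. c *\<^sub>C a)"
  unfolding scaleC_def by (rule bounded_linear_compose_right)

lemma closed_subspace_vimage:
  assumes "bounded_linear f" "closed T" "subspace T"
  shows "closed (f -` T)" "subspace (f -` T)"
proof -
  interpret bounded_linear f by fact
  show "closed (f -` T)" by (intro closed_vimage assms(2) linear_continuous_on assms(1))
  show "subspace (f -` T)" using assms(3) by (auto simp: subspace_def add scale zero)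
qed

text \<open>As \<open>cspan\<close> is the real span of all complex multiples, \<open>T\<close> may
  be any closed real subspace; complex multiples have to be checked on the generators only.\<close>

lemma closure_cspan_subset:
  assumes "closed T" "subspace T" "\<And>c s. s \<in> S \<Longrightarrow> c *\<^sub>C s \<in> T"
  shows "closure (cspan S) \<subseteq> T"
  unfolding cspan_def by (intro closure_minimal span_minimal) (use assms in auto)

lemma subspace_closure:
  fixes S :: "'a::real_normed_vector set"
  assumes "subspace S"
  shows "subspace (closure S)"
  unfolding subspace_def
proof (intro conjI ballI allI)
  show "0 \<in> closure S" using subspace_0[OF assms] closure_subset by blast
next
  fix x y assume "x \<in> closure S" "y \<in> closure S"
  then obtain u v where u: "\<forall>n. u n \<in> S" "u \<longlonglongrightarrow> x" and v: "\<forall>n. v n \<in> S" "v \<longlonglongrightarrow> y"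
    unfolding closure_sequential by (elim exE conjE)
  show "x + y \<in> closure S"
    unfolding closure_sequential
  proof (intro exI[of _ "\<lambda>n. u n + v n"] conjI allI)
    show "u n + v n \<in> S" for n using u(1) v(1) by (simp add: subspace_add[OF assms])
    show "(\<lambda>n. u n + v n) \<longlonglongrightarrow> x + y" by (rule tendsto_add[OF u(2) v(2)])
  qed
next
  fix c x assume "x \<in> closure S"
  then obtain u where u: "\<forall>n. u n \<in> S" "u \<longlonglongrightarrow> x"
    unfolding closure_sequential by (elim exE conjE)
  show "c *\<^sub>R x \<in> closure S"
    unfolding closure_sequential
  proof (intro exI[of _ "\<lambda>n. c *\<^sub>R u n"] conjI allI)
    show "c *\<^sub>R u n \<in> S" for n using u(1) by (simp add: subspace_scale[OF assms])
    show "(\<lambda>n. c *\<^sub>R u n) \<longlonglongrightarrow> c *\<^sub>R x" by (rule tendsto_scaleR[OF tendsto_const u(2)])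
  qed
qed

lemma subspace_closure_cspan: "subspace (closure (cspan S))"
  unfolding cspan_def by (intro subspace_closure subspace_span)

lemma scaleC_cspan: "s \<in> S \<Longrightarrow> c *\<^sub>C s \<in> cspan S"
  by (auto simp: cspan_def intro: span_base)

lemma is_adjoint_add: "is_adjoint a a' \<Longrightarrow> is_adjoint b b' \<Longrightarrow> is_adjoint (a + b) (a' + b')"
  by (simp add: is_adjoint_def blinfun.add_left cinner_add_left cinner_add_right)

lemma is_adjoint_scaleC: "is_adjoint a a' \<Longrightarrow> is_adjoint (c *\<^sub>C a) (cnj c *\<^sub>C a')"
  by (simp add: is_adjoint_def cinner_scaleC_left cinner_scaleC_right)

lemma cond_exp_add: "cond_exp (a + b) x = cond_exp a x + cond_exp b x"
  and cond_exp_scaleC: "cond_exp (c *\<^sub>C a) x = c * cond_exp a x"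
  and cond_exp_scaleR: "cond_exp (r *\<^sub>R a) x = of_real r * cond_exp a x"
  and cond_exp_zero: "cond_exp 0 x = 0"
  by (simp_all add: cond_exp_def op_coord_simps)

lemma cmod_cond_exp_le: "cmod (cond_exp a x) \<le> norm a"
  unfolding cond_exp_def using cmod_coord_le norm_blinfun[of a "delta (0, x)"] order_trans
  by (fastforce simp: norm_delta)

lemma bounded_linear_cond_exp: "bounded_linear (\<lambda>a. cond_exp a x)"
  by (rule bounded_linear_intro[of _ 1])
    (simp_all add: cond_exp_add cond_exp_scaleR cmod_cond_exp_le scaleR_conv_of_real)

lemma cond_exp_adjoint:
  assumes "is_adjoint a b"
  shows "cond_exp (b o\<^sub>L a) x = complex_of_real ((norm (a (delta (0, x))))\<^sup>2)"
proof -
  have "cond_exp (b o\<^sub>L a) x = cnj (cinner (delta (0, x)) (b (a (delta (0, x)))))"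
    unfolding cond_exp_def cinner_delta[symmetric] by (subst cinner_commute) simp
  also have "\<dots> = cnj (cinner (a (delta (0, x))) (a (delta (0, x))))"
    using assms by (simp add: is_adjoint_def)
  finally show ?thesis by (simp add: cinner_self_norm)
qed

section \<open>Generators of the corner and density arguments\<close>

locale groupoid_corner =
  fixes act :: "'g::group_add \<Rightarrow> 'x::t2_space \<Rightarrow> 'x" and Y :: "'x set"
  assumes act: "continuous_action act" and open_Y: "open Y" and closed_Y: "closed Y"
begin

lemma act_zero: "act 0 x = x" and act_add: "act (g + h) x = act g (act h x)"
  and act_cont: "continuous_on S (act g)"
  using act by (auto simp: continuous_action_def intro: continuous_on_subset)

lemma act_cancel [simp]: "act (- g) (act g x) = x" "act g (act (- g) x) = x"
  by (simp_all add: act_add[symmetric] act_zero)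

lemma C0_act: "f \<in> C0 \<Longrightarrow> (\<lambda>x. f (act g x)) \<in> C0"
  by (rule C0_homeo[of f "act g" "act (- g)"]) (auto intro: act_cont)

text \<open>\<open>dom g\<close> is the image under the range map of the part of the groupoid lying over \<open>g\<close>, and
  \<open>gen g f\<close> is the element \<open>f u\<^sub>g\<close> of the corner when \<open>f\<close> is supported there.\<close>

definition dom :: "'g \<Rightarrow> 'x set" where
  "dom g = {x \<in> Y. act (- g) x \<in> Y}"

definition gen :: "'g \<Rightarrow> ('x \<Rightarrow> complex) \<Rightarrow> ('g \<times> 'x) op" where
  "gen g f = mult_op act f o\<^sub>L trans_op g"

definition coeffs :: "'g \<Rightarrow> ('x \<Rightarrow> complex) set" where
  "coeffs g = {f \<in> C0. \<forall>x. x \<notin> dom g \<longrightarrow> f x = 0}"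

definition gens :: "('g \<times> 'x) op set" where
  "gens = {gen g f | g f. f \<in> coeffs g}"

abbreviation A :: "('g \<times> 'x) op set" where
  "A \<equiv> reduced_algebra act Y"

lemma coeffsD: "f \<in> coeffs g \<Longrightarrow> f \<in> C0" "f \<in> coeffs g \<Longrightarrow> x \<notin> dom g \<Longrightarrow> f x = 0"
  by (auto simp: coeffs_def)

lemma dom_zero: "dom 0 = Y"
  by (auto simp: dom_def act_zero)

lemma dom_uminus: "x \<in> dom (- g) \<longleftrightarrow> act g x \<in> dom g"
  by (auto simp: dom_def)

lemma open_act_vimage: "open S \<Longrightarrow> open {x. act g x \<in> S}"
  using open_vimage[OF _ act_cont] by (simp add: vimage_def)

lemma closed_act_vimage: "closed S \<Longrightarrow> closed {x. act g x \<in> S}"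
  using closed_vimage[OF _ act_cont] by (simp add: vimage_def)

lemma open_dom: "open (dom g)" and closed_dom: "closed (dom g)"
  using open_Int[OF open_Y open_act_vimage[OF open_Y, of "- g"]]
    closed_Int[OF closed_Y closed_act_vimage[OF closed_Y, of "- g"]]
  by (simp_all add: dom_def Int_def)

lemma continuous_indicator_clopen:
  assumes "open S" "closed S"
  shows "continuous_on UNIV (indicator S :: 'x \<Rightarrow> complex)"
  unfolding continuous_on_open_vimage[OF open_UNIV]
proof (intro allI impI)
  fix B :: "complex set"
  have "indicator S -` B \<inter> UNIV = (if 1 \<in> B then S else {}) \<union> (if 0 \<in> B then - S else {})"
  proof (rule set_eqI)
    fix x show "x \<in> indicator S -` B \<inter> UNIV \<longleftrightarrow> x \<in> (if 1 \<in> B then S else {}) \<union> (if 0 \<in> B then - S else {})"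
      by (cases "x \<in> S") simp_all
  qed
  then show "open (indicator S -` B \<inter> UNIV)" using assms by auto
qed

lemma coord_gen:
  assumes "f \<in> C0"
  shows "coord (gen g f \<xi>) (h, x) = f (act h x) * coord \<xi> (- g + h, x)"
proof -
  obtain K where K: "\<And>x. cmod (f x) \<le> K" using C0_bounded[OF assms] by blast
  show ?thesis by (simp add: gen_def coord_mult_op[OF K] coord_trans_op)
qed

lemma norm_gen_le:
  assumes "f \<in> C0" "0 \<le> K" "\<And>x. cmod (f x) \<le> K"
  shows "norm (gen g f) \<le> K"
proof -
  have "norm (mult_op act f) \<le> K"
    unfolding mult_op_def by (rule norm_diag_op) (use assms in auto)
  moreover have "norm (trans_op g :: ('g \<times> 'x) op) \<le> 1"
  proof (rule norm_blinfun_bound)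
    fix \<xi> :: "('g \<times> 'x) ell2"
    have "coord (trans_op g \<xi>) i = coord \<xi> ((\<lambda>(h, x). (- g + h, x)) i)" for i
      by (cases i) (simp add: coord_trans_op)
    then show "norm (trans_op g \<xi>) \<le> 1 * norm \<xi>"
      using infsum_reindex_bij_betw[OF bij_trans[of g], of "\<lambda>i. (cmod (coord \<xi> i))\<^sup>2"]
      by (simp add: norm_ell2_eq)
  qed simp
  ultimately show ?thesis unfolding gen_def using norm_compose_le by fastforce
qed

lemma gen_eqI:
  fixes a :: "('g \<times> 'x) op"
  assumes "f \<in> C0" "\<And>\<xi> h x. coord (a \<xi>) (h, x) = f (act h x) * coord \<xi> (- g + h, x)"
  shows "a = gen g f"
  by (rule op_eqI) (use assms in \<open>auto simp: coord_gen\<close>)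

lemma C0_add: "f \<in> C0 \<Longrightarrow> k \<in> C0 \<Longrightarrow> (\<lambda>x. f x + k x) \<in> C0"
  for f k :: "'x \<Rightarrow> complex"
  by (rule C0_dominated[of f k _ 1])
    (auto intro: continuous_on_add C0_continuous norm_triangle_ineq)

lemma C0_cmult: "f \<in> C0 \<Longrightarrow> (\<lambda>x. c * f x) \<in> C0"
  for f :: "'x \<Rightarrow> complex"
  by (rule C0_bounded_mult[of f "\<lambda>_. c" "cmod c"]) auto

lemma gen_add: "f \<in> C0 \<Longrightarrow> k \<in> C0 \<Longrightarrow> gen g (\<lambda>x. f x + k x) = gen g f + gen g k"
  by (rule gen_eqI[symmetric]) (auto simp: C0_add coord_gen op_coord_simps algebra_simps)

lemma gen_cmult: "f \<in> C0 \<Longrightarrow> gen g (\<lambda>x. c * f x) = c *\<^sub>C gen g f"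
  by (rule gen_eqI[symmetric]) (auto simp: C0_cmult coord_gen op_coord_simps algebra_simps)

lemma gen_compose:
  assumes "f \<in> C0" "k \<in> C0"
  shows "gen g f o\<^sub>L gen h k = gen (g + h) (\<lambda>x. f x * k (act (- g) x))"
  by (rule gen_eqI)
    (use assms in \<open>auto simp: C0_mult C0_act coord_gen act_add minus_add add.assoc simp del: add_uminus_conv_diff\<close>)

lemma gen_adjoint:
  assumes "f \<in> C0"
  shows "is_adjoint (gen g f) (gen (- g) (\<lambda>x. cnj (f (act g x))))"
  unfolding is_adjoint_def
proof (intro allI)
  fix \<xi> \<eta> :: "('g \<times> 'x) ell2"
  \<comment> \<open>Translation by \<open>g\<close>, written with a double negation so that
    \<open>bij_trans\<close> for \<open>- g\<close> reindexes the sum verbatim.\<close>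
  let ?p = "\<lambda>(h, x). (- (- g) + h, x :: 'x)"
  let ?F = "\<lambda>i. coord (gen g f \<xi>) i * cnj (coord \<eta> i)"
  have "?F (?p i) = coord \<xi> i * cnj (coord (gen (- g) (\<lambda>x. cnj (f (act g x))) \<eta>) i)" for i
    using assms by (cases i) (simp add: coord_gen C0_cnj C0_act act_add add.assoc[symmetric])
  then show "cinner (gen g f \<xi>) \<eta> = cinner \<xi> (gen (- g) (\<lambda>x. cnj (f (act g x))) \<eta>)"
    unfolding cinner_def using infsum_reindex_bij_betw[OF bij_trans[of "- g"], of ?F] by simp
qed

lemma coeffs_compose:
  assumes "f \<in> coeffs g" "k \<in> coeffs h"
  shows "(\<lambda>x. f x * k (act (- g) x)) \<in> coeffs (g + h)"
proof -
  have "f x * k (act (- g) x) = 0" if "x \<notin> dom (g + h)" for x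
  proof (rule ccontr)
    assume "f x * k (act (- g) x) \<noteq> 0"
    then have "x \<in> dom g" "act (- g) x \<in> dom h"
      using assms coeffsD(2) by (metis mult_eq_0_iff)+
    then show False using that by (simp add: dom_def minus_add act_add del: add_uminus_conv_diff)
  qed
  then show ?thesis using assms by (simp add: coeffs_def C0_mult C0_act)
qed

lemma coeffs_adjoint: "f \<in> coeffs g \<Longrightarrow> (\<lambda>x. cnj (f (act g x))) \<in> coeffs (- g)"
  by (auto simp: coeffs_def C0_cnj C0_act dom_uminus)

lemma coeffs_cmult: "f \<in> coeffs g \<Longrightarrow> (\<lambda>x. c * f x) \<in> coeffs g"
  by (auto simp: coeffs_def C0_cmult)

lemma coeffs_restrict: "f \<in> C0 \<Longrightarrow> (\<lambda>x. indicator (dom g) x * f x) \<in> coeffs g"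
  unfolding coeffs_def
  by (intro CollectI conjI C0_bounded_mult[of f _ 1] continuous_indicator_clopen open_dom closed_dom)
    (auto simp: indicator_def)

text \<open>The right-hand projection passes through u_g and becomes the indicator of gY, so
  compression multiplies \<open>f\<close> by the indicator of Y and gY. The product stays in
  \<open>C0\<close> because \<open>dom g\<close> is clopen.\<close>

lemma corner_gen:
  assumes "f \<in> C0"
  shows "mult_op act (indicator Y) o\<^sub>L gen g f o\<^sub>L mult_op act (indicator Y) =
    gen g (\<lambda>x. indicator (dom g) x * f x)"
proof (rule gen_eqI)
  show "(\<lambda>x. indicator (dom g) x * f x) \<in> C0" using coeffs_restrict[OF assms] by (rule coeffsD)
qed (use assms in \<open>auto simp: coord_gen coord_mult_op_indicator act_add dom_def indicator_def\<close>)

lemma corner_gen_coeffs: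
  assumes "f \<in> coeffs g"
  shows "mult_op act (indicator Y) o\<^sub>L gen g f o\<^sub>L mult_op act (indicator Y) = gen g f"
proof -
  have "(\<lambda>x. indicator (dom g) x * f x) = f"
  proof
    fix x show "indicator (dom g) x * f x = f x"
      using coeffsD(2)[OF assms, of x] by (cases "x \<in> dom g") simp_all
  qed
  then show ?thesis using corner_gen[OF coeffsD(1)[OF assms]] by simp
qed

lemma scaleC_gens: "s \<in> gens \<Longrightarrow> c *\<^sub>C s \<in> gens"
proof -
  assume "s \<in> gens"
  then obtain g f where "s = gen g f" "f \<in> coeffs g" unfolding gens_def by blast
  then have "c *\<^sub>C s = gen g (\<lambda>x. c * f x)" "(\<lambda>x. c * f x) \<in> coeffs g"
    by (simp_all add: gen_cmult coeffsD coeffs_cmult)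
  then show ?thesis unfolding gens_def by blast
qed

text \<open>Compression by the projection of \<open>Y\<close> is bounded and linear, hence maps the
  closed span of the crossed-product generators into the closed span of \<open>gens\<close>. For the
  other inclusion it fixes \<open>gens\<close>, hence the closed span pointwise, so every element
  there is the compression of itself.\<close>

lemma reduced_algebra_eq: "A = closure (cspan gens)"
proof
  let ?p = "mult_op act (indicator Y) :: ('g \<times> 'x) op"
  let ?c = "\<lambda>a. ?p o\<^sub>L a o\<^sub>L ?p"
  have bl: "bounded_linear ?c"
    using bounded_linear_compose[OF bounded_linear_compose_left bounded_linear_compose_right] .
  have "crossed_product act \<subseteq> ?c -` closure (cspan gens)"
    unfolding crossed_product_def
  proof (rule closure_cspan_subset)
    fix c s assume "s \<in> {mult_op act f o\<^sub>L trans_op g |f g. f \<in> C0}"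
    then obtain f g where s: "s = gen g f" "f \<in> C0" by (auto simp: gen_def)
    have "?c (c *\<^sub>C s) = ?c (gen g (\<lambda>x. c * f x))" using s by (simp add: gen_cmult)
    also have "\<dots> = gen g (\<lambda>x. indicator (dom g) x * (c * f x))"
      by (rule corner_gen[OF C0_cmult[OF s(2)]])
    also have "\<dots> \<in> gens" unfolding gens_def using coeffs_restrict[OF C0_cmult[OF s(2)]] by blast
    finally have "?c (c *\<^sub>C s) \<in> gens" .
    from scaleC_cspan[OF this, of 1] show "c *\<^sub>C s \<in> ?c -` closure (cspan gens)"
      using closure_subset by (auto simp: scaleC_one)
  qed (intro closed_subspace_vimage bl closed_closure subspace_closure_cspan)+
  then show "A \<subseteq> closure (cspan gens)" by (auto simp: reduced_algebra_def)
  have 1: "closure (cspan gens) \<subseteq> crossed_product act"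
    unfolding crossed_product_def
  proof (intro closure_mono)
    show "cspan gens \<subseteq> cspan {mult_op act f o\<^sub>L trans_op g |f g. f \<in> C0}"
      unfolding cspan_def by (intro span_mono) (auto simp: gens_def gen_def coeffs_def)
  qed
  have bl2: "bounded_linear (\<lambda>a. ?c a - a)" by (intro bounded_linear_sub bl bounded_linear_ident)
  have "closure (cspan gens) \<subseteq> (\<lambda>a. ?c a - a) -` {0}"
  proof (rule closure_cspan_subset)
    fix c s assume "s \<in> gens"
    then have "c *\<^sub>C s \<in> gens" by (rule scaleC_gens)
    then show "c *\<^sub>C s \<in> (\<lambda>a. ?c a - a) -` {0}" by (auto simp: gens_def corner_gen_coeffs)
  qed (intro closed_subspace_vimage bl2 closed_singleton subspace_single_0)+
  then have 2: "?c a = a" if "a \<in> closure (cspan gens)" for a using that by auto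
  show "closure (cspan gens) \<subseteq> A"
  proof
    fix a assume a: "a \<in> closure (cspan gens)"
    then have "a = ?c a" "a \<in> crossed_product act" using 1 2[OF a] by auto
    then show "a \<in> A" unfolding reduced_algebra_def by blast
  qed
qed

lemma closed_A: "closed A" and subspace_A: "subspace A"
  unfolding reduced_algebra_eq by (simp_all add: subspace_closure_cspan)

text \<open>Induction principle for the algebra: a property that defines a closed real subspace is
  checked on the elements f u_g alone, because complex multiples are absorbed into
  \<open>f\<close>.\<close>

lemma A_subsetI:
  assumes "closed T" "subspace T" "\<And>g f. f \<in> coeffs g \<Longrightarrow> gen g f \<in> T"
  shows "A \<subseteq> T"
  unfolding reduced_algebra_eq
proof (rule closure_cspan_subset[OF assms(1,2)])
  fix c s assume "s \<in> gens"
  then have "c *\<^sub>C s \<in> gens" by (rule scaleC_gens)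
  then obtain g f where "c *\<^sub>C s = gen g f" "f \<in> coeffs g" unfolding gens_def by blast
  then show "c *\<^sub>C s \<in> T" using assms(3)[of f g] by simp
qed

lemma gens_A: "gens \<subseteq> A"
  unfolding reduced_algebra_eq using scaleC_cspan[of _ gens 1] closure_subset by (auto simp: scaleC_one)

lemma gen_A: "f \<in> coeffs g \<Longrightarrow> gen g f \<in> A"
  using gens_A by (auto simp: gens_def)

lemma A_vimageI:
  assumes "bounded_linear F" "\<And>g f. f \<in> coeffs g \<Longrightarrow> F (gen g f) \<in> A" "a \<in> A"
  shows "F a \<in> A"
  using A_subsetI[OF closed_subspace_vimage[OF assms(1) closed_A subspace_A]] assms(2,3) by auto

lemma A_scaleC: "a \<in> A \<Longrightarrow> c *\<^sub>C a \<in> A"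
  by (rule A_vimageI[OF bounded_linear_scaleC]) (auto simp: gen_cmult[symmetric] coeffsD gen_A coeffs_cmult)

lemma A_add: "a \<in> A \<Longrightarrow> b \<in> A \<Longrightarrow> a + b \<in> A"
  and A_diff: "a \<in> A \<Longrightarrow> b \<in> A \<Longrightarrow> a - b \<in> A"
  and A_zero: "0 \<in> A"
  using subspace_A by (auto intro: subspace_add subspace_diff subspace_0)

lemma A_compose:
  assumes a: "a \<in> A" and b: "b \<in> A"
  shows "a o\<^sub>L b \<in> A"
proof (rule A_vimageI[OF bounded_linear_compose_right _ b])
  fix h k assume k: "k \<in> coeffs h"
  show "a o\<^sub>L gen h k \<in> A"
  proof (rule A_vimageI[OF bounded_linear_compose_left _ a])
    fix g f assume f: "f \<in> coeffs g"
    show "gen g f o\<^sub>L gen h k \<in> A"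
      unfolding gen_compose[OF coeffsD(1)[OF f] coeffsD(1)[OF k]] by (rule gen_A[OF coeffs_compose[OF f k]])
  qed
qed

text \<open>Elements of the algebra are complex linear, unlike arbitrary members of the operator type.\<close>

lemma A_compose_scaleC:
  assumes "a \<in> A"
  shows "a o\<^sub>L (c *\<^sub>C b) = c *\<^sub>C (a o\<^sub>L b)"
proof -
  let ?F = "\<lambda>a. (a o\<^sub>L (c *\<^sub>C b)) - c *\<^sub>C (a o\<^sub>L b)"
  have "bounded_linear (\<lambda>a. c *\<^sub>C (a o\<^sub>L b))"
    by (rule bounded_linear_compose[OF bounded_linear_scaleC bounded_linear_compose_left])
  moreover have "bounded_linear (\<lambda>a. a o\<^sub>L (c *\<^sub>C b))" by (rule bounded_linear_compose_left)
  ultimately have "bounded_linear ?F" by (intro bounded_linear_sub)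
  then have "A \<subseteq> ?F -` {0}"
  proof (intro A_subsetI closed_subspace_vimage closed_singleton subspace_single_0)
    fix g f assume f: "f \<in> coeffs g"
    have "gen g f o\<^sub>L (c *\<^sub>C b) = c *\<^sub>C (gen g f o\<^sub>L b)"
      by (rule op_eqI) (auto simp: coord_gen[OF coeffsD(1)[OF f]] coord_scaleC)
    then show "gen g f \<in> ?F -` {0}" by simp
  qed
  then show ?thesis using assms by auto
qed

lemma cond_exp_gen: "f \<in> C0 \<Longrightarrow> cond_exp (gen g f) = (if g = 0 then f else (\<lambda>_. 0))"
  unfolding gen_def by (rule cond_exp_generator[OF act])

text \<open>On generators the expectation is a continuous function or zero. Norm limits of operators
  give pointwise limits of expectations, and these preserve measurability.\<close>

lemma borel_measurable_cond_exp:
  assumes "a \<in> A"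
  shows "cond_exp a \<in> borel_measurable borel"
proof -
  have "A \<subseteq> {a. cond_exp a \<in> borel_measurable borel}"
  proof (rule A_subsetI)
    show "closed {a :: ('g \<times> 'x) op. cond_exp a \<in> borel_measurable borel}"
      unfolding closed_sequential_limits
    proof (intro allI impI, elim conjE)
      fix s :: "nat \<Rightarrow> ('g \<times> 'x) op" and l
      assume s: "\<forall>n. s n \<in> {a. cond_exp a \<in> borel_measurable borel}" "s \<longlonglongrightarrow> l"
      have "(\<lambda>n. cond_exp (s n) x) \<longlonglongrightarrow> cond_exp l x" for x
        by (rule bounded_linear.tendsto[OF bounded_linear_cond_exp s(2)])
      then have "cond_exp l \<in> borel_measurable borel"
        by (rule borel_measurable_LIMSEQ_metric[rotated]) (use s(1) in simp)
      then show "l \<in> {a. cond_exp a \<in> borel_measurable borel}" by simp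
    qed
    have "cond_exp (a + b) = (\<lambda>x. cond_exp a x + cond_exp b x)"
      "cond_exp (r *\<^sub>R a) = (\<lambda>x. of_real r * cond_exp a x)"
      "cond_exp (0 :: ('g \<times> 'x) op) = (\<lambda>x. 0)" for a b :: "('g \<times> 'x) op" and r
      by (auto simp: cond_exp_add cond_exp_scaleR cond_exp_zero)
    then show "subspace {a :: ('g \<times> 'x) op. cond_exp a \<in> borel_measurable borel}"
      unfolding subspace_def by auto
    fix g f assume f: "f \<in> coeffs g"
    have "f \<in> borel_measurable borel"
      by (rule borel_measurable_continuous_onI[OF C0_continuous[OF coeffsD(1)[OF f]]])
    then show "gen g f \<in> {a. cond_exp a \<in> borel_measurable borel}"
      by (simp add: cond_exp_gen[OF coeffsD(1)[OF f]])
  qed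
  then show ?thesis using assms by auto
qed

end

section \<open>The dynamics on the corner\<close>

locale groupoid_dynamics = groupoid_corner act Y
  for act :: "'g::group_add \<Rightarrow> 'x::t2_space \<Rightarrow> 'x" and Y +
  fixes N :: "'g \<Rightarrow> real"
  assumes N_pos: "\<And>g. N g > 0" and N_add: "\<And>g h. N (g + h) = N g * N h"
begin

lemma N_zero: "N 0 = 1"
  using N_add[of 0 0] N_pos[of 0] by simp

lemma N_uminus: "N (- g) = inverse (N g)"
  using N_add[of g "- g"] N_zero N_pos[of g] by (simp add: field_simps)

lemma phase_le: "cmod (complex_of_real (N h) powr (\<i> * complex_of_real t)) \<le> 1"
  using N_pos[of h] by (simp add: powr_def Ln_of_real)

lemma coord_phase_op:
  "coord (phase_op N t \<xi>) (h, x) = complex_of_real (N h) powr (\<i> * complex_of_real t) * coord \<xi> (h, x)"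
  unfolding phase_op_def by (subst coord_diag_op[where K = 1]) (use phase_le in auto)

lemma norm_phase_op: "norm (phase_op N t :: ('g \<times> 'x) op) \<le> 1"
  unfolding phase_op_def by (rule norm_diag_op) (use phase_le in auto)

lemma norm_dynamics_le: "norm (dynamics N t a) \<le> norm a" for a :: "('g \<times> 'x) op"
  unfolding dynamics_def
  using norm_compose_le[OF norm_compose_le[OF norm_phase_op order_refl] norm_phase_op] by simp

lemma bounded_linear_dynamics: "bounded_linear (dynamics N t :: ('g \<times> 'x) op \<Rightarrow> _)"
  unfolding dynamics_def[abs_def]
  using bounded_linear_compose[OF bounded_linear_compose_left bounded_linear_compose_right] .

lemma dynamics_gen:
  assumes "f \<in> coeffs g"
  shows "dynamics N t (gen g f) = complex_of_real (N g) powr (\<i> * complex_of_real t) *\<^sub>C gen g f"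
  using dynamics_generator[of N f t act Y g, OF N_pos N_add coeffsD(1)[OF assms]] corner_gen_coeffs[OF assms]
  by (simp add: gen_def)

lemma dynamics_A: "a \<in> A \<Longrightarrow> dynamics N t a \<in> A"
  by (rule A_vimageI[OF bounded_linear_dynamics]) (auto simp: dynamics_gen A_scaleC gen_A)

lemma dynamics_scaleC:
  assumes "a \<in> A"
  shows "dynamics N t (c *\<^sub>C a) = c *\<^sub>C dynamics N t a"
proof -
  let ?F = "\<lambda>a :: ('g \<times> 'x) op. dynamics N t (c *\<^sub>C a) - c *\<^sub>C dynamics N t a"
  have "bounded_linear (\<lambda>a. dynamics N t (c *\<^sub>C a) :: ('g \<times> 'x) op)"
    by (rule bounded_linear_compose[OF bounded_linear_dynamics bounded_linear_scaleC])
  moreover have "bounded_linear (\<lambda>a. c *\<^sub>C dynamics N t a :: ('g \<times> 'x) op)"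
    by (rule bounded_linear_compose[OF bounded_linear_scaleC bounded_linear_dynamics])
  ultimately have "bounded_linear ?F" by (intro bounded_linear_sub)
  then have "A \<subseteq> ?F -` {0}"
  proof (intro A_subsetI closed_subspace_vimage closed_singleton subspace_single_0)
    fix g f assume f: "f \<in> coeffs g"
    then show "gen g f \<in> ?F -` {0}"
      using dynamics_gen[OF coeffs_cmult[OF f], of t c]
      by (simp add: gen_cmult coeffsD dynamics_gen scaleC_scaleC mult.commute)
  qed
  then show ?thesis using assms by auto
qed

text \<open>The expectation reads diagonal coefficients at \<open>(0, x)\<close>, where the phases
  are trivial because \<open>N 0 = 1\<close>.\<close>

lemma cond_exp_dynamics:
  assumes "a \<in> A"
  shows "cond_exp (dynamics N t a) x = cond_exp a x"
proof -
  have "phase_op N s (delta (0, x)) = delta (0, x)" for s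
  proof (rule ell2_eqI)
    fix i :: "'g \<times> 'x"
    show "coord (phase_op N s (delta (0, x))) i = coord (delta (0, x)) i"
      by (cases i) (simp add: coord_phase_op delta.rep_eq N_zero)
  qed
  then show ?thesis
    by (simp add: cond_exp_def dynamics_def coord_phase_op N_zero)
qed

end

section \<open>Complex analysis, square roots and mixtures\<close>

text \<open>Phragmen-Lindelof for bounded functions: dividing by \<open>1 - i\<epsilon>z\<close> forces decay at infinity.\<close>

lemma upper_half_plane_bound:
  assumes hol: "H holomorphic_on UNIV" and bdd: "bounded (H ` {z. 0 < Im z})"
    and real: "\<And>t. cmod (H (complex_of_real t)) \<le> M" and M: "0 < M" and z: "0 < Im z"
  shows "cmod (H z) \<le> M"
proof -
  obtain B where B: "\<And>z. 0 < Im z \<Longrightarrow> cmod (H z) \<le> B" "0 < B"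
    using bdd unfolding bounded_pos by auto
  have le: "cmod (H z) \<le> M * cmod (1 - \<i> * of_real e * z)" if e: "0 < e" for e
  proof -
    define q where "q w = 1 - \<i> * of_real e * w" for w
    \<comment> \<open>The first bound puts \<open>z\<close> inside the half-disc. The second gives
      \<open>B \<le> M * (e * R)\<close> on the arc, and there \<open>cmod (q w)\<close> is at least
      \<open>e * R\<close>.\<close>
    define R where "R = max (cmod z + 1) (B / (e * M))"
    define S where "S = {w. 0 < Im w \<and> cmod w < R}"
    have Re_q: "Re (q w) = 1 + e * Im w" and Im_q: "Im (q w) = - (e * Re w)" for w
      by (simp_all add: q_def)
    have q1: "1 \<le> cmod (q w)" if "0 \<le> Im w" for w
      using complex_Re_le_cmod[of "q w"] mult_nonneg_nonneg[of e "Im w"] that e unfolding Re_q by linarith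
    have q2: "e * cmod w \<le> cmod (q w)" if "0 \<le> Im w" for w
    proof -
      have "0 \<le> e * Im w" using that e by simp
      then have "(e * Im w)\<^sup>2 \<le> (1 + e * Im w)\<^sup>2" by (intro power_mono) auto
      then have "(e * cmod w)\<^sup>2 \<le> (cmod (q w))\<^sup>2"
        by (simp add: cmod_power2 Re_q Im_q power_mult_distrib distrib_left)
      then show ?thesis by (rule power2_le_imp_le) simp
    qed
    have q0: "q w \<noteq> 0" if "0 \<le> Im w" for w using q1[OF that] by auto
    have "S \<subseteq> ball 0 R" by (auto simp: S_def)
    then have bS: "bounded S" by (rule bounded_subset[OF bounded_ball])
    have S_eq: "S = {w. 0 < Im w} \<inter> ball 0 R" by (auto simp: S_def)
    have oS: "open S" unfolding S_eq by (intro open_Int open_halfspace_Im_gt open_ball)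
    have "S \<subseteq> {w. 0 \<le> Im w} \<inter> cball 0 R" by (auto simp: S_def)
    then have clS: "closure S \<subseteq> {w. 0 \<le> Im w} \<inter> cball 0 R"
      by (intro closure_minimal closed_Int closed_halfspace_Im_ge closed_cball)
    have holq: "(\<lambda>w. H w / q w) holomorphic_on T" if "T \<subseteq> {w. 0 \<le> Im w}" for T
    proof (rule holomorphic_on_divide)
      show "H holomorphic_on T" using hol by (rule holomorphic_on_subset) simp
      show "q holomorphic_on T" unfolding q_def by (intro holomorphic_intros)
      show "\<And>w. w \<in> T \<Longrightarrow> q w \<noteq> 0" using that q0 by auto
    qed
    have "cmod (H z / q z) \<le> M"
    proof (rule maximum_modulus_frontier[of "\<lambda>w. H w / q w" S M z])
      show "(\<lambda>w. H w / q w) holomorphic_on interior S"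
        unfolding interior_open[OF oS] by (rule holq) (auto simp: S_def)
      show "continuous_on (closure S) (\<lambda>w. H w / q w)"
        by (rule holomorphic_on_imp_continuous_on[OF holq]) (use clS in auto)
      show "bounded S" by (rule bS)
      show "z \<in> S" using z by (auto simp: S_def R_def)
      fix w assume "w \<in> frontier S"
      then have w: "w \<in> closure S" "w \<notin> S" unfolding frontier_def interior_open[OF oS] by auto
      have Iw: "0 \<le> Im w" "cmod w \<le> R" using w(1) clS by auto
      show "cmod (H w / q w) \<le> M"
      proof (cases "Im w = 0")
        case True
        then have "w = of_real (Re w)" by (simp add: complex_eq_iff)
        then have "cmod (H w) \<le> M" using real by metis
        also have "\<dots> \<le> M * cmod (q w)" using q1[OF Iw(1)] M by simp
        finally show ?thesis using q0[OF Iw(1)] by (simp add: norm_divide divide_le_eq)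
      next
        case False
        then have Iw': "0 < Im w" using Iw by simp
        then have "cmod w = R" using w(2) Iw(2) by (auto simp: S_def)
        have "B / (e * M) \<le> R" by (simp add: R_def)
        then have "B \<le> M * (e * R)" using e M by (simp add: divide_le_eq mult.commute mult.left_commute)
        also have "\<dots> \<le> M * cmod (q w)" using q2[OF Iw(1)] M \<open>cmod w = R\<close> by simp
        finally have "cmod (H w) \<le> M * cmod (q w)" using B(1)[OF Iw'] by linarith
        then show ?thesis using q0[OF Iw(1)] by (simp add: norm_divide divide_le_eq)
      qed
    qed
    moreover have "0 < cmod (q z)" using q0[of z] z by simp
    ultimately show ?thesis by (simp add: norm_divide divide_le_eq q_def)
  qed
  have "((\<lambda>e. M * cmod (1 - \<i> * of_real e * z)) \<longlongrightarrow> M * cmod (1 - \<i> * of_real 0 * z)) (at_right 0)"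
    by (intro tendsto_intros)
  moreover have "eventually (\<lambda>e. cmod (H z) \<le> M * cmod (1 - \<i> * of_real e * z)) (at_right 0)"
    using eventually_at_right_less[of "0::real"] by eventually_elim (rule le)
  ultimately have "cmod (H z) \<le> M * cmod (1 - \<i> * of_real 0 * z)"
    by (intro tendsto_lowerbound) auto
  then show ?thesis by simp
qed

text \<open>Multiplying \<open>H\<close> by exp(i l z) turns the approximation into one of the
  constant \<open>c\<close>, with error at most \<open>e / 2\<close> on the real axis and hence, by
  \<open>upper_half_plane_bound\<close>, on the upper half-plane. The factor has modulus exp(-l Im
  z), so high up the product with the bounded \<open>H\<close> is negligible and \<open>c\<close>
  itself is small. Only approximations of the frequency are required to be bounded, which fits a
  ground state known on a dense set.\<close>

lemma negative_frequency_vanishes: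
  assumes l: "0 < l"
    and ex: "\<And>e. 0 < e \<Longrightarrow> \<exists>H. H holomorphic_on UNIV \<and> bounded (H ` {z. 0 < Im z}) \<and>
      (\<forall>t. cmod (H (complex_of_real t) - exp (- (\<i> * of_real l * of_real t)) * c) \<le> e)"
  shows "c = 0"
proof -
  have "cmod c \<le> 0 + e" if "0 < e" for e
  proof -
    have e2: "0 < e / 2" using that by simp
    obtain H where H: "H holomorphic_on UNIV" "bounded (H ` {z. 0 < Im z})"
      "\<And>t. cmod (H (complex_of_real t) - exp (- (\<i> * of_real l * of_real t)) * c) \<le> e / 2"
      using ex[OF e2] by blast
    obtain B where B: "\<And>z. 0 < Im z \<Longrightarrow> cmod (H z) \<le> B" "0 < B"
      using H(2) unfolding bounded_pos by auto
    define G where "G z = exp (\<i> * of_real l * z) * H z - c" for z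
    have ne: "cmod (exp (\<i> * of_real l * z)) = exp (- (l * Im z))" for z
      by (simp add: norm_exp_eq_Re)
    have "G holomorphic_on UNIV" unfolding G_def by (intro holomorphic_intros H(1))
    moreover have "bounded (G ` {z. 0 < Im z})"
      unfolding bounded_iff
    proof (intro exI[of _ "B + cmod c"] ballI)
      fix y assume "y \<in> G ` {z. 0 < Im z}"
      then obtain z where z: "0 < Im z" "y = G z" by auto
      have "exp (- (l * Im z)) * cmod (H z) \<le> 1 * B"
        using B(1)[OF z(1)] z(1) l by (intro mult_mono) auto
      moreover have "cmod (G z) \<le> exp (- (l * Im z)) * cmod (H z) + cmod c"
        unfolding G_def using norm_triangle_ineq4[of "exp (\<i> * of_real l * z) * H z" c]
        by (simp add: norm_mult ne)
      ultimately show "norm y \<le> B + cmod c" using z(2) by simp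
    qed
    moreover have "cmod (G (complex_of_real t)) \<le> e / 2" for t
    proof -
      let ?x = "exp (\<i> * of_real l * complex_of_real t)"
      have "G (of_real t) = ?x * (H (of_real t) - exp (- (\<i> * of_real l * of_real t)) * c)"
        by (simp add: G_def algebra_simps exp_minus)
      then have "cmod (G (of_real t)) = cmod ?x * cmod (H (of_real t) - exp (- (\<i> * of_real l * of_real t)) * c)"
        by (simp only: norm_mult)
      also have "cmod ?x = 1" unfolding ne by simp
      finally show ?thesis using H(3)[of t] by simp
    qed
    ultimately have bound: "cmod (G z) \<le> e / 2" if "0 < Im z" for z
      by (rule upper_half_plane_bound[OF _ _ _ e2 that])
    \<comment> \<open>At this height exp(-l y) B is at most \<open>e / 2\<close>; the maximum with 1
      keeps the point in the open half-plane.\<close>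
    define y where "y = max 1 (ln (2 * B / e) / l)"
    have y: "0 < y" by (simp add: y_def)
    have "ln (2 * B / e) / l \<le> y" by (simp add: y_def)
    then have "ln (2 * B / e) \<le> l * y" using l by (simp add: divide_le_eq mult.commute)
    then have "2 * B / e \<le> exp (l * y)" using B(2) that by (metis exp_le_cancel_iff exp_ln divide_pos_pos mult_pos_pos zero_less_numeral)
    then have "exp (- (l * y)) * B \<le> e / 2"
      using that by (simp add: exp_minus field_simps)
    moreover have "cmod (exp (\<i> * of_real l * (\<i> * of_real y)) * H (\<i> * of_real y)) \<le> exp (- (l * y)) * B"
      unfolding norm_mult ne using B(1)[of "\<i> * of_real y"] y by simp
    moreover have "cmod (G (\<i> * of_real y)) \<le> e / 2" using bound[of "\<i> * of_real y"] y by simp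
    moreover have c_eq: "c = exp (\<i> * of_real l * (\<i> * of_real y)) * H (\<i> * of_real y) - G (\<i> * of_real y)"
      by (simp add: G_def)
    have "cmod c \<le> cmod (exp (\<i> * of_real l * (\<i> * of_real y)) * H (\<i> * of_real y)) + cmod (G (\<i> * of_real y))"
      by (subst c_eq) (rule norm_triangle_ineq4)
    ultimately show ?thesis by linarith
  qed
  then have "cmod c \<le> 0" by (rule field_le_epsilon)
  then show ?thesis by simp
qed

text \<open>The degenerate case of Cauchy-Schwarz. The expression is the value at x + c y of a
  positive form with \<open>p\<close> = (x,x), \<open>P\<close> = (x,y), \<open>Q\<close> = (y,x),
  \<open>q\<close> = (y,y). Taking \<open>c\<close> to be 1 and \<open>\<i>\<close> yields
  \<open>Q = cnj P\<close>.\<close>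

lemma null_vector_orthogonal:
  assumes nonneg: "\<And>c. p + c * P + cnj c * Q + (cnj c * c) * q \<in> \<real>\<^sub>\<ge>\<^sub>0"
    and q: "q \<in> \<real>\<^sub>\<ge>\<^sub>0" and null: "p = 0 \<or> q = 0"
  shows "P = 0"
proof (rule ccontr)
  assume "P \<noteq> 0"
  have p: "p \<in> \<real>\<^sub>\<ge>\<^sub>0" using nonneg[of 0] by simp
  obtain p' q' where pq: "p = of_real p'" "0 \<le> p'" "q = of_real q'" "0 \<le> q'"
    using p q by (metis nonneg_Reals_cases)
  have "Im P + Im Q = 0" using nonneg[of 1] pq by (auto simp: complex_nonneg_Reals_iff)
  moreover have "Re P - Re Q = 0" using nonneg[of \<i>] pq by (auto simp: complex_nonneg_Reals_iff)
  ultimately have Q: "Q = cnj P" by (simp add: complex_eq_iff)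
  define r where "r = (cmod P)\<^sup>2"
  have r: "0 < r" using \<open>P \<noteq> 0\<close> by (simp add: r_def)
  have PP: "P * cnj P = of_real r" by (simp add: r_def complex_norm_square[symmetric])
  \<comment> \<open>The direction \<open>- cnj P\<close> makes both mixed terms equal to
    \<open>- s * r\<close>, leaving a real quadratic in \<open>s\<close>.\<close>
  have main: "0 \<le> p' - 2 * s * r + s\<^sup>2 * r * q'" for s
  proof -
    have "p + (- of_real s * cnj P) * P + cnj (- of_real s * cnj P) * Q +
        (cnj (- of_real s * cnj P) * (- of_real s * cnj P)) * q =
      of_real p' - 2 * of_real s * (P * cnj P) + of_real s * of_real s * (P * cnj P) * of_real q'"
      by (simp add: Q pq algebra_simps)
    also have "\<dots> = of_real (p' - 2 * s * r + s\<^sup>2 * r * q')"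
      unfolding PP by (simp add: power2_eq_square)
    finally show ?thesis using nonneg[of "- of_real s * cnj P"] by (simp only: nonneg_Reals_of_real_iff)
  qed
  show False
  proof (cases "p' = 0")
    case True
    \<comment> \<open>With \<open>p' = 0\<close> and \<open>s * q' \<le> 1\<close> the quadratic is
      at most \<open>- s * r\<close>, which is negative.\<close>
    define s where "s = 1 / (q' + 1)"
    have s: "0 < s" "s * q' \<le> 1" using pq(4) by (simp_all add: s_def)
    have "s\<^sup>2 * r * q' = s * r * (s * q')" by (simp add: power2_eq_square)
    also have "\<dots> \<le> s * r * 1" using s r by (intro mult_left_mono) auto
    finally show False using main[of s] True mult_pos_pos[OF s(1) r] by simp
  next
    case False
    then have "q' = 0" using null pq by auto
    \<comment> \<open>With \<open>q' = 0\<close> the expression is affine in \<open>s\<close>, and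
      this value makes it equal to -1.\<close>
    then show False using main[of "(p' + 1) / (2 * r)"] r by simp
  qed
qed

lemma C0_sqrt:
  assumes "f \<in> C0" "continuous_on UNIV k" "\<And>x. cmod (k x) = sqrt (cmod (f x))"
  shows "k \<in> C0"
proof -
  have "{x. e \<le> cmod (k x)} = {x. e\<^sup>2 \<le> cmod (f x)}" if "0 < e" for e
    unfolding assms(3) using that by (auto simp: real_le_rsqrt dest: power_mono[of e _ 2])
  then show ?thesis using assms(1,2) by (simp add: C0_def)
qed

lemma C0r_sqrt:
  assumes "f \<in> C0r U" "\<And>x. 0 \<le> f x"
  shows "(\<lambda>x. sqrt (f x)) \<in> C0r U"
proof -
  have "continuous_on UNIV (\<lambda>x. complex_of_real (sqrt (f x)))"
    by (intro continuous_on_of_real continuous_on_real_sqrt C0r_continuous[OF assms(1)])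
  then have "(\<lambda>x. complex_of_real (sqrt (f x))) \<in> C0"
    by (rule C0_sqrt[of "\<lambda>x. complex_of_real (f x)", rotated]) (use assms in \<open>auto simp: C0r_def\<close>)
  then show ?thesis using assms(1) by (simp add: C0r_def)
qed

text \<open>The balanced splitting lets f u_g be read as k1* (k2 u_g), while |k1|^2 and |k2|^2
  vanish exactly where \<open>f\<close> does.\<close>

lemma C0_factorization:
  assumes f: "f \<in> C0"
  obtains k1 k2 where "k1 \<in> C0" "k2 \<in> C0" "\<And>x. f x = k1 x * k2 x" "\<And>x. cnj (k1 x) = k1 x"
    "\<And>x. cmod (k1 x) = sqrt (cmod (f x))" "\<And>x. cmod (k2 x) = sqrt (cmod (f x))"
proof -
  define k1 where "k1 x = complex_of_real (sqrt (cmod (f x)))" for x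
  \<comment> \<open>Division by zero gives \<open>h 0 = 0\<close>, and the modulus of
    \<open>h z\<close> is sqrt|z|, so \<open>h\<close> is continuous at the origin as well.\<close>
  define h where "h z = z / complex_of_real (sqrt (cmod z))" for z
  have hn: "cmod (h z) = sqrt (cmod z)" for z
    by (simp add: h_def norm_divide real_div_sqrt)
  have ch: "isCont h z" for z
  proof (cases "z = 0")
    case True
    have "((\<lambda>z. sqrt (cmod z)) \<longlongrightarrow> sqrt (cmod 0)) (at (0::complex))" by (intro tendsto_intros)
    then have "((\<lambda>z. norm (h z)) \<longlongrightarrow> 0) (at 0)" by (simp add: hn)
    then have "(h \<longlongrightarrow> 0) (at 0)" by (rule tendsto_norm_zero_cancel)
    then show ?thesis using True by (simp add: isCont_def h_def)
  next
    case False
    then show ?thesis unfolding h_def by (intro continuous_intros) auto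
  qed
  have cf: "continuous_on UNIV f" by (rule C0_continuous[OF f])
  have "continuous_on UNIV h" using ch by (simp add: continuous_at_imp_continuous_on)
  then have "continuous_on UNIV (\<lambda>x. h (f x))" by (rule continuous_on_compose2[OF _ cf]) simp
  then have 2: "(\<lambda>x. h (f x)) \<in> C0" by (rule C0_sqrt[OF f]) (rule hn)
  have "continuous_on UNIV k1" unfolding k1_def
    by (intro continuous_on_of_real continuous_on_real_sqrt continuous_on_norm cf)
  then have 1: "k1 \<in> C0" by (rule C0_sqrt[OF f]) (simp add: k1_def)
  show thesis by (rule that[OF 1 2]) (auto simp: k1_def hn, simp add: h_def)
qed

section \<open>Integration against mixtures\<close>

lemma nn_integral_mixture:
  assumes s: "sets \<nu> = sets \<mu>" and f: "f \<in> borel_measurable \<mu>"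
  shows "(\<integral>\<^sup>+x. f x \<partial>mixture t \<mu> \<nu>) = ennreal t * (\<integral>\<^sup>+x. f x \<partial>\<mu>) + ennreal (1 - t) * (\<integral>\<^sup>+x. f x \<partial>\<nu>)"
proof -
  have m: "borel_measurable \<nu> = (borel_measurable \<mu> :: ('a \<Rightarrow> ennreal) set)"
    "borel_measurable (mixture t \<mu> \<nu>) = (borel_measurable \<mu> :: ('a \<Rightarrow> ennreal) set)"
    by (rule measurable_cong_sets[OF s refl], rule measurable_cong_sets) simp_all
  have sp: "space \<nu> = space \<mu>" by (rule sets_eq_imp_space_eq[OF s])
  from f show ?thesis
  proof (induction rule: borel_measurable_induct)
    case (cong f g)
    then show ?case using nn_integral_cong[of \<mu> f g] nn_integral_cong[of \<nu> f g]
        nn_integral_cong[of "mixture t \<mu> \<nu>" f g] sp by auto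
  next
    case (set A)
    then show ?case using s by (simp add: emeasure_mixture)
  next
    case (mult u c)
    then show ?case using m by (simp add: nn_integral_cmult distrib_left mult.left_commute)
  next
    case (add u v)
    then show ?case using m by (simp add: nn_integral_add distrib_left ac_simps)
  next
    case (seq U)
    have U: "incseq (\<lambda>i. integral\<^sup>N M (U i))" for M
      using seq(3) by (auto simp: incseq_def le_fun_def intro!: nn_integral_mono)
    have eq: "(\<integral>\<^sup>+x. (SUP i. U i) x \<partial>M) = (SUP i. integral\<^sup>N M (U i))"
      if "borel_measurable M = (borel_measurable \<mu> :: ('a \<Rightarrow> ennreal) set)" for M
      unfolding SUP_apply using seq(1,3) that by (intro nn_integral_monotone_convergence_SUP) auto
    have "(SUP i. ennreal t * integral\<^sup>N \<mu> (U i) + ennreal (1 - t) * integral\<^sup>N \<nu> (U i)) =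
      (SUP i. ennreal t * integral\<^sup>N \<mu> (U i)) + (SUP i. ennreal (1 - t) * integral\<^sup>N \<nu> (U i))"
      by (rule ennreal_SUP_add) (auto simp: incseq_def intro!: mult_left_mono incseqD[OF U])
    then show ?case using eq[OF refl] eq[OF m(1)] eq[OF m(2)] seq.IH
      by (simp add: SUP_mult_left_ennreal)
  qed
qed

lemma integral_mixture:
  fixes f :: "'a \<Rightarrow> complex"
  assumes "prob_space \<mu>" "prob_space \<nu>" and P: "prob_space (mixture t \<mu> \<nu>)"
    and s: "sets \<nu> = sets \<mu>" and t: "t \<in> {0..1}"
    and f: "f \<in> borel_measurable \<mu>" and K: "\<And>x. cmod (f x) \<le> K"
  shows "integral\<^sup>L (mixture t \<mu> \<nu>) f = of_real t * integral\<^sup>L \<mu> f + of_real (1 - t) * integral\<^sup>L \<nu> f"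
proof -
  interpret m: prob_space \<mu> by fact
  interpret n: prob_space \<nu> by fact
  interpret x: prob_space "mixture t \<mu> \<nu>" by fact
  have meas: "borel_measurable \<nu> = (borel_measurable \<mu> :: ('a \<Rightarrow> 'b::topological_space) set)"
    "borel_measurable (mixture t \<mu> \<nu>) = (borel_measurable \<mu> :: ('a \<Rightarrow> 'b) set)"
    by (rule measurable_cong_sets[OF s refl], rule measurable_cong_sets) simp_all
  have int: "integrable M g" if "prob_space M" "g \<in> borel_measurable M" "\<And>x. norm (g x) \<le> C"
    for M and g :: "'a \<Rightarrow> 'b::{banach, second_countable_topology}" and C
    using that by (intro finite_measure.integrable_const_bound[of M g C])
      (auto simp: prob_space.finite_measure)
  have nonneg: "integral\<^sup>L (mixture t \<mu> \<nu>) g = t * integral\<^sup>L \<mu> g + (1 - t) * integral\<^sup>L \<nu> g"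
    if g: "g \<in> borel_measurable \<mu>" "\<And>x. 0 \<le> g x" "\<And>x. g x \<le> C" for g :: "'a \<Rightarrow> real" and C
  proof -
    have i: "integrable \<mu> g" "integrable \<nu> g" "integrable (mixture t \<mu> \<nu>) g"
      using g meas by (auto intro!: int[of _ _ C] assms(1,2) P)
    have e: "integral\<^sup>N M (\<lambda>x. ennreal (g x)) = ennreal (integral\<^sup>L M g)" if "integrable M g" for M
      by (rule nn_integral_eq_integral[OF that]) (use g(2) in auto)
    have "ennreal (integral\<^sup>L (mixture t \<mu> \<nu>) g) =
        ennreal t * ennreal (integral\<^sup>L \<mu> g) + ennreal (1 - t) * ennreal (integral\<^sup>L \<nu> g)"
      unfolding e[OF i(1), symmetric] e[OF i(2), symmetric] e[OF i(3), symmetric]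
      by (rule nn_integral_mixture[OF s]) (use g(1) in simp)
    also have "\<dots> = ennreal (t * integral\<^sup>L \<mu> g + (1 - t) * integral\<^sup>L \<nu> g)"
      using t g(2) by (simp add: ennreal_mult ennreal_plus integral_nonneg)
    finally show ?thesis using t g(2) by (subst (asm) ennreal_inj) (auto intro!: add_nonneg_nonneg mult_nonneg_nonneg integral_nonneg)
  qed
  have real: "integral\<^sup>L (mixture t \<mu> \<nu>) g = t * integral\<^sup>L \<mu> g + (1 - t) * integral\<^sup>L \<nu> g"
    if g: "g \<in> borel_measurable \<mu>" "\<And>x. \<bar>g x\<bar> \<le> C" for g :: "'a \<Rightarrow> real" and C
  proof -
    have i: "integrable \<mu> g" "integrable \<nu> g" "integrable (mixture t \<mu> \<nu>) g"
      using g meas by (auto intro!: int[of _ _ C] assms(1,2) P)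
    \<comment> \<open>Shifting by \<open>C\<close> reduces to nonnegative functions; since all three
      measures have mass 1, the shift cancels.\<close>
    have b: "0 \<le> g x + C" "g x + C \<le> 2 * C" for x using g(2)[of x] by linarith+
    have "integral\<^sup>L (mixture t \<mu> \<nu>) (\<lambda>x. g x + C) =
        t * integral\<^sup>L \<mu> (\<lambda>x. g x + C) + (1 - t) * integral\<^sup>L \<nu> (\<lambda>x. g x + C)"
      by (rule nonneg[OF _ b]) (use g(1) in simp)
    moreover have "measure (mixture t \<mu> \<nu>) (space \<mu>) = 1" using x.prob_space by simp
    ultimately show ?thesis using i by (simp add: m.prob_space n.prob_space algebra_simps)
  qed
  have i: "integrable \<mu> f" "integrable \<nu> f" "integrable (mixture t \<mu> \<nu>) f"
    using f K meas by (auto intro!: int[of _ _ K] assms(1,2) P)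
  have "\<bar>Re (f x)\<bar> \<le> K" "\<bar>Im (f x)\<bar> \<le> K" for x
    using K[of x] abs_Re_le_cmod[of "f x"] abs_Im_le_cmod[of "f x"] by linarith+
  then have "integral\<^sup>L (mixture t \<mu> \<nu>) (\<lambda>x. Re (f x)) = t * integral\<^sup>L \<mu> (\<lambda>x. Re (f x)) + (1 - t) * integral\<^sup>L \<nu> (\<lambda>x. Re (f x))"
    "integral\<^sup>L (mixture t \<mu> \<nu>) (\<lambda>x. Im (f x)) = t * integral\<^sup>L \<mu> (\<lambda>x. Im (f x)) + (1 - t) * integral\<^sup>L \<nu> (\<lambda>x. Im (f x))"
    using f by (auto intro!: real[of _ K])
  then show ?thesis using i by (simp add: complex_eq_iff integral_Re integral_Im)
qed

section \<open>Ground states\<close>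

text \<open>Difference quotients along real increments stay in the real subspace \<open>T\<close>.
  Applied to the algebra, this ensures that the derivative of an analytic orbit is an element on
  which a state is linear and continuous.\<close>

lemma has_derivative_scaleC_in_closed:
  fixes F :: "complex \<Rightarrow> 'i op"
  assumes F: "(F has_derivative (\<lambda>w. w *\<^sub>C D)) (at z)" "\<And>z. F z \<in> T" and T: "closed T" "subspace T"
  shows "D \<in> T"
proof -
  have "D \<in> closure T"
    unfolding closure_approachable
  proof (intro allI impI)
    fix e :: real assume e: "0 < e"
    have "((\<lambda>h. norm (F (z + h) - F z - h *\<^sub>C D) / norm h) \<longlongrightarrow> 0) (at 0)"
      using F(1) by (simp add: has_derivative_at)
    from tendstoD[OF this e] obtain d where d: "0 < d"
      "\<And>h. h \<noteq> 0 \<Longrightarrow> dist h 0 < d \<Longrightarrow> dist (norm (F (z + h) - F z - h *\<^sub>C D) / norm h) 0 < e"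
      unfolding eventually_at by blast
    define r where "r = d / 2"
    have r: "0 < r" "r < d" using d(1) by (simp_all add: r_def)
    have "dist (norm (F (z + of_real r) - F z - of_real r *\<^sub>C D) / norm (complex_of_real r)) 0 < e"
      by (rule d(2)) (use r in auto)
    then have lt: "norm (F (z + of_real r) - F z - r *\<^sub>R D) / r < e"
      using r by (simp add: scaleC_of_real)
    let ?y = "(1 / r) *\<^sub>R (F (z + of_real r) - F z)"
    have "?y \<in> T" using F(2) T(2) by (intro subspace_scale subspace_diff)
    have "?y - D = (1 / r) *\<^sub>R (F (z + of_real r) - F z - r *\<^sub>R D)"
      using r by (simp add: scaleR_diff_right)
    then have "dist ?y D = norm (F (z + of_real r) - F z - r *\<^sub>R D) / r"
      using r by (simp add: dist_norm)
    with lt \<open>?y \<in> T\<close> show "\<exists>y\<in>T. dist y D < e" by metis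
  qed
  then show ?thesis using T(1) by simp
qed

section \<open>The set \<open>Y0\<close> and the functionals given by measures\<close>

locale ground_setup = groupoid_dynamics act Y N
  for act :: "'g::{group_add, countable} \<Rightarrow> 'x::{t2_space, second_countable_topology} \<Rightarrow> 'x"
    and Y :: "'x set" and N :: "'g \<Rightarrow> real" +
  assumes lc: "locally_compact_space (euclidean :: 'x topology)"
    and free: "\<And>g. act g ` Y0 act Y N \<inter> Y0 act Y N \<noteq> {} \<Longrightarrow> g = 0"
begin

abbreviation Z :: "'x set" where "Z \<equiv> Y0 act Y N"

lemma dom_eq: "dom g = Y \<inter> act g ` Y"
proof (intro set_eqI iffI)
  fix x assume "x \<in> dom g"
  then show "x \<in> Y \<inter> act g ` Y" by (auto simp: dom_def intro!: image_eqI[of x "act g" "act (- g) x"])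
qed (auto simp: dom_def)

lemma Diff_Z: "Y - Z = (\<Union>g\<in>{g. 1 < N g}. dom g)"
  by (auto simp: Y0_def dom_eq)

lemma closed_Z: "closed Z"
proof -
  have "Z = Y \<inter> - (\<Union>g\<in>{g. 1 < N g}. dom g)" using Diff_Z by (auto simp: Y0_def)
  then show ?thesis by (auto intro!: closed_Int closed_Y closed_Compl open_UN open_dom simp: closed_Compl)
qed

lemma Z_sets: "Z \<in> sets (restrict_space borel Y)"
proof -
  have "Z = Y \<inter> Z" by (auto simp: Y0_def)
  then show ?thesis unfolding sets_restrict_space by (rule image_eqI) (rule borel_closed[OF closed_Z])
qed

lemma coeffs_real: "f \<in> C0r (dom g) \<Longrightarrow> (\<lambda>x. complex_of_real (f x)) \<in> coeffs g"
  by (auto simp: C0r_def coeffs_def)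

lemma C0r_Y: "f \<in> C0r Y \<longleftrightarrow> (\<lambda>x. complex_of_real (f x)) \<in> coeffs 0"
  by (auto simp: C0r_def coeffs_def dom_zero)

lemma measurable_restrict:
  fixes f :: "'x \<Rightarrow> 'b::topological_space"
  assumes "sets \<mu> = sets (restrict_space borel Y)" "f \<in> borel_measurable borel"
  shows "f \<in> borel_measurable \<mu>"
  using measurable_restrict_space1[OF assms(2), of Y] measurable_cong_sets[OF assms(1) refl] by blast

definition expect :: "'x measure \<Rightarrow> ('g \<times> 'x) op \<Rightarrow> complex" where
  "expect \<mu> a = integral\<^sup>L \<mu> (cond_exp a)"

lemma integrable_cond_exp:
  assumes "finite_measure \<mu>" "sets \<mu> = sets (restrict_space borel Y)" "a \<in> A"
  shows "integrable \<mu> (cond_exp a)"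
  by (rule finite_measure.integrable_const_bound[OF assms(1), of _ "norm a"])
    (auto intro: measurable_restrict[OF assms(2)] borel_measurable_cond_exp assms(3) cmod_cond_exp_le)

lemma cmod_expect_le:
  assumes "finite_measure \<mu>" "sets \<mu> = sets (restrict_space borel Y)" "a \<in> A"
  shows "cmod (expect \<mu> a) \<le> measure \<mu> (space \<mu>) * norm a"
proof -
  interpret finite_measure \<mu> by fact
  have i: "integrable \<mu> (cond_exp a)" by (rule integrable_cond_exp[OF assms])
  have "cmod (expect \<mu> a) \<le> (\<integral>x. cmod (cond_exp a x) \<partial>\<mu>)"
    unfolding expect_def by (rule integral_norm_bound)
  also have "\<dots> \<le> (\<integral>x. norm a \<partial>\<mu>)"
    using i by (intro integral_mono integrable_norm) (auto simp: cmod_cond_exp_le)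
  finally show ?thesis by simp
qed

text \<open>Shared by states and by \<open>expect \<mu>\<close> when \<open>\<mu>\<close> has mass
  at most 1. This allows the two to be compared on generators before \<open>\<mu>\<close> is known
  to be a probability measure.\<close>

definition contractive :: "(('g \<times> 'x) op \<Rightarrow> complex) \<Rightarrow> bool" where
  "contractive \<phi> \<longleftrightarrow> (\<forall>a\<in>A. \<forall>b\<in>A. \<phi> (a + b) = \<phi> a + \<phi> b) \<and> (\<forall>c. \<forall>a\<in>A. \<phi> (c *\<^sub>C a) = c * \<phi> a) \<and>
    (\<forall>a\<in>A. cmod (\<phi> a) \<le> norm a)"

lemma contractive_expect:
  assumes "finite_measure \<mu>" "sets \<mu> = sets (restrict_space borel Y)" "measure \<mu> (space \<mu>) \<le> 1"
  shows "contractive (expect \<mu>)"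
  unfolding contractive_def
proof (intro conjI ballI allI)
  fix a b assume ab: "a \<in> A" "b \<in> A"
  have "cond_exp (a + b) = (\<lambda>x. cond_exp a x + cond_exp b x)" by (auto simp: cond_exp_add)
  then show "expect \<mu> (a + b) = expect \<mu> a + expect \<mu> b"
    by (simp add: expect_def integrable_cond_exp[OF assms(1,2)] ab)
next
  fix c a assume "a \<in> A"
  have "cond_exp (c *\<^sub>C a) = (\<lambda>x. c * cond_exp a x)" by (auto simp: cond_exp_scaleC)
  then show "expect \<mu> (c *\<^sub>C a) = c * expect \<mu> a" by (simp add: expect_def)
next
  fix a assume "a \<in> A"
  then have "cmod (expect \<mu> a) \<le> measure \<mu> (space \<mu>) * norm a" by (rule cmod_expect_le[OF assms(1,2)])
  also have "\<dots> \<le> 1 * norm a" using assms(3) by (intro mult_right_mono) auto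
  finally show "cmod (expect \<mu> a) \<le> norm a" by simp
qed

lemma contractiveD:
  assumes "contractive \<phi>"
  shows "a \<in> A \<Longrightarrow> b \<in> A \<Longrightarrow> \<phi> (a + b) = \<phi> a + \<phi> b" "a \<in> A \<Longrightarrow> \<phi> (c *\<^sub>C a) = c * \<phi> a"
    "a \<in> A \<Longrightarrow> cmod (\<phi> a) \<le> norm a" "\<phi> 0 = 0"
    "a \<in> A \<Longrightarrow> \<phi> (r *\<^sub>R a) = of_real r * \<phi> a"
    "a \<in> A \<Longrightarrow> b \<in> A \<Longrightarrow> \<phi> (a - b) = \<phi> a - \<phi> b"
proof -
  show add: "\<phi> (a + b) = \<phi> a + \<phi> b" if "a \<in> A" "b \<in> A" for a b
    using assms that by (simp add: contractive_def)
  show sc: "\<phi> (c *\<^sub>C a) = c * \<phi> a" if "a \<in> A" for a c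
    using assms that by (simp add: contractive_def)
  show "cmod (\<phi> a) \<le> norm a" if "a \<in> A" using assms that by (simp add: contractive_def)
  show "\<phi> 0 = 0" using sc[OF A_zero, of 0] by (simp add: scaleC_zero_right)
  show "\<phi> (r *\<^sub>R a) = of_real r * \<phi> a" if "a \<in> A"
    using sc[OF that, of "of_real r"] by (simp add: scaleC_of_real)
  show "\<phi> (a - b) = \<phi> a - \<phi> b" if "a \<in> A" "b \<in> A"
    using add[of "a - b" b] that by (simp add: A_diff)
qed

lemma contractive_eqI:
  assumes \<phi>: "contractive \<phi>" and \<psi>: "contractive \<psi>"
    and eq: "\<And>g f. f \<in> coeffs g \<Longrightarrow> \<phi> (gen g f) = \<psi> (gen g f)" and a: "a \<in> A"
  shows "\<phi> a = \<psi> a"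
proof -
  have "A \<subseteq> {a \<in> A. \<phi> a = \<psi> a}"
  proof (rule A_subsetI)
    show "closed {a \<in> A. \<phi> a = \<psi> a}"
      unfolding closed_sequential_limits
    proof (intro allI impI, elim conjE)
      fix s :: "nat \<Rightarrow> ('g \<times> 'x) op" and l
      assume s: "\<forall>n. s n \<in> {a \<in> A. \<phi> a = \<psi> a}" "s \<longlonglongrightarrow> l"
      have sA: "\<And>n. s n \<in> A" using s(1) by simp
      have l: "l \<in> A" using closed_A sA s(2) unfolding closed_sequential_limits by blast
      have n0: "(\<lambda>n. norm (s n - l)) \<longlonglongrightarrow> 0" using s(2) by (simp add: LIM_zero tendsto_norm_zero)
      have lim: "(\<lambda>n. \<theta> (s n)) \<longlonglongrightarrow> \<theta> l" if \<theta>: "contractive \<theta>" for \<theta>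
      proof -
        have "(\<lambda>n. \<theta> (s n) - \<theta> l) \<longlonglongrightarrow> 0"
        proof (rule Lim_null_comparison[OF always_eventually n0], rule allI)
          fix n show "norm (\<theta> (s n) - \<theta> l) \<le> norm (s n - l)"
            using contractiveD(3)[OF \<theta> A_diff[OF sA l], of n] contractiveD(6)[OF \<theta> sA l, of n] by simp
        qed
        then show ?thesis by (rule LIM_zero_cancel)
      qed
      have "(\<lambda>n. \<phi> (s n)) = (\<lambda>n. \<psi> (s n))" using s(1) by auto
      then have "\<phi> l = \<psi> l" using LIMSEQ_unique lim[OF \<phi>] lim[OF \<psi>] by metis
      then show "l \<in> {a \<in> A. \<phi> a = \<psi> a}" using l by simp
    qed
    show "subspace {a \<in> A. \<phi> a = \<psi> a}"
      using subspace_A by (auto simp: subspace_def contractiveD[OF \<phi>] contractiveD[OF \<psi>])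
  qed (use eq gen_A in auto)
  then show ?thesis using a by auto
qed

lemma integral_indicator_limit:
  assumes fin: "finite_measure \<mu>" and \<mu>: "space \<mu> = Y" "sets \<mu> = sets (restrict_space borel Y)" and V: "open V" "V \<subseteq> Y"
    and g: "\<And>n. g n \<in> C0r V" "\<And>n x. 0 \<le> g n x" "\<And>n x. g n x \<le> 1" "\<And>x. (\<lambda>n. g n x) \<longlonglongrightarrow> indicator V x"
  shows "(\<lambda>n. integral\<^sup>L \<mu> (g n)) \<longlonglongrightarrow> measure \<mu> V"
proof -
  interpret finite_measure \<mu> by fact
  have Vs: "V \<in> sets \<mu>"
    unfolding \<mu>(2) sets_restrict_space using V by (intro image_eqI[of _ _ V]) auto
  have "(\<lambda>n. integral\<^sup>L \<mu> (g n)) \<longlonglongrightarrow> integral\<^sup>L \<mu> (indicator V :: 'x \<Rightarrow> real)"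
  proof (rule integral_dominated_convergence[where w = "\<lambda>_. 1"])
    show "g n \<in> borel_measurable \<mu>" for n
      by (rule measurable_restrict[OF \<mu>(2) borel_measurable_continuous_onI[OF C0r_continuous[OF g(1)]]])
    show "(indicator V :: 'x \<Rightarrow> real) \<in> borel_measurable \<mu>" using Vs by simp
  qed (use g in auto)
  moreover have "V \<inter> space \<mu> = V" using V(2) \<mu>(1) by auto
  ultimately show ?thesis by simp
qed

section \<open>From measures to ground states\<close>

context
  fixes \<mu> :: "'x measure"
  assumes \<mu>: "\<mu> \<in> prob_measures_on Y Z"
begin

lemma prob_\<mu>: "prob_space \<mu>" and space_\<mu>: "space \<mu> = Y" and sets_\<mu>: "sets \<mu> = sets (restrict_space borel Y)"
  and null_\<mu>: "emeasure \<mu> (Y - Z) = 0"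
  using \<mu> by (auto simp: prob_measures_on_def)

interpretation prob_space \<mu> by (rule prob_\<mu>)

lemma AE_Z: "AE x in \<mu>. x \<in> Z"
proof (rule AE_I[OF _ null_\<mu>])
  show "{x \<in> space \<mu>. x \<notin> Z} \<subseteq> Y - Z" by (auto simp: space_\<mu>)
  have "Y \<in> sets \<mu>" using sets.top[of \<mu>] by (simp add: space_\<mu>)
  then show "Y - Z \<in> sets \<mu>" using Z_sets by (auto simp: sets_\<mu>)
qed

lemma contractive_\<mu>: "contractive (expect \<mu>)"
  by (rule contractive_expect[OF _ sets_\<mu>]) (auto simp: prob_space finite_measure_axioms)

lemma state_expect: "state_on A (induced_functional A \<mu>)"
proof -
  let ?\<phi> = "induced_functional A \<mu>"
  have \<phi>: "?\<phi> a = expect \<mu> a" if "a \<in> A" for a using that by (simp add: induced_functional_def expect_def)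
  note c = contractiveD[OF contractive_\<mu>]
  have "?\<phi> (b o\<^sub>L a) \<in> \<real>\<^sub>\<ge>\<^sub>0" if "is_adjoint a b" for a b
  \<comment> \<open>The positivity clause of \<open>state_on\<close> lets \<open>b\<close> be any
    operator adjoint to \<open>a\<close>; if the product lies outside the algebra, the functional is
    zero by definition.\<close>
  proof (cases "b o\<^sub>L a \<in> A")
    case True
    have "cond_exp (b o\<^sub>L a) = (\<lambda>x. complex_of_real ((norm (a (delta (0, x))))\<^sup>2))"
      using cond_exp_adjoint[OF that] by auto
    then have "?\<phi> (b o\<^sub>L a) = of_real (integral\<^sup>L \<mu> (\<lambda>x. (norm (a (delta (0, x))))\<^sup>2))"
      using True by (simp only: \<phi> expect_def integral_complex_of_real)
    then show ?thesis by simp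
  qed (simp add: induced_functional_def)
  moreover have "bdd_above ((\<lambda>a. cmod (?\<phi> a)) ` {a \<in> A. norm a \<le> 1})"
    using c(3) \<phi> by (intro bdd_aboveI[of _ 1]) (auto intro: order_trans)
  moreover have "(SUP a\<in>{a \<in> A. norm a \<le> 1}. cmod (?\<phi> a)) = 1"
  proof (rule antisym)
    show "(SUP a\<in>{a \<in> A. norm a \<le> 1}. cmod (?\<phi> a)) \<le> 1"
    proof (rule cSUP_least)
      show "{a \<in> A. norm a \<le> 1} \<noteq> {}" using A_zero by (auto intro!: exI[of _ 0])
    qed (use c(3) \<phi> in \<open>auto intro: order_trans\<close>)
    \<comment> \<open>In place of a unit, a sequence in the unit ball of C_0(Y) converging pointwise
      to the indicator of \<open>Y\<close> shows that the norm is at least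
      \<open>measure \<mu> Y\<close>.\<close>
    obtain g :: "nat \<Rightarrow> 'x \<Rightarrow> real" where g: "\<And>n. g n \<in> C0r Y" "\<And>n x. 0 \<le> g n x" "\<And>n x. g n x \<le> 1"
      "\<And>x. (\<lambda>n. g n x) \<longlonglongrightarrow> indicator Y x"
      by (rule C0r_exhaustion[OF lc open_Y]) blast
    have "(\<lambda>n. integral\<^sup>L \<mu> (g n)) \<longlonglongrightarrow> measure \<mu> Y"
      by (rule integral_indicator_limit[OF finite_measure_axioms space_\<mu> sets_\<mu> open_Y order_refl g])
    then have lim: "(\<lambda>n. integral\<^sup>L \<mu> (g n)) \<longlonglongrightarrow> 1" using prob_space by (simp add: space_\<mu>)
    show "1 \<le> (SUP a\<in>{a \<in> A. norm a \<le> 1}. cmod (?\<phi> a))"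
    proof (rule LIMSEQ_le_const2[OF lim], intro exI[of _ 0] allI impI)
      fix n
      let ?f = "\<lambda>x. complex_of_real (g n x)"
      have f: "?f \<in> coeffs 0" using g(1) by (simp add: C0r_Y)
      have "norm (gen 0 ?f) \<le> 1"
        by (rule norm_gen_le[OF coeffsD(1)[OF f]]) (use g in auto)
      then have m: "gen 0 ?f \<in> {a \<in> A. norm a \<le> 1}" using gen_A[OF f] by simp
      have "?\<phi> (gen 0 ?f) = of_real (integral\<^sup>L \<mu> (g n))"
        using gen_A[OF f] by (simp add: \<phi> expect_def cond_exp_gen[OF coeffsD(1)[OF f]])
      then have "integral\<^sup>L \<mu> (g n) = cmod (?\<phi> (gen 0 ?f))"
        using g(2) by (simp add: integral_nonneg)
      also have "\<dots> \<le> (SUP a\<in>{a \<in> A. norm a \<le> 1}. cmod (?\<phi> a))"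
        by (rule cSUP_upper[OF m]) fact
      finally show "integral\<^sup>L \<mu> (g n) \<le> (SUP a\<in>{a \<in> A. norm a \<le> 1}. cmod (?\<phi> a))" .
    qed
  qed
  moreover have "?\<phi> a = 0" if "a \<notin> A" for a using that by (simp add: induced_functional_def)
  ultimately show ?thesis
    unfolding state_on_def using c(1,2) by (simp add: \<phi> A_add A_scaleC)
qed

lemma expect_growing:
  assumes f: "f \<in> coeffs g" and k: "k \<in> coeffs h" and Ng: "N g < 1"
  shows "expect \<mu> (gen h k o\<^sub>L gen g f) = 0"
proof -
  have C: "(\<lambda>x. k x * f (act (- h) x)) \<in> C0" using coeffs_compose[OF k f] by (rule coeffsD)
  show ?thesis
  \<comment> \<open>The product k u_h f u_g has a diagonal part only for \<open>h = - g\<close>, and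
    then its expectation at \<open>x\<close> is k(x) f(gx).\<close>
  proof (cases "h + g = 0")
    case True
    then have h: "- h = g" by (rule minus_unique)
    have "f (act g x) = 0" if "x \<in> Z" for x
    proof (rule ccontr)
      assume "f (act g x) \<noteq> 0"
      then have "act g x \<in> Y" using coeffsD(2)[OF f] by (auto simp: dom_def)
      then have "x \<in> act (- g) ` Y" by (intro image_eqI[of _ _ "act g x"]) auto
      moreover have "1 < N (- g)" using Ng N_pos[of g] by (simp add: N_uminus one_less_inverse)
      ultimately show False using that by (auto simp: Y0_def)
    qed
    then have "AE x in \<mu>. k x * f (act g x) = 0" using AE_Z by (auto elim: eventually_mono)
    then have "integral\<^sup>L \<mu> (\<lambda>x. k x * f (act g x)) = 0" by (rule integral_eq_zero_AE)
    then show ?thesis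
      using C by (simp add: expect_def gen_compose coeffsD(1)[OF f] coeffsD(1)[OF k] cond_exp_gen True h)
  next
    case False
    then show ?thesis
      using C by (simp add: expect_def gen_compose coeffsD(1)[OF f] coeffsD(1)[OF k] cond_exp_gen)
  qed
qed

text \<open>The orbit of a generator stays in a complex line, so analyticity reduces to that of the
  scalar N(g)^{iz}, written with the real logarithm.\<close>

lemma analytic_gen:
  assumes f: "f \<in> coeffs g"
  shows "analytic_orbit A (dynamics N) (gen g f) (\<lambda>z. exp (\<i> * z * of_real (ln (N g))) *\<^sub>C gen g f)"
  unfolding analytic_orbit_def
proof (intro conjI allI)
  let ?b = "gen g f"
  show "exp (\<i> * z * of_real (ln (N g))) *\<^sub>C ?b \<in> A" for z by (intro A_scaleC gen_A f)
  show "exp (\<i> * complex_of_real t * of_real (ln (N g))) *\<^sub>C ?b = dynamics N t ?b" for t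
    using N_pos[of g] by (simp add: dynamics_gen[OF f] powr_def Ln_of_real mult_ac)
  fix z
  have bl: "bounded_linear (\<lambda>c. c *\<^sub>C ?b)"
  proof (rule bounded_linear_intro[of _ "norm ?b"])
    show "(r *\<^sub>R c) *\<^sub>C ?b = r *\<^sub>R (c *\<^sub>C ?b)" for r c
      by (simp add: scaleR_conv_of_real scaleC_scaleC[symmetric] scaleC_of_real)
  qed (auto simp: scaleC_add_left norm_scaleC_le)
  let ?d = "exp (\<i> * z * of_real (ln (N g))) * (\<i> * of_real (ln (N g)))"
  have "((\<lambda>z. exp (\<i> * z * of_real (ln (N g)))) has_field_derivative ?d) (at z)"
    by (auto intro!: derivative_eq_intros)
  then have "((\<lambda>z. exp (\<i> * z * of_real (ln (N g)))) has_derivative (\<lambda>w. ?d * w)) (at z)"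
    by (simp add: has_field_derivative_def)
  from bounded_linear.has_derivative[OF bl this]
  have "((\<lambda>z. exp (\<i> * z * of_real (ln (N g))) *\<^sub>C ?b) has_derivative (\<lambda>w. w *\<^sub>C (?d *\<^sub>C ?b))) (at z)"
    by (simp add: scaleC_scaleC mult.commute)
  then show "\<exists>D. ((\<lambda>z. exp (\<i> * z * of_real (ln (N g))) *\<^sub>C ?b) has_derivative (\<lambda>w. w *\<^sub>C D)) (at z)" by blast
qed

text \<open>The dense set is \<open>gens\<close>. For \<open>N g \<ge> 1\<close> the scalar
  N(g)^{iz} has modulus at most 1 on the upper half-plane; otherwise it grows, but multiplies zero
  by \<open>expect_growing\<close>.\<close>

lemma ground_expect: "induced_functional A \<mu> \<in> ground_states A (dynamics N)"
proof -
  let ?\<phi> = "induced_functional A \<mu>"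
  have \<phi>: "?\<phi> a = expect \<mu> a" if "a \<in> A" for a using that by (simp add: induced_functional_def expect_def)
  have inv: "?\<phi> (dynamics N t a) = ?\<phi> a" if "a \<in> A" for t a
  proof -
    have "cond_exp (dynamics N t a) = cond_exp a" using cond_exp_dynamics[OF that] by auto
    then show ?thesis using that by (simp add: \<phi> dynamics_A expect_def)
  qed
  have bdd: "bounded ((\<lambda>z. ?\<phi> (gen h k o\<^sub>L (exp (\<i> * z * of_real (ln (N g))) *\<^sub>C gen g f))) ` {z. 0 < Im z})"
    if f: "f \<in> coeffs g" and k: "k \<in> coeffs h" for f g k h
  proof -
    have AA: "gen h k o\<^sub>L gen g f \<in> A" by (intro A_compose gen_A f k)
    have eq: "?\<phi> (gen h k o\<^sub>L (exp (\<i> * z * of_real (ln (N g))) *\<^sub>C gen g f)) =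
        exp (\<i> * z * of_real (ln (N g))) * expect \<mu> (gen h k o\<^sub>L gen g f)" for z
      using AA by (simp add: A_compose_scaleC[OF gen_A[OF k]] \<phi> A_scaleC contractiveD[OF contractive_\<mu>])
    show ?thesis
    proof (cases "N g < 1")
      case True
      then show ?thesis unfolding eq expect_growing[OF f k True] by (auto simp: bounded_iff)
    next
      case False
      then have "0 \<le> ln (N g)" by simp
      then have "cmod (exp (\<i> * z * of_real (ln (N g)))) \<le> 1" if "0 < Im z" for z
        using that by (simp add: norm_exp_eq_Re)
      then have "cmod (exp (\<i> * z * of_real (ln (N g))) * expect \<mu> (gen h k o\<^sub>L gen g f)) \<le>
          1 * cmod (expect \<mu> (gen h k o\<^sub>L gen g f))" if "0 < Im z" for z
        unfolding norm_mult using that by (intro mult_right_mono) auto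
      then show ?thesis unfolding eq bounded_iff by blast
    qed
  qed
  have "\<exists>F. analytic_orbit A (dynamics N) b F \<and> (\<forall>a\<in>gens. bounded ((\<lambda>z. ?\<phi> (a o\<^sub>L F z)) ` {z. 0 < Im z}))"
    if "b \<in> gens" for b
  proof -
    obtain g f where b: "b = gen g f" "f \<in> coeffs g" using \<open>b \<in> gens\<close> unfolding gens_def by blast
    show ?thesis unfolding b(1)
    proof (intro exI conjI ballI)
      show "analytic_orbit A (dynamics N) (gen g f) (\<lambda>z. exp (\<i> * z * of_real (ln (N g))) *\<^sub>C gen g f)"
        by (rule analytic_gen[OF b(2)])
      fix a assume "a \<in> gens"
      then obtain h k where "a = gen h k" "k \<in> coeffs h" unfolding gens_def by blast
      then show "bounded ((\<lambda>z. ?\<phi> (a o\<^sub>L (exp (\<i> * z * of_real (ln (N g))) *\<^sub>C gen g f))) ` {z. 0 < Im z})"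
        using bdd[OF b(2)] by simp
    qed
  qed
  then show ?thesis
    unfolding ground_states_def
    using state_expect inv gens_A reduced_algebra_eq by (intro CollectI conjI exI[of _ gens]) auto
qed

end

end

lemmas compose_right_linear = bounded_linear.linear[OF bounded_linear_compose_right]
lemmas compose_left_linear = bounded_linear.linear[OF bounded_linear_compose_left]

lemma cspan_subset:
  assumes "subspace T" "\<And>c s. s \<in> S \<Longrightarrow> c *\<^sub>C s \<in> T"
  shows "cspan S \<subseteq> T"
  unfolding cspan_def by (rule span_minimal) (use assms in auto)

section \<open>From ground states to measures\<close>

context ground_setup
begin

context
  fixes \<phi> :: "('g \<times> 'x) op \<Rightarrow> complex"
  assumes ground: "\<phi> \<in> ground_states A (dynamics N)"
begin

lemma state: "state_on A \<phi>"
  using ground by (simp add: ground_states_def)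

lemma state_zero: "a \<notin> A \<Longrightarrow> \<phi> a = 0"
  using state by (simp add: state_on_def)

lemma state_positive: "a \<in> A \<Longrightarrow> is_adjoint a b \<Longrightarrow> \<phi> (b o\<^sub>L a) \<in> \<real>\<^sub>\<ge>\<^sub>0"
  using state unfolding state_on_def by blast

lemma contractive_state: "contractive \<phi>"
proof -
  have add: "\<forall>a\<in>A. \<forall>b\<in>A. \<phi> (a + b) = \<phi> a + \<phi> b" and sc: "\<forall>c. \<forall>a\<in>A. \<phi> (c *\<^sub>C a) = c * \<phi> a"
    and bdd: "bdd_above ((\<lambda>a. cmod (\<phi> a)) ` {a \<in> A. norm a \<le> 1})"
    and sup: "(SUP a\<in>{a \<in> A. norm a \<le> 1}. cmod (\<phi> a)) = 1"
    using state by (simp_all add: state_on_def)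
  have "cmod (\<phi> a) \<le> norm a" if a: "a \<in> A" for a
  proof (cases "a = 0")
    case True
    have "\<phi> (0 *\<^sub>C a) = 0 * \<phi> a" using sc a by blast
    then show ?thesis using True by (simp add: scaleC_zero_right)
  next
    case False
    then have n: "0 < norm a" by simp
    let ?b = "complex_of_real (1 / norm a) *\<^sub>C a"
    have "norm ?b \<le> 1" unfolding scaleC_of_real using n by simp
    then have "?b \<in> {a \<in> A. norm a \<le> 1}" using A_scaleC[OF a] by simp
    then have le: "cmod (\<phi> ?b) \<le> 1" using cSUP_upper[OF _ bdd, of ?b] unfolding sup by blast
    have "\<phi> ?b = complex_of_real (1 / norm a) * \<phi> a" using sc a by blast
    then have "cmod (\<phi> ?b) = cmod (\<phi> a) / norm a" by (simp only: norm_mult norm_of_real) simp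
    then have "cmod (\<phi> a) / norm a \<le> 1" using le by (simp only:)
    then show ?thesis using n by (simp add: divide_le_eq)
  qed
  then show ?thesis using add sc by (simp add: contractive_def)
qed

lemmas \<phi>_simps = contractiveD[OF contractive_state]

text \<open>The derivative of \<open>F\<close> has the form \<open>w *\<^sub>C D\<close>, so after
  applying \<open>\<phi>\<close> it is multiplication by a complex number. Linearity and
  contractivity of \<open>\<phi>\<close> are available only on the algebra, so \<open>D\<close> must
  first be placed there.\<close>

lemma orbit_holomorphic:
  assumes F: "analytic_orbit A (dynamics N) b F" and a: "a \<in> A"
  shows "(\<lambda>z. \<phi> (a o\<^sub>L F z)) holomorphic_on UNIV"
  unfolding holomorphic_on_def
proof
  fix z :: complex
  have FA: "F z \<in> A" for z using F by (simp add: analytic_orbit_def)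
  obtain D where D: "(F has_derivative (\<lambda>w. w *\<^sub>C D)) (at z)"
    using F unfolding analytic_orbit_def by blast
  have DA: "D \<in> A" by (rule has_derivative_scaleC_in_closed[OF D FA closed_A subspace_A])
  have lim: "((\<lambda>h. norm (F (z + h) - F z - h *\<^sub>C D) / norm h) \<longlongrightarrow> 0) (at 0)"
    using D by (simp add: has_derivative_at)
  have le: "norm (\<phi> (a o\<^sub>L F (z + h)) - \<phi> (a o\<^sub>L F z) - \<phi> (a o\<^sub>L D) * h) \<le>
      norm a * norm (F (z + h) - F z - h *\<^sub>C D)" for h
  proof -
    have "a o\<^sub>L (F (z + h) - F z - h *\<^sub>C D) = (a o\<^sub>L F (z + h)) - (a o\<^sub>L F z) - h *\<^sub>C (a o\<^sub>L D)"
      by (simp add: linear_diff[OF compose_right_linear] A_compose_scaleC[OF a])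
    then have "\<phi> (a o\<^sub>L (F (z + h) - F z - h *\<^sub>C D)) = \<phi> (a o\<^sub>L F (z + h)) - \<phi> (a o\<^sub>L F z) - \<phi> (a o\<^sub>L D) * h"
      by (simp add: \<phi>_simps A_compose A_diff A_scaleC a FA DA)
    moreover have "a o\<^sub>L (F (z + h) - F z - h *\<^sub>C D) \<in> A"
      by (intro A_compose A_diff A_scaleC a FA DA)
    ultimately have "norm (\<phi> (a o\<^sub>L F (z + h)) - \<phi> (a o\<^sub>L F z) - \<phi> (a o\<^sub>L D) * h) \<le>
        norm (a o\<^sub>L (F (z + h) - F z - h *\<^sub>C D))"
      using \<phi>_simps(3) by metis
    also have "\<dots> \<le> norm a * norm (F (z + h) - F z - h *\<^sub>C D)" by (rule norm_blinfun_compose)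
    finally show ?thesis .
  qed
  have "((\<lambda>h. norm (\<phi> (a o\<^sub>L F (z + h)) - \<phi> (a o\<^sub>L F z) - \<phi> (a o\<^sub>L D) * h) / norm h) \<longlongrightarrow> 0) (at 0)"
  proof (rule Lim_null_comparison[OF always_eventually tendsto_mult_right_zero[OF lim, of "norm a"]], rule allI)
    fix h show "norm (norm (\<phi> (a o\<^sub>L F (z + h)) - \<phi> (a o\<^sub>L F z) - \<phi> (a o\<^sub>L D) * h) / norm h) \<le>
        norm a * (norm (F (z + h) - F z - h *\<^sub>C D) / norm h)"
      using divide_right_mono[OF le[of h], of "norm h"] by simp
  qed
  then have "((\<lambda>z. \<phi> (a o\<^sub>L F z)) has_field_derivative \<phi> (a o\<^sub>L D)) (at z)"
    unfolding has_field_derivative_def has_derivative_at by (simp add: bounded_linear_mult_right)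
  then show "(\<lambda>z. \<phi> (a o\<^sub>L F z)) field_differentiable at z within UNIV"
    unfolding field_differentiable_def by blast
qed

text \<open>Only the scalar function with prescribed values on the real axis is kept, not the
  operator-valued orbit. This makes the property stable under linear combinations in each
  argument.\<close>

definition half_plane_extension :: "('g \<times> 'x) op \<Rightarrow> ('g \<times> 'x) op \<Rightarrow> bool" where
  "half_plane_extension a b \<longleftrightarrow> (\<exists>H. H holomorphic_on UNIV \<and> bounded (H ` {z. 0 < Im z}) \<and>
     (\<forall>t. H (complex_of_real t) = \<phi> (a o\<^sub>L dynamics N t b)))"

lemma bounded_image_add:
  fixes H K :: "complex \<Rightarrow> complex"
  assumes "bounded (H ` T)" "bounded (K ` T)"
  shows "bounded ((\<lambda>z. H z + K z) ` T)"
proof -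
  obtain B C where "\<And>z. z \<in> T \<Longrightarrow> cmod (H z) \<le> B" "\<And>z. z \<in> T \<Longrightarrow> cmod (K z) \<le> C"
    using assms unfolding bounded_iff by blast
  then have "cmod (H z + K z) \<le> B + C" if "z \<in> T" for z
    using norm_triangle_mono that by blast
  then show ?thesis unfolding bounded_iff by blast
qed

lemma bounded_image_cmult:
  fixes H :: "complex \<Rightarrow> complex"
  assumes "bounded (H ` T)"
  shows "bounded ((\<lambda>z. c * H z) ` T)"
proof -
  obtain B where "\<And>z. z \<in> T \<Longrightarrow> cmod (H z) \<le> B" using assms unfolding bounded_iff by blast
  then have "cmod (c * H z) \<le> cmod c * B" if "z \<in> T" for z
    unfolding norm_mult using that by (intro mult_left_mono) auto
  then show ?thesis unfolding bounded_iff by blast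
qed

text \<open>A single rule for sums and complex multiples in both arguments; for a multiple, the
  second pair is chosen with value zero.\<close>

lemma half_plane_extension_combine:
  assumes "half_plane_extension a b" "half_plane_extension a' b'"
    and eq: "\<And>t. \<phi> (a'' o\<^sub>L dynamics N t b'') = c * \<phi> (a o\<^sub>L dynamics N t b) + \<phi> (a' o\<^sub>L dynamics N t b')"
  shows "half_plane_extension a'' b''"
proof -
  obtain H where H: "H holomorphic_on UNIV" "bounded (H ` {z. 0 < Im z})"
    "\<And>t. H (complex_of_real t) = \<phi> (a o\<^sub>L dynamics N t b)"
    using assms(1) unfolding half_plane_extension_def by blast
  obtain K where K: "K holomorphic_on UNIV" "bounded (K ` {z. 0 < Im z})"
    "\<And>t. K (complex_of_real t) = \<phi> (a' o\<^sub>L dynamics N t b')"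
    using assms(2) unfolding half_plane_extension_def by blast
  show ?thesis unfolding half_plane_extension_def
  proof (intro exI[of _ "\<lambda>z. c * H z + K z"] conjI allI)
    show "(\<lambda>z. c * H z + K z) holomorphic_on UNIV" by (intro holomorphic_intros H(1) K(1))
    show "bounded ((\<lambda>z. c * H z + K z) ` {z. 0 < Im z})"
      by (rule bounded_image_add[OF bounded_image_cmult[OF H(2)] K(2)])
  qed (simp add: H(3) K(3) eq)
qed

lemma half_plane_extension_zero:
  assumes "\<And>t. \<phi> (a o\<^sub>L dynamics N t b) = 0"
  shows "half_plane_extension a b"
  unfolding half_plane_extension_def by (intro exI[of _ "\<lambda>_. 0"]) (use assms in \<open>auto simp: bounded_iff\<close>)

lemma subspace_half_plane_extension_right:
  assumes a: "a \<in> A"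
  shows "subspace {b \<in> A. half_plane_extension a b}"
  unfolding subspace_def
proof (intro conjI ballI allI)
  note lin = bounded_linear.linear[OF bounded_linear_dynamics]
  show "0 \<in> {b \<in> A. half_plane_extension a b}"
    by (auto simp: A_zero linear_0[OF lin] linear_0[OF compose_right_linear] \<phi>_simps intro!: half_plane_extension_zero)
  fix x y assume xy: "x \<in> {b \<in> A. half_plane_extension a b}" "y \<in> {b \<in> A. half_plane_extension a b}"
  have "half_plane_extension a (x + y)"
    by (rule half_plane_extension_combine[of a x a y _ _ 1])
      (use xy a in \<open>auto simp: linear_add[OF lin] linear_add[OF compose_right_linear] \<phi>_simps A_compose dynamics_A\<close>)
  then show "x + y \<in> {b \<in> A. half_plane_extension a b}" using xy by (simp add: A_add)
next
  note lin = bounded_linear.linear[OF bounded_linear_dynamics]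
  fix r x assume x: "x \<in> {b \<in> A. half_plane_extension a b}"
  have "half_plane_extension a 0"
    by (auto simp: linear_0[OF lin] linear_0[OF compose_right_linear] \<phi>_simps intro!: half_plane_extension_zero)
  then have "half_plane_extension a (r *\<^sub>R x)"
    by (rule half_plane_extension_combine[of a x _ _ _ _ "of_real r", rotated])
      (use x a in \<open>auto simp: linear_0[OF lin] linear_0[OF compose_right_linear] linear_scale[OF lin]
        linear_scale[OF compose_right_linear] \<phi>_simps A_compose dynamics_A\<close>)
  then show "r *\<^sub>R x \<in> {b \<in> A. half_plane_extension a b}"
    using x subspace_scale[OF subspace_A] by simp
qed

lemma subspace_half_plane_extension_left:
  assumes b: "b \<in> A"
  shows "subspace {a \<in> A. half_plane_extension a b}"
  unfolding subspace_def
proof (intro conjI ballI allI)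
  show "0 \<in> {a \<in> A. half_plane_extension a b}"
    by (auto simp: A_zero linear_0[OF compose_left_linear] \<phi>_simps intro!: half_plane_extension_zero)
  fix x y assume xy: "x \<in> {a \<in> A. half_plane_extension a b}" "y \<in> {a \<in> A. half_plane_extension a b}"
  have "half_plane_extension (x + y) b"
    by (rule half_plane_extension_combine[of x b y b _ _ 1])
      (use xy b in \<open>auto simp: linear_add[OF compose_left_linear] \<phi>_simps A_compose dynamics_A\<close>)
  then show "x + y \<in> {a \<in> A. half_plane_extension a b}" using xy by (simp add: A_add)
next
  fix r x assume x: "x \<in> {a \<in> A. half_plane_extension a b}"
  have "half_plane_extension 0 b"
    by (auto simp: linear_0[OF compose_left_linear] \<phi>_simps intro!: half_plane_extension_zero)
  then have "half_plane_extension (r *\<^sub>R x) b"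
    by (rule half_plane_extension_combine[of x b _ _ _ _ "of_real r", rotated])
      (use x b in \<open>auto simp: linear_0[OF compose_left_linear]
        linear_scale[OF compose_left_linear] \<phi>_simps A_compose dynamics_A\<close>)
  then show "r *\<^sub>R x \<in> {a \<in> A. half_plane_extension a b}"
    using x subspace_scale[OF subspace_A] by simp
qed

text \<open>The set \<open>S\<close> from the definition of a ground state is replaced by its span,
  first in the second argument with the first in \<open>S\<close>, then in the first argument.
  Approximants of arbitrary elements can then be taken from the span.\<close>

lemma dense_half_plane_extension:
  "\<exists>T\<subseteq>A. A \<subseteq> closure T \<and> (\<forall>a\<in>T. \<forall>b\<in>T. half_plane_extension a b)"
proof -
  obtain S where S: "S \<subseteq> A" "A \<subseteq> closure (cspan S)"
    "\<And>b. b \<in> S \<Longrightarrow> \<exists>F. analytic_orbit A (dynamics N) b F \<and>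
      (\<forall>a\<in>S. bounded ((\<lambda>z. \<phi> (a o\<^sub>L F z)) ` {z. 0 < Im z}))"
    using ground unfolding ground_states_def by blast
  have base: "half_plane_extension a b" if ab: "a \<in> S" "b \<in> S" for a b
  proof -
    obtain F where F: "analytic_orbit A (dynamics N) b F" "bounded ((\<lambda>z. \<phi> (a o\<^sub>L F z)) ` {z. 0 < Im z})"
      using S(3)[OF ab(2)] ab(1) by blast
    have "(\<lambda>z. \<phi> (a o\<^sub>L F z)) holomorphic_on UNIV" using orbit_holomorphic[OF F(1)] S(1) ab(1) by blast
    moreover have "F (complex_of_real t) = dynamics N t b" for t using F(1) by (simp add: analytic_orbit_def)
    ultimately show ?thesis
      unfolding half_plane_extension_def using F(2) by (intro exI[of _ "\<lambda>z. \<phi> (a o\<^sub>L F z)"]) simp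
  qed
  have A0: "half_plane_extension a 0" for a
    using linear_0[OF bounded_linear.linear[OF bounded_linear_dynamics]]
    by (auto simp: linear_0[OF compose_right_linear] \<phi>_simps intro!: half_plane_extension_zero)
  have right: "cspan S \<subseteq> {b \<in> A. half_plane_extension a b}" if a: "a \<in> S" for a
  proof (rule cspan_subset)
    have aA: "a \<in> A" using a S(1) by blast
    show "subspace {b \<in> A. half_plane_extension a b}" by (rule subspace_half_plane_extension_right[OF aA])
    fix c s assume s: "s \<in> S"
    have sA: "s \<in> A" using s S(1) by blast
    have "half_plane_extension a (c *\<^sub>C s)"
      by (rule half_plane_extension_combine[OF base[OF a s] A0[of a], of _ _ c])
        (use aA sA in \<open>auto simp: linear_0[OF bounded_linear.linear[OF bounded_linear_dynamics]]
          linear_0[OF compose_right_linear] dynamics_scaleC A_compose_scaleC \<phi>_simps A_compose dynamics_A\<close>)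
    then show "c *\<^sub>C s \<in> {b \<in> A. half_plane_extension a b}" using A_scaleC[OF sA] by simp
  qed
  have left: "cspan S \<subseteq> {a \<in> A. half_plane_extension a b}" if b: "b \<in> cspan S" for b
  proof (rule cspan_subset)
    have S_ne: "b \<in> A" if "s \<in> S" for s using right[OF that] b by blast
    show "subspace {a \<in> A. half_plane_extension a b}"
    \<comment> \<open>Membership of \<open>b\<close> in the algebra is obtained from
      \<open>right\<close>, which needs an element of \<open>S\<close>; for empty \<open>S\<close>
      the span is zero.\<close>
    proof (cases "S = {}")
      case True
      then have "b \<in> A" using b A_zero by (simp add: cspan_def)
      then show ?thesis by (rule subspace_half_plane_extension_left)
    next
      case False
      then show ?thesis using S_ne subspace_half_plane_extension_left by blast
    qed
    fix c s assume s: "s \<in> S"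
    have sA: "s \<in> A" using s S(1) by blast
    have bA: "b \<in> A" and e: "half_plane_extension s b" using right[OF s] b by auto
    have "half_plane_extension (c *\<^sub>C s) b"
      by (rule half_plane_extension_combine[OF e A0[of s], of _ _ c])
        (use bA sA in \<open>auto simp: linear_0[OF bounded_linear.linear[OF bounded_linear_dynamics]]
          linear_0[OF compose_right_linear] scaleC_compose_left \<phi>_simps A_compose dynamics_A\<close>)
    then show "c *\<^sub>C s \<in> {a \<in> A. half_plane_extension a b}" using A_scaleC[OF sA] by simp
  qed
  have "cspan S \<subseteq> A"
  proof (rule cspan_subset[OF subspace_A])
    show "c *\<^sub>C s \<in> A" if "s \<in> S" for c s using S(1) that by (blast intro: A_scaleC)
  qed
  then show ?thesis using S(2) left by (intro exI[of _ "cspan S"]) blast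
qed

lemma ground_annihilates:
  assumes a: "a \<in> A" and b: "b \<in> A" and Ng: "N g < 1"
    and dyn: "\<And>t. dynamics N t b = complex_of_real (N g) powr (\<i> * complex_of_real t) *\<^sub>C b"
  shows "\<phi> (a o\<^sub>L b) = 0"
proof (rule negative_frequency_vanishes)
  show "0 < - ln (N g)" using Ng N_pos[of g] by simp
  obtain T where T: "T \<subseteq> A" "A \<subseteq> closure T" "\<And>a b. a \<in> T \<Longrightarrow> b \<in> T \<Longrightarrow> half_plane_extension a b"
    using dense_half_plane_extension by blast
  fix e :: real assume e: "0 < e"
  \<comment> \<open>Replacing \<open>a\<close> and \<open>b\<close> by approximants within
    \<open>d\<close> costs at most \<open>d * (norm b + 1) + norm a * d = d * M\<close>; the
    condition \<open>d \<le> 1\<close> gives \<open>norm b' \<le> norm b + 1\<close>.\<close>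
  define M where "M = norm a + norm b + 1"
  have M: "0 < M" by (simp add: M_def add_nonneg_pos)
  define d where "d = min 1 (e / M)"
  have d: "0 < d" "d \<le> 1" using e M by (auto simp: d_def)
  have dM: "d * M \<le> e" using M by (simp add: d_def min_def field_simps)
  obtain a' where a': "a' \<in> T" "norm (a' - a) < d"
    using closure_approachable[THEN iffD1, OF subsetD[OF T(2) a], rule_format, OF d(1)]
    unfolding dist_norm by (elim bexE)
  obtain b' where b': "b' \<in> T" "norm (b' - b) < d"
    using closure_approachable[THEN iffD1, OF subsetD[OF T(2) b], rule_format, OF d(1)]
    unfolding dist_norm by (elim bexE)
  obtain H where H: "H holomorphic_on UNIV" "bounded (H ` {z. 0 < Im z})"
    "\<And>t. H (complex_of_real t) = \<phi> (a' o\<^sub>L dynamics N t b')"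
    using T(3)[OF a'(1) b'(1)] unfolding half_plane_extension_def by blast
  have A': "a' \<in> A" "b' \<in> A" using a' b' T(1) by auto
  have "cmod (H (complex_of_real t) - exp (- (\<i> * of_real (- ln (N g)) * of_real t)) * \<phi> (a o\<^sub>L b)) \<le> e" for t
  proof -
    have "exp (- (\<i> * of_real (- ln (N g)) * of_real t)) = complex_of_real (N g) powr (\<i> * complex_of_real t)"
      using N_pos[of g] by (simp add: powr_def Ln_of_real mult_ac)
    then have "exp (- (\<i> * of_real (- ln (N g)) * of_real t)) * \<phi> (a o\<^sub>L b) = \<phi> (a o\<^sub>L dynamics N t b)"
      by (simp add: dyn A_compose_scaleC[OF a] \<phi>_simps A_compose a b)
    then have eq: "H (complex_of_real t) - exp (- (\<i> * of_real (- ln (N g)) * of_real t)) * \<phi> (a o\<^sub>L b) =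
        \<phi> ((a' o\<^sub>L dynamics N t b') - (a o\<^sub>L dynamics N t b))"
      by (simp only: H(3) \<phi>_simps(6)[OF A_compose[OF A'(1) dynamics_A[OF A'(2)]] A_compose[OF a dynamics_A[OF b]]])
    \<comment> \<open>Both terms are estimated independently of \<open>t\<close>, as the dynamics
      does not increase norms.\<close>
    have split: "(a' o\<^sub>L dynamics N t b') - (a o\<^sub>L dynamics N t b) =
        ((a' - a) o\<^sub>L dynamics N t b') + (a o\<^sub>L dynamics N t (b' - b))"
      by (simp add: linear_diff[OF compose_left_linear] linear_diff[OF compose_right_linear]
          linear_diff[OF bounded_linear.linear[OF bounded_linear_dynamics]])
    have "norm b' \<le> norm b + 1" using norm_triangle_ineq[of b "b' - b"] b'(2) d(2) by simp
    then have 1: "norm ((a' - a) o\<^sub>L dynamics N t b') \<le> d * (norm b + 1)"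
      using a'(2) norm_dynamics_le[of t b'] by (intro norm_compose_le) auto
    have 2: "norm (a o\<^sub>L dynamics N t (b' - b)) \<le> norm a * d"
      using b'(2) norm_dynamics_le[of t "b' - b"] by (intro norm_compose_le) auto
    have "cmod (\<phi> ((a' o\<^sub>L dynamics N t b') - (a o\<^sub>L dynamics N t b))) \<le>
        norm ((a' o\<^sub>L dynamics N t b') - (a o\<^sub>L dynamics N t b))"
      by (intro \<phi>_simps A_diff A_compose dynamics_A a b A')
    also have "\<dots> \<le> d * (norm b + 1) + norm a * d"
      unfolding split by (rule order_trans[OF norm_triangle_ineq add_mono[OF 1 2]])
    also have "\<dots> = d * M" by (simp add: M_def algebra_simps)
    finally show ?thesis using dM unfolding eq by linarith
  qed
  then show "\<exists>H. H holomorphic_on UNIV \<and> bounded (H ` {z. 0 < Im z}) \<and>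
      (\<forall>t. cmod (H (complex_of_real t) - exp (- (\<i> * of_real (- ln (N g)) * of_real t)) * \<phi> (a o\<^sub>L b)) \<le> e)"
    using H(1,2) by blast
qed

section \<open>The representing measure of a ground state\<close>

lemma gen_square:
  assumes "f \<in> coeffs g"
  shows "gen (- g) (\<lambda>x. cnj (f (act g x))) o\<^sub>L gen g f = gen 0 (\<lambda>x. cnj (f (act g x)) * f (act g x))"
  using gen_compose[OF coeffsD(1)[OF coeffs_adjoint[OF assms]] coeffsD(1)[OF assms], of "- g" g] by simp

lemma sqrt_coeffs:
  assumes "u \<in> C0r (dom g)" "\<And>x. 0 \<le> u x"
  shows "(\<lambda>x. complex_of_real (sqrt (u x))) \<in> coeffs g"
  by (rule coeffs_real[OF C0r_sqrt[OF assms]])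

text \<open>Positivity of a state concerns products of an adjoint pair, so the function is written
  as the square of its root.\<close>

lemma state_gen_nonneg:
  assumes "u \<in> C0r Y" "\<And>x. 0 \<le> u x"
  shows "\<phi> (gen 0 (\<lambda>x. complex_of_real (u x))) \<in> \<real>\<^sub>\<ge>\<^sub>0"
proof -
  let ?f = "\<lambda>x. complex_of_real (sqrt (u x))"
  have f: "?f \<in> coeffs 0" using assms by (intro sqrt_coeffs) (simp_all add: dom_zero)
  have "complex_of_real (sqrt (u x)) * complex_of_real (sqrt (u x)) = complex_of_real (u x)" for x
    using assms(2)[of x] by (simp flip: of_real_mult)
  then have "gen 0 (\<lambda>x. complex_of_real (u x)) = gen (- 0) (\<lambda>x. cnj (?f (act 0 x))) o\<^sub>L gen 0 ?f"
    unfolding gen_square[OF f] by (simp add: act_zero)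
  then show ?thesis using state_positive[OF gen_A[OF f] gen_adjoint[OF coeffsD(1)[OF f]]] by simp
qed

definition real_part :: "('x \<Rightarrow> real) \<Rightarrow> real" where
  "real_part u = Re (\<phi> (gen 0 (\<lambda>x. complex_of_real (u x))))"

lemma state_gen_add:
  assumes "f \<in> coeffs g" "k \<in> coeffs g"
  shows "\<phi> (gen g (\<lambda>x. f x + k x)) = \<phi> (gen g f) + \<phi> (gen g k)"
  using assms by (simp add: gen_add coeffsD \<phi>_simps gen_A)

lemma state_gen_cmult: "f \<in> coeffs g \<Longrightarrow> \<phi> (gen g (\<lambda>x. c * f x)) = c * \<phi> (gen g f)"
  by (simp add: gen_cmult coeffsD \<phi>_simps gen_A)

lemma state_gen_real:
  assumes u: "u \<in> C0r Y"
  shows "\<phi> (gen 0 (\<lambda>x. complex_of_real (u x))) = of_real (real_part u)"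
proof -
  let ?p = "\<lambda>x. max (u x) 0" and ?q = "\<lambda>x. max (- u x) 0"
  have q: "?q \<in> C0r Y" using C0r_max[OF C0r_cmult[OF u, of "- 1"] C0r_zero] by simp
  have p: "?p \<in> C0r Y" by (rule C0r_max[OF u C0r_zero])
  have "(\<lambda>x. complex_of_real (?p x)) = (\<lambda>x. complex_of_real (u x) + complex_of_real (?q x))"
    by (auto simp: max_def)
  then have "\<phi> (gen 0 (\<lambda>x. complex_of_real (?p x))) =
      \<phi> (gen 0 (\<lambda>x. complex_of_real (u x))) + \<phi> (gen 0 (\<lambda>x. complex_of_real (?q x)))"
    using state_gen_add[OF C0r_Y[THEN iffD1, OF u] C0r_Y[THEN iffD1, OF q]] by (simp only:)
  then have "Im (\<phi> (gen 0 (\<lambda>x. complex_of_real (u x)))) = 0"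
    using state_gen_nonneg[OF p] state_gen_nonneg[OF q] by (auto simp: complex_nonneg_Reals_iff complex_eq_iff)
  then show ?thesis by (simp add: real_part_def complex_eq_iff)
qed

lemma C0_functional_real_part: "C0_functional Y real_part"
proof
  show "locally_compact_space (euclidean :: 'x topology)" "open Y" by (fact lc open_Y)+
  fix f assume f: "f \<in> C0r Y"
  note fc = C0r_Y[THEN iffD1, OF f]
  show "real_part (\<lambda>x. f x + g x) = real_part f + real_part g" if "g \<in> C0r Y" for g
    using state_gen_add[OF fc C0r_Y[THEN iffD1, OF that]] by (simp add: real_part_def)
  show "real_part (\<lambda>x. c * f x) = c * real_part f" for c
    using state_gen_cmult[OF fc, of "of_real c"] by (simp add: real_part_def)
  assume nn: "\<And>x. 0 \<le> f x"
  show "0 \<le> real_part f"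
    using state_gen_nonneg[OF f nn] by (simp add: real_part_def complex_nonneg_Reals_iff)
  show "real_part f \<le> c" if "\<And>x. f x \<le> c" for c
  proof -
    have c: "0 \<le> c" using nn that order_trans by blast
    have "real_part f \<le> cmod (\<phi> (gen 0 (\<lambda>x. complex_of_real (f x))))"
      unfolding real_part_def by (rule complex_Re_le_cmod)
    also have "\<dots> \<le> norm (gen 0 (\<lambda>x. complex_of_real (f x)))" by (rule \<phi>_simps(3)[OF gen_A[OF fc]])
    also have "\<dots> \<le> c" by (rule norm_gen_le[OF coeffsD(1)[OF fc] c]) (simp add: nn that)
    finally show ?thesis .
  qed
qed

text \<open>Expanding positivity at x + c y for all complex \<open>c\<close> yields the hypothesis
  of \<open>null_vector_orthogonal\<close>; no completion to a Hilbert space is formed.\<close>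

lemma state_orthogonal:
  assumes x: "x \<in> A" "is_adjoint x x'" "x' \<in> A" and y: "y \<in> A" "is_adjoint y y'" "y' \<in> A"
    and null: "\<phi> (x' o\<^sub>L x) = 0 \<or> \<phi> (y' o\<^sub>L y) = 0"
  shows "\<phi> (x' o\<^sub>L y) = 0"
proof (rule null_vector_orthogonal[OF _ state_positive[OF y(1,2)] null])
  fix c
  have "(x' + cnj c *\<^sub>C y') o\<^sub>L (x + c *\<^sub>C y) =
      ((x' o\<^sub>L x) + c *\<^sub>C (x' o\<^sub>L y)) + (cnj c *\<^sub>C (y' o\<^sub>L x) + (cnj c * c) *\<^sub>C (y' o\<^sub>L y))"
    by (simp add: linear_add[OF compose_left_linear] linear_add[OF compose_right_linear]
        scaleC_compose_left A_compose_scaleC x y scaleC_add_right scaleC_scaleC)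
  then have "\<phi> ((x' + cnj c *\<^sub>C y') o\<^sub>L (x + c *\<^sub>C y)) =
      \<phi> (x' o\<^sub>L x) + c * \<phi> (x' o\<^sub>L y) + (cnj c * \<phi> (y' o\<^sub>L x) + (cnj c * c) * \<phi> (y' o\<^sub>L y))"
    by (simp add: \<phi>_simps A_compose A_add A_scaleC x y)
  moreover have "\<phi> ((x' + cnj c *\<^sub>C y') o\<^sub>L (x + c *\<^sub>C y)) \<in> \<real>\<^sub>\<ge>\<^sub>0"
    by (intro state_positive A_add A_scaleC is_adjoint_add is_adjoint_scaleC x y)
  ultimately show "\<phi> (x' o\<^sub>L x) + c * \<phi> (x' o\<^sub>L y) + cnj c * \<phi> (y' o\<^sub>L x) + (cnj c * c) * \<phi> (y' o\<^sub>L y) \<in> \<real>\<^sub>\<ge>\<^sub>0"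
    by (simp add: add.assoc)
qed

text \<open>With w = sqrt(u) u_g the function \<open>u\<close> is w w*, and w* sits over
  \<open>- g\<close>, where \<open>N\<close> is below 1. The support condition on \<open>u\<close>
  is what puts w in the algebra.\<close>

lemma state_growing:
  assumes u: "u \<in> C0r (dom g)" "\<And>x. 0 \<le> u x" and g: "1 < N g"
  shows "\<phi> (gen 0 (\<lambda>x. complex_of_real (u x))) = 0"
proof -
  let ?f = "\<lambda>x. complex_of_real (sqrt (u x))"
  have f: "?f \<in> coeffs g" by (rule sqrt_coeffs[OF u])
  have b: "(\<lambda>x. ?f (act g x)) \<in> coeffs (- g)" using coeffs_adjoint[OF f] by simp
  have N: "N (- g) < 1" using g by (simp add: N_uminus inverse_less_1_iff)
  have sq: "complex_of_real (sqrt (u x)) * complex_of_real (sqrt (u x)) = complex_of_real (u x)" for x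
    using u(2)[of x] by (simp flip: of_real_mult)
  have "\<phi> (gen g ?f o\<^sub>L gen (- g) (\<lambda>x. ?f (act g x))) = 0"
    by (rule ground_annihilates[OF gen_A[OF f] gen_A[OF b] N dynamics_gen[OF b]])
  then show ?thesis
    by (simp add: gen_compose coeffsD(1)[OF f] coeffsD(1)[OF b] sq)
qed

lemma ground_representation: "\<exists>\<mu>\<in>prob_measures_on Y Z. induced_functional A \<mu> = \<phi>"
proof -
  interpret L: C0_functional Y real_part by (rule C0_functional_real_part)
  obtain \<mu> where sp: "space \<mu> = Y" and se: "sets \<mu> = sets (restrict_space borel Y)" and le: "emeasure \<mu> Y \<le> 1"
    and int: "\<And>f. f \<in> C0r Y \<Longrightarrow> integrable \<mu> f" and rep: "\<And>f. f \<in> C0r Y \<Longrightarrow> integral\<^sup>L \<mu> f = real_part f"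
    using L.riesz_representation by metis
  interpret finite_measure \<mu>
    by (rule finite_measureI) (use sp le in \<open>auto simp: top_unique\<close>)
  \<comment> \<open>Only an upper bound on the mass is available so far; it suffices to make
    \<open>expect \<mu>\<close> contractive.\<close>
  have mle: "measure \<mu> (space \<mu>) \<le> 1" using le sp by (simp add: measure_def enn2real_leI)
  note E = contractive_expect[OF finite_measure_axioms se mle]
  have real: "\<phi> (gen 0 (\<lambda>x. complex_of_real (u x))) = of_real (integral\<^sup>L \<mu> u)" if "u \<in> C0r Y" for u
    using state_gen_real[OF that] rep[OF that] by simp
  \<comment> \<open>Each \<open>dom g\<close> with \<open>1 < N g\<close> is exhausted by countably
    many positivity sets, each null because its function has integral zero; countability of the
    group then allows all such \<open>g\<close> at once.\<close>
  have "AE x in \<mu>. \<forall>g\<in>{g. 1 < N g}. x \<notin> dom g"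
  proof (rule AE_ball_countable')
    fix g assume "g \<in> {g. 1 < N g}"
    then have g: "1 < N g" by simp
    obtain f :: "nat \<Rightarrow> 'x \<Rightarrow> real" where f: "\<And>n. f n \<in> C0r (dom g)" "\<And>n x. 0 \<le> f n x"
      "\<And>n x. f n x \<le> 1" "dom g = (\<Union>n. {x. 0 < f n x})"
      by (rule open_countable_C0r[OF lc open_dom]) blast
    have "AE x in \<mu>. f n x = 0" for n
    proof -
      have fY: "f n \<in> C0r Y" by (rule C0r_mono[OF _ f(1)]) (auto simp: dom_def)
      have "integral\<^sup>L \<mu> (f n) = 0" using real[OF fY] state_growing[OF f(1,2) g] by simp
      then show ?thesis using integral_nonneg_eq_0_iff_AE[OF int[OF fY]] f(2) by simp
    qed
    then have "AE x in \<mu>. \<forall>n. f n x = 0" by (simp add: AE_all_countable)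
    then show "AE x in \<mu>. x \<notin> dom g" by (rule AE_mp) (auto simp: f(4))
  qed simp
  then have AEZ: "AE x in \<mu>. x \<in> Z"
  proof (rule AE_mp, intro AE_I2 impI)
    fix x assume "x \<in> space \<mu>" "\<forall>g\<in>{g. 1 < N g}. x \<notin> dom g"
    then show "x \<in> Z" using Diff_Z sp by blast
  qed
  have complex: "\<phi> (gen 0 f) = expect \<mu> (gen 0 f)" if f: "f \<in> coeffs 0" for f
  proof -
    have fC: "f \<in> C0" by (rule coeffsD(1)[OF f])
    have cf: "continuous_on UNIV f" by (rule C0_continuous[OF fC])
    have "(\<lambda>x. complex_of_real (Re (f x))) \<in> C0"
    proof (rule C0_dominated[OF fC fC continuous_on_of_real[OF continuous_on_Re[OF cf]], of 1])
      show "cmod (complex_of_real (Re (f x))) \<le> 1 * (cmod (f x) + cmod (f x))" for x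
        unfolding norm_of_real by (rule order_trans[OF abs_Re_le_cmod]) simp
    qed
    then have re: "(\<lambda>x. Re (f x)) \<in> C0r Y" using coeffsD(2)[OF f] by (simp add: C0r_def dom_zero)
    have "(\<lambda>x. complex_of_real (Im (f x))) \<in> C0"
    proof (rule C0_dominated[OF fC fC continuous_on_of_real[OF continuous_on_Im[OF cf]], of 1])
      show "cmod (complex_of_real (Im (f x))) \<le> 1 * (cmod (f x) + cmod (f x))" for x
        unfolding norm_of_real by (rule order_trans[OF abs_Im_le_cmod]) simp
    qed
    then have im: "(\<lambda>x. Im (f x)) \<in> C0r Y" using coeffsD(2)[OF f] by (simp add: C0r_def dom_zero)
    note rc = C0r_Y[THEN iffD1, OF re] and ic = C0r_Y[THEN iffD1, OF im]
    have dec: "f = (\<lambda>x. complex_of_real (Re (f x)) + \<i> * complex_of_real (Im (f x)))"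
      using complex_eq by auto
    have "\<phi> (gen 0 f) = of_real (integral\<^sup>L \<mu> (\<lambda>x. Re (f x))) + \<i> * of_real (integral\<^sup>L \<mu> (\<lambda>x. Im (f x)))"
      by (subst dec, subst state_gen_add[OF rc coeffs_cmult[OF ic]])
        (simp add: state_gen_cmult[OF ic] real[OF re] real[OF im])
    also have "\<dots> = integral\<^sup>L \<mu> f"
      by (subst (3) dec) (simp add: int[OF re] int[OF im] integral_complex_of_real)
    finally show ?thesis by (simp add: expect_def cond_exp_gen[OF fC])
  qed
  have off: "\<phi> (gen g f) = 0" if f: "f \<in> coeffs g" and g: "g \<noteq> 0" for g f
  proof -
    \<comment> \<open>Cauchy-Schwarz with x = k1 and y = k2 u_g, so that x* y = k u_g. Here x* x =
      |k1|^2 has integral zero when \<open>k\<close> vanishes on \<open>Z\<close>, and y* y is the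
      function |k2(g .)|^2, with integral zero when \<open>k\<close> vanishes on gZ.\<close>
    have van: "\<phi> (gen g k) = 0"
      if k: "k \<in> coeffs g" and v: "(\<forall>x\<in>Z. k x = 0) \<or> (\<forall>x\<in>Z. k (act g x) = 0)" for k
    proof -
      obtain k1 k2 where kk: "k1 \<in> C0" "k2 \<in> C0" "\<And>x. k x = k1 x * k2 x" "\<And>x. cnj (k1 x) = k1 x"
        "\<And>x. cmod (k1 x) = sqrt (cmod (k x))" "\<And>x. cmod (k2 x) = sqrt (cmod (k x))"
        by (rule C0_factorization[OF coeffsD(1)[OF k]]) blast
      have k1: "k1 \<in> coeffs 0" and k2: "k2 \<in> coeffs g"
        using kk coeffsD(2)[OF k] by (auto simp: coeffs_def dom_zero) (metis dom_def mem_Collect_eq norm_eq_zero real_sqrt_zero)+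
      let ?x = "gen 0 k1" and ?y = "gen g k2"
      let ?x' = "gen (- 0) (\<lambda>x. cnj (k1 (act 0 x)))" and ?y' = "gen (- g) (\<lambda>x. cnj (k2 (act g x)))"
      have sq1: "\<phi> (?x' o\<^sub>L ?x) = integral\<^sup>L \<mu> (\<lambda>x. cnj (k1 x) * k1 x)"
        unfolding gen_square[OF k1]
        using complex[of "\<lambda>x. cnj (k1 x) * k1 x"] coeffs_compose[OF coeffs_adjoint[OF k1] k1]
        by (simp add: act_zero expect_def cond_exp_gen coeffsD)
      have sq2: "\<phi> (?y' o\<^sub>L ?y) = integral\<^sup>L \<mu> (\<lambda>x. cnj (k2 (act g x)) * k2 (act g x))"
        unfolding gen_square[OF k2]
        using complex[of "\<lambda>x. cnj (k2 (act g x)) * k2 (act g x)"] coeffs_compose[OF coeffs_adjoint[OF k2] k2]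
        by (simp add: expect_def cond_exp_gen coeffsD)
      have "\<phi> (?x' o\<^sub>L ?x) = 0 \<or> \<phi> (?y' o\<^sub>L ?y) = 0"
        using v
      proof
        assume "\<forall>x\<in>Z. k x = 0"
        then have "k1 x = 0" if "x \<in> Z" for x using kk(5)[of x] that by simp
        then have "AE x in \<mu>. cnj (k1 x) * k1 x = 0" using AEZ by (auto elim: eventually_mono)
        then show ?thesis unfolding sq1 by (simp add: integral_eq_zero_AE)
      next
        assume "\<forall>x\<in>Z. k (act g x) = 0"
        then have "k2 (act g x) = 0" if "x \<in> Z" for x using kk(6)[of "act g x"] that by simp
        then have "AE x in \<mu>. cnj (k2 (act g x)) * k2 (act g x) = 0" using AEZ by (auto elim: eventually_mono)
        then show ?thesis unfolding sq2 by (simp add: integral_eq_zero_AE)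
      qed
      then have "\<phi> (?x' o\<^sub>L ?y) = 0"
        by (rule state_orthogonal[OF gen_A[OF k1] gen_adjoint[OF kk(1)] gen_A[OF coeffs_adjoint[OF k1]]
              gen_A[OF k2] gen_adjoint[OF kk(2)] gen_A[OF coeffs_adjoint[OF k2]]])
      moreover have "?x' o\<^sub>L ?y = gen g k"
      proof -
        have "k = (\<lambda>x. k1 x * k2 x)" using kk(3) by auto
        then show ?thesis using gen_compose[OF kk(1,2), of 0 g] by (simp add: act_zero kk(4))
      qed
      ultimately show ?thesis by simp
    qed
    \<comment> \<open>The translate gZ, written as a preimage so that it is visibly closed. The
      cut-off \<open>\<theta>\<close> separates it from \<open>Z\<close>: \<open>?f1\<close>
      vanishes on \<open>Z\<close> and \<open>?f2\<close> on \<open>?T\<close>.\<close>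
    let ?T = "{x. act (- g) x \<in> Z}"
    have "Z \<inter> ?T = {}"
    proof (rule ccontr)
      assume "Z \<inter> ?T \<noteq> {}"
      then obtain x where "x \<in> Z" "act (- g) x \<in> Z" by auto
      then have "act g ` Z \<inter> Z \<noteq> {}" by (metis IntI act_cancel(2) empty_iff imageI)
      then show False using free g by blast
    qed
    then obtain \<theta> :: "'x \<Rightarrow> real" where \<theta>: "continuous_on UNIV \<theta>" "\<And>x. 0 \<le> \<theta> x" "\<And>x. \<theta> x \<le> 1"
      "\<And>x. x \<in> Z \<Longrightarrow> \<theta> x = 0" "\<And>x. x \<in> ?T \<Longrightarrow> \<theta> x = 1"
      by (rule Urysohn_locally_compact[OF lc closed_Z closed_act_vimage[OF closed_Z]]) blast
    let ?f1 = "\<lambda>x. complex_of_real (\<theta> x) * f x" and ?f2 = "\<lambda>x. complex_of_real (1 - \<theta> x) * f x"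
    have f1: "?f1 \<in> coeffs g"
      using C0_bounded_mult[OF coeffsD(1)[OF f] continuous_on_of_real[OF \<theta>(1)], of 1] \<theta>(2,3) coeffsD(2)[OF f]
      by (simp add: coeffs_def)
    have "?f2 \<in> C0"
    proof (rule C0_bounded_mult[OF coeffsD(1)[OF f], of _ 1])
      show "continuous_on UNIV (\<lambda>x. complex_of_real (1 - \<theta> x))"
        by (intro continuous_on_of_real continuous_on_diff continuous_on_const \<theta>(1))
      show "cmod (complex_of_real (1 - \<theta> x)) \<le> 1" for x
        unfolding norm_of_real using \<theta>(2,3)[of x] by simp
    qed
    then have f2: "?f2 \<in> coeffs g" using coeffsD(2)[OF f] by (simp add: coeffs_def)
    have "f = (\<lambda>x. ?f1 x + ?f2 x)" by (auto simp: algebra_simps)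
    then have "\<phi> (gen g f) = \<phi> (gen g ?f1) + \<phi> (gen g ?f2)" using state_gen_add[OF f1 f2] by simp
    also have "\<dots> = 0" using van[OF f1] van[OF f2] \<theta>(4,5) by simp
    finally show ?thesis .
  qed
  have eq: "\<phi> a = expect \<mu> a" if "a \<in> A" for a
  proof (rule contractive_eqI[OF contractive_state E _ that])
    fix g f assume f: "f \<in> coeffs g"
    show "\<phi> (gen g f) = expect \<mu> (gen g f)"
    proof (cases "g = 0")
      case True
      then show ?thesis using complex f by simp
    next
      case False
      then show ?thesis using off[OF f False] by (simp add: expect_def cond_exp_gen[OF coeffsD(1)[OF f]])
    qed
  qed
  \<comment> \<open>On the unit ball the formula bounds |\<phi>(a)| by the mass of
    \<open>\<mu>\<close>, while the supremum there is 1 by the definition of a state.\<close>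
  have "1 \<le> measure \<mu> (space \<mu>)"
  proof -
    have "(SUP a\<in>{a \<in> A. norm a \<le> 1}. cmod (\<phi> a)) \<le> measure \<mu> (space \<mu>)"
    proof (rule cSUP_least)
      show "{a \<in> A. norm a \<le> 1} \<noteq> {}" using A_zero by (auto intro!: exI[of _ 0])
      fix a assume a: "a \<in> {a \<in> A. norm a \<le> 1}"
      then have "cmod (\<phi> a) \<le> measure \<mu> (space \<mu>) * norm a"
        using eq cmod_expect_le[OF finite_measure_axioms se] by simp
      also have "\<dots> \<le> measure \<mu> (space \<mu>) * 1" using a by (intro mult_left_mono) auto
      finally show "cmod (\<phi> a) \<le> measure \<mu> (space \<mu>)" by simp
    qed
    then show ?thesis using state unfolding state_on_def by simp
  qed
  then have "prob_space \<mu>" using mle by (intro prob_spaceI) (simp add: emeasure_eq_measure)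
  moreover have "emeasure \<mu> (Y - Z) = 0"
  proof -
    have "{x \<in> space \<mu>. \<not> x \<in> Z} = Y - Z" using sp by auto
    moreover have "Y - Z \<in> sets \<mu>" using sets.top[of \<mu>] sp se Z_sets by auto
    ultimately show ?thesis using AE_iff_measurable[of "Y - Z" \<mu> "\<lambda>x. x \<in> Z"] AEZ by simp
  qed
  ultimately have "\<mu> \<in> prob_measures_on Y Z" using sp se by (simp add: prob_measures_on_def)
  moreover have "induced_functional A \<mu> = \<phi>"
    using eq state_zero by (auto simp: induced_functional_def expect_def)
  ultimately show ?thesis by blast
qed

end

section \<open>Injectivity, affinity and the bijection\<close>

lemma induced_functional_inj: "inj_on (induced_functional A) (prob_measures_on Y Z)"
proof (rule inj_onI)
  fix \<mu> \<nu> assume \<mu>: "\<mu> \<in> prob_measures_on Y Z" and \<nu>: "\<nu> \<in> prob_measures_on Y Z"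
    and eq: "induced_functional A \<mu> = induced_functional A \<nu>"
  have int: "integral\<^sup>L \<mu> u = integral\<^sup>L \<nu> u" if "u \<in> C0r Y" for u
  proof -
    note f = C0r_Y[THEN iffD1, OF that]
    have "induced_functional A \<rho> (gen 0 (\<lambda>x. complex_of_real (u x))) = of_real (integral\<^sup>L \<rho> u)" for \<rho>
      by (simp add: induced_functional_def gen_A[OF f] cond_exp_gen[OF coeffsD(1)[OF f]])
    then have "complex_of_real (integral\<^sup>L \<mu> u) = of_real (integral\<^sup>L \<nu> u)" using eq by metis
    then show ?thesis by (simp only: of_real_eq_iff)
  qed
  note M = prob_\<mu>[OF \<mu>] space_\<mu>[OF \<mu>] sets_\<mu>[OF \<mu>]
  note N = prob_\<mu>[OF \<nu>] space_\<mu>[OF \<nu>] sets_\<mu>[OF \<nu>]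
  have fm: "finite_measure \<mu>" "finite_measure \<nu>" using M(1) N(1) by (simp_all add: prob_space.finite_measure)
  \<comment> \<open>Equal integrals on \<open>C0r Y\<close> pass to open subsets of \<open>Y\<close>
    by dominated convergence along an exhaustion of the indicator.\<close>
  have op: "measure \<mu> V = measure \<nu> V" if V: "open V" "V \<subseteq> Y" for V
  proof -
    obtain g :: "nat \<Rightarrow> 'x \<Rightarrow> real" where g: "\<And>n. g n \<in> C0r V" "\<And>n x. 0 \<le> g n x" "\<And>n x. g n x \<le> 1"
      "\<And>x. (\<lambda>n. g n x) \<longlonglongrightarrow> indicator V x"
      by (rule C0r_exhaustion[OF lc V(1)]) blast
    have "(\<lambda>n. integral\<^sup>L \<mu> (g n)) \<longlonglongrightarrow> measure \<mu> V"
      by (rule integral_indicator_limit[OF fm(1) M(2,3) V g])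
    moreover have "(\<lambda>n. integral\<^sup>L \<nu> (g n)) \<longlonglongrightarrow> measure \<nu> V"
      by (rule integral_indicator_limit[OF fm(2) N(2,3) V g])
    moreover have "integral\<^sup>L \<mu> (g n) = integral\<^sup>L \<nu> (g n)" for n
      by (rule int[OF C0r_mono[OF V(2) g(1)]])
    ultimately show ?thesis using LIMSEQ_unique by simp
  qed
  have id: "(\<lambda>x. x) \<in> measurable \<rho> borel" if "sets \<rho> = sets (restrict_space borel Y)" for \<rho> :: "'x measure"
    by (rule measurable_restrict[OF that]) simp
  have dist: "emeasure (distr \<rho> borel (\<lambda>x. x)) B = emeasure \<rho> (Y \<inter> B)"
    if "space \<rho> = Y" "sets \<rho> = sets (restrict_space borel Y)" "B \<in> sets borel" for \<rho> :: "'x measure" and B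
    using emeasure_distr[OF id[OF that(2)] that(3)] that(1) by (simp add: Int_commute)
  \<comment> \<open>The measures live on the trace of the Borel sets on \<open>Y\<close>. Their
    images on \<open>borel\<close> are compared on the intersection-stable generator of open sets,
    and the values at \<open>Y \<inter> B\<close> recover the original measures.\<close>
  have "distr \<mu> borel (\<lambda>x. x) = distr \<nu> borel (\<lambda>x. x)"
  proof (rule measure_eqI_generator_eq[where E = "{S. open S}" and \<Omega> = UNIV and A = "\<lambda>_. UNIV"])
    fix V :: "'x set" assume V: "V \<in> {S. open S}"
    have "measure \<mu> (Y \<inter> V) = measure \<nu> (Y \<inter> V)" using V open_Y by (intro op) auto
    then show "emeasure (distr \<mu> borel (\<lambda>x. x)) V = emeasure (distr \<nu> borel (\<lambda>x. x)) V"
      using V fm by (simp add: dist M(2,3) N(2,3) finite_measure.emeasure_eq_measure)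
  next
    show "emeasure (distr \<mu> borel (\<lambda>x. x)) UNIV \<noteq> \<infinity>"
      using fm(1) by (simp add: dist M(2,3) finite_measure.emeasure_eq_measure)
  qed (auto simp: Int_stable_def borel_def)
  then have "emeasure \<mu> (Y \<inter> B) = emeasure \<nu> (Y \<inter> B)" if "B \<in> sets borel" for B
    using dist[OF M(2,3) that] dist[OF N(2,3) that] by simp
  then show "\<mu> = \<nu>"
    by (intro measure_eqI) (auto simp: M(3) N(3) sets_restrict_space)
qed

lemma induced_functional_mixture:
  assumes \<mu>: "\<mu> \<in> prob_measures_on Y Z" and \<nu>: "\<nu> \<in> prob_measures_on Y Z" and t: "t \<in> {0..1}"
  shows "induced_functional A (mixture t \<mu> \<nu>) =
    (\<lambda>a. complex_of_real t * induced_functional A \<mu> a + complex_of_real (1 - t) * induced_functional A \<nu> a)"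
proof
  fix a
  note M = prob_\<mu>[OF \<mu>] space_\<mu>[OF \<mu>] sets_\<mu>[OF \<mu>]
  note N = prob_\<mu>[OF \<nu>] space_\<mu>[OF \<nu>] sets_\<mu>[OF \<nu>]
  have P: "prob_space (mixture t \<mu> \<nu>)"
    by (rule prob_\<mu>[OF mixture_prob_measures_on[OF \<mu> \<nu> t Z_sets]])
  have s: "sets \<nu> = sets \<mu>" using M(3) N(3) by simp
  show "induced_functional A (mixture t \<mu> \<nu>) a =
      complex_of_real t * induced_functional A \<mu> a + complex_of_real (1 - t) * induced_functional A \<nu> a"
  proof (cases "a \<in> A")
    case True
    have m: "cond_exp a \<in> borel_measurable \<mu>"
      by (rule measurable_restrict[OF M(3) borel_measurable_cond_exp[OF True]])
    show ?thesis
      using integral_mixture[OF M(1) N(1) P s t m cmod_cond_exp_le] True by (simp add: induced_functional_def)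
  qed (simp add: induced_functional_def)
qed

lemma ground_states_bij:
  "bij_betw (induced_functional A) (prob_measures_on Y Z) (ground_states A (dynamics N))"
  unfolding bij_betw_def
proof (intro conjI induced_functional_inj antisym subsetI)
  fix \<phi> assume "\<phi> \<in> induced_functional A ` prob_measures_on Y Z"
  then show "\<phi> \<in> ground_states A (dynamics N)" using ground_expect by auto
next
  fix \<phi> assume "\<phi> \<in> ground_states A (dynamics N)"
  from ground_representation[OF this] show "\<phi> \<in> induced_functional A ` prob_measures_on Y Z" by blast
qed

end

theorem proposition1p3:
  fixes act :: "'g::{group_add, countable} \<Rightarrow> 'x::{t2_space, second_countable_topology} \<Rightarrow> 'x"
    and Y :: "'x set" and N :: "'g \<Rightarrow> real"
  assumes "locally_compact_space (euclidean :: 'x topology)"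
    and "continuous_action act"
    and "open Y" and "closed Y" and "(\<Union>g. act g ` Y) = UNIV"
    and "\<And>g. N g > 0" and "\<And>g h. N (g + h) = N g * N h"
    and "\<And>g. act g ` Y0 act Y N \<inter> Y0 act Y N \<noteq> {} \<Longrightarrow> g = 0"
  shows "bij_betw (induced_functional (reduced_algebra act Y))
           (prob_measures_on Y (Y0 act Y N))
           (ground_states (reduced_algebra act Y) (dynamics N)) \<and>
         (\<forall>\<mu>\<in>prob_measures_on Y (Y0 act Y N). \<forall>\<nu>\<in>prob_measures_on Y (Y0 act Y N). \<forall>t\<in>{0..1}.
           induced_functional (reduced_algebra act Y) (mixture t \<mu> \<nu>) =
             (\<lambda>a. complex_of_real t * induced_functional (reduced_algebra act Y) \<mu> a
                + complex_of_real (1 - t) * induced_functional (reduced_algebra act Y) \<nu> a))"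
proof -
  interpret ground_setup act Y N by unfold_locales (fact assms)+
  show ?thesis using ground_states_bij induced_functional_mixture by blast
qed

end
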